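(* Let $k$ be a field. If $A$ is a finitely generated $k$-algebra or a $*$-algebra of finite $*$-type over $k$, then $A$ is special if and only if $A$ is essential.
   Context: All rings are commutative and unital. The algebraic signature $\mathcal D$ of $k$ is the set of all polynomials in finitely many variables over $k$ which have no zero rational in $k$. For a $k$-algebra $A$, $M_A=\{D(\bar a): D\in\mathcal D,\ \bar a \text{ an appropriate tuple from } A\}$ (a multiplicative subset) and the canonical localisation of $A$ is $A_M:=M_A^{-1}A$. A $*$-algebra is a $k$-algebra $A$ in which every element of $M_A$ is invertible. A $*$-algebra has finite $*$-type if it is isomorphic to the canonical localisation of a finitely generated $k$-algebra. The homogeneous signature $\mathcal H$ of $k$ is the set of all non-zero homogeneous polynomials $P(\bar X,Y)$ over $k$ in finitely many variables $\bar X=(X_1,\ldots,X_n)$ and a distinguished variable $Y$ such that for all $\bar a\in k^n$ and $b\in k$, $P(\bar a,b)=0$ implies $b=0$. A $k$-algebra $A$ is special if for all $P(\bar X,Y)\in\mathcal H$ and $\bar a,b$ from $A$ such that $P(\bar a,b)=0$, we have $b=0$. A $k$-algebra $A$ is essential if it embeds as a $k$-algebra into a power $k^S$ of $k$ ($S$ a set, possibly empty). *)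

theory Defs
  imports "HOL-Algebra.Module" "HOL-Algebra.Generated_Rings" "HOL-Algebra.Indexed_Polynomials"
begin

text \<open>
  A \<open>k\<close>-algebra is a structure \<open>A\<close> with \<open>algebra K A\<close>; both sides are commutative and unital,
  and \<open>A\<close> may be the zero ring. Polynomials over \<open>K\<close> are those of
  \<^theory>\<open>HOL-Algebra.Indexed_Polynomials\<close>: functions from monomials (multisets of variable
  indices) to coefficients, with \<open>ring.indexed_pset K I (carrier K)\<close> the polynomials over \<open>K\<close>
  in the variables indexed by \<open>I\<close>.
\<close>

section \<open>Algebras and homomorphisms\<close>

definition alg_hom ::
    "('k, 'm) ring_scheme \<Rightarrow> ('k, 'a, 'n) module_scheme \<Rightarrow> ('k, 'b, 'p) module_scheme \<Rightarrow> ('a \<Rightarrow> 'b) set"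
  where "alg_hom K A B =
    {f \<in> ring_hom A B. \<forall>c\<in>carrier K. \<forall>x\<in>carrier A. f (c \<odot>\<^bsub>A\<^esub> x) = c \<odot>\<^bsub>B\<^esub> f x}"

definition alg_isomorphic ::
    "('k, 'm) ring_scheme \<Rightarrow> ('k, 'a, 'n) module_scheme \<Rightarrow> ('k, 'b, 'p) module_scheme \<Rightarrow> bool"
  where "alg_isomorphic K A B \<longleftrightarrow> (\<exists>f\<in>alg_hom K A B. bij_betw f (carrier A) (carrier B))"

definition finitely_generated_algebra ::
    "('k, 'm) ring_scheme \<Rightarrow> ('k, 'a, 'n) module_scheme \<Rightarrow> bool"
  where "finitely_generated_algebra K A \<longleftrightarrow> algebra K A \<and>
    (\<exists>F. finite F \<and> F \<subseteq> carrier A \<and>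
      generate_ring A ((\<lambda>c. c \<odot>\<^bsub>A\<^esub> \<one>\<^bsub>A\<^esub>) ` carrier K \<union> F) = carrier A)"

definition scalar_algebra :: "('k, 'm) ring_scheme \<Rightarrow> ('k, 'k) module"
  where "scalar_algebra K =
    \<lparr>carrier = carrier K, monoid.mult = monoid.mult K, one = \<one>\<^bsub>K\<^esub>, zero = \<zero>\<^bsub>K\<^esub>, add = add K, smult = monoid.mult K\<rparr>"

definition power_algebra :: "('k, 'm) ring_scheme \<Rightarrow> 's set \<Rightarrow> ('k, 's \<Rightarrow> 'k) module"
  where "power_algebra K S =
    \<lparr>carrier = S \<rightarrow>\<^sub>E carrier K,
     monoid.mult = (\<lambda>f g. \<lambda>s\<in>S. f s \<otimes>\<^bsub>K\<^esub> g s),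
     one = (\<lambda>s\<in>S. \<one>\<^bsub>K\<^esub>),
     zero = (\<lambda>s\<in>S. \<zero>\<^bsub>K\<^esub>),
     add = (\<lambda>f g. \<lambda>s\<in>S. f s \<oplus>\<^bsub>K\<^esub> g s),
     smult = (\<lambda>c f. \<lambda>s\<in>S. c \<otimes>\<^bsub>K\<^esub> f s)\<rparr>"

section \<open>Evaluation of polynomials\<close>

definition poly_eval ::
    "('k, 'm) ring_scheme \<Rightarrow> ('k, 'a, 'n) module_scheme \<Rightarrow> ('i multiset \<Rightarrow> 'k) \<Rightarrow> ('i \<Rightarrow> 'a) \<Rightarrow> 'a"
  where "poly_eval K A P a =
    (\<Oplus>\<^bsub>A\<^esub>m\<in>{m. P m \<noteq> \<zero>\<^bsub>K\<^esub>}. P m \<odot>\<^bsub>A\<^esub> (\<Otimes>\<^bsub>A\<^esub>i\<in>set_mset m. a i [^]\<^bsub>A\<^esub> count m i))"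

text \<open>The sum in \<open>poly_eval\<close> is never over an infinite set.\<close>

lemma indexed_pset_finite_support:
  assumes "ring K" and "P \<in> ring.indexed_pset K I (carrier K)"
  shows "finite {m. P m \<noteq> \<zero>\<^bsub>K\<^esub>}"
proof -
  interpret K: ring K by fact
  from assms(2) show ?thesis
  proof induction
    case (indexed_const k)
    have "{m. K.indexed_const k m \<noteq> \<zero>\<^bsub>K\<^esub>} \<subseteq> {{#}}"
      by (auto simp: K.indexed_const_def)
    then show ?case by (rule finite_subset) simp
  next
    case (indexed_padd P Q)
    have "{m. K.indexed_padd P Q m \<noteq> \<zero>\<^bsub>K\<^esub>} \<subseteq> {m. P m \<noteq> \<zero>\<^bsub>K\<^esub>} \<union> {m. Q m \<noteq> \<zero>\<^bsub>K\<^esub>}"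
      by (auto simp: K.indexed_padd_def)
    then show ?case using indexed_padd.IH by (auto intro: finite_subset)
  next
    case (indexed_pmult P i)
    have "{m. K.indexed_pmult P i m \<noteq> \<zero>\<^bsub>K\<^esub>} \<subseteq> add_mset i ` {m. P m \<noteq> \<zero>\<^bsub>K\<^esub>}"
      by (auto simp: K.indexed_pmult_def image_iff split: if_splits)
        (metis insert_DiffM)
    then show ?case using indexed_pmult.IH by (auto intro: finite_subset)
  qed
qed

section \<open>The algebraic signature and canonical localisation\<close>

text \<open>The part of \<open>\<D>\<close> consisting of polynomials in the variables \<open>X\<^sub>0, \<dots>, X\<^sub>n\<^sub>-\<^sub>1\<close>.\<close>

definition algebraic_signature :: "('k, 'm) ring_scheme \<Rightarrow> nat \<Rightarrow> (nat multiset \<Rightarrow> 'k) set"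
  where "algebraic_signature K n =
    {P \<in> ring.indexed_pset K {..<n} (carrier K).
      \<forall>a \<in> {..<n} \<rightarrow> carrier K. poly_eval K (scalar_algebra K) P a \<noteq> \<zero>\<^bsub>K\<^esub>}"

definition signature_values ::
    "('k, 'm) ring_scheme \<Rightarrow> ('k, 'a, 'n) module_scheme \<Rightarrow> 'a set"
  where "signature_values K A =
    {poly_eval K A P a | n P a. P \<in> algebraic_signature K n \<and> a \<in> {..<n} \<rightarrow> carrier A}"

definition fraction_rel :: "('a, 'm) ring_scheme \<Rightarrow> 'a set \<Rightarrow> (('a \<times> 'a) \<times> ('a \<times> 'a)) set"
  where "fraction_rel A M =
    {((a, s), (b, t)). a \<in> carrier A \<and> s \<in> M \<and> b \<in> carrier A \<and> t \<in> M \<and>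
      (\<exists>u\<in>M. u \<otimes>\<^bsub>A\<^esub> (a \<otimes>\<^bsub>A\<^esub> t) = u \<otimes>\<^bsub>A\<^esub> (b \<otimes>\<^bsub>A\<^esub> s))}"

definition fraction :: "('a, 'm) ring_scheme \<Rightarrow> 'a set \<Rightarrow> 'a \<Rightarrow> 'a \<Rightarrow> ('a \<times> 'a) set"
  where "fraction A M a s = fraction_rel A M `` {(a, s)}"

text \<open>
  The localisation \<open>M\<^sup>-\<^sup>1A\<close> at a multiplicative subset \<open>M\<close> (containing 1, possibly containing 0).
  Each union is over all representatives and collapses to one class.
\<close>

definition localisation :: "('k, 'a, 'n) module_scheme \<Rightarrow> 'a set \<Rightarrow> ('k, ('a \<times> 'a) set) module"
  where "localisation A M =
    \<lparr>carrier = (carrier A \<times> M) // fraction_rel A M,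
     monoid.mult = (\<lambda>p q. \<Union>(a, s)\<in>p. \<Union>(b, t)\<in>q. fraction A M (a \<otimes>\<^bsub>A\<^esub> b) (s \<otimes>\<^bsub>A\<^esub> t)),
     one = fraction A M \<one>\<^bsub>A\<^esub> \<one>\<^bsub>A\<^esub>,
     zero = fraction A M \<zero>\<^bsub>A\<^esub> \<one>\<^bsub>A\<^esub>,
     add = (\<lambda>p q. \<Union>(a, s)\<in>p. \<Union>(b, t)\<in>q.
       fraction A M (a \<otimes>\<^bsub>A\<^esub> t \<oplus>\<^bsub>A\<^esub> b \<otimes>\<^bsub>A\<^esub> s) (s \<otimes>\<^bsub>A\<^esub> t)),
     smult = (\<lambda>c p. \<Union>(a, s)\<in>p. fraction A M (c \<odot>\<^bsub>A\<^esub> a) s)\<rparr>"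

definition canonical_localisation ::
    "('k, 'm) ring_scheme \<Rightarrow> ('k, 'a, 'n) module_scheme \<Rightarrow> ('k, ('a \<times> 'a) set) module"
  where "canonical_localisation K A = localisation A (signature_values K A)"

definition star_algebra :: "('k, 'm) ring_scheme \<Rightarrow> ('k, 'a, 'n) module_scheme \<Rightarrow> bool"
  where "star_algebra K A \<longleftrightarrow> algebra K A \<and> signature_values K A \<subseteq> Units A"

text \<open>
  HOL cannot quantify over the type of the finitely generated algebra inside a formula, so its
  type \<open>'b\<close> is a parameter. As this predicate is used as a hypothesis, a free \<open>'b\<close> in a theorem
  amounts to an existential quantification over all finitely generated algebras of all types.
\<close>

definition finite_star_type ::
    "'b itself \<Rightarrow> ('k, 'm) ring_scheme \<Rightarrow> ('k, 'a, 'n) module_scheme \<Rightarrow> bool"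
  where "finite_star_type _ K A \<longleftrightarrow> star_algebra K A \<and>
    (\<exists>B :: ('k, 'b) module. finitely_generated_algebra K B \<and>
      alg_isomorphic K A (canonical_localisation K B))"

section \<open>The homogeneous signature, special and essential algebras\<close>

definition homogeneous :: "('k, 'm) ring_scheme \<Rightarrow> ('i multiset \<Rightarrow> 'k) \<Rightarrow> bool"
  where "homogeneous K P \<longleftrightarrow> (\<exists>d. \<forall>m. P m \<noteq> \<zero>\<^bsub>K\<^esub> \<longrightarrow> size m = d)"

text \<open>
  The part of \<open>\<H>\<close> with \<open>n\<close> ordinary variables: these have indices \<open>0, \<dots>, n - 1\<close>, and the
  distinguished variable \<open>Y\<close> has index \<open>n\<close>. Thus \<open>P(a, b)\<close> is evaluation at \<open>a(n := b)\<close>.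
\<close>

definition homogeneous_signature :: "('k, 'm) ring_scheme \<Rightarrow> nat \<Rightarrow> (nat multiset \<Rightarrow> 'k) set"
  where "homogeneous_signature K n =
    {P \<in> ring.indexed_pset K {..n} (carrier K).
      P \<noteq> ring.indexed_const K \<zero>\<^bsub>K\<^esub> \<and> homogeneous K P \<and>
      (\<forall>a \<in> {..<n} \<rightarrow> carrier K. \<forall>b \<in> carrier K.
        poly_eval K (scalar_algebra K) P (a(n := b)) = \<zero>\<^bsub>K\<^esub> \<longrightarrow> b = \<zero>\<^bsub>K\<^esub>)}"

definition special :: "('k, 'm) ring_scheme \<Rightarrow> ('k, 'a, 'n) module_scheme \<Rightarrow> bool"
  where "special K A \<longleftrightarrow>
    (\<forall>n. \<forall>P \<in> homogeneous_signature K n. \<forall>a \<in> {..<n} \<rightarrow> carrier A. \<forall>b \<in> carrier A.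
      poly_eval K A P (a(n := b)) = \<zero>\<^bsub>A\<^esub> \<longrightarrow> b = \<zero>\<^bsub>A\<^esub>)"

text \<open>
  The index set \<open>S\<close> is taken in the type \<open>'a \<Rightarrow> 'k\<close>, which has room for all homomorphisms
  \<open>A \<rightarrow> k\<close>; \<open>essentialI\<close> below shows that this loses no generality.
\<close>

definition essential :: "('k, 'm) ring_scheme \<Rightarrow> ('k, 'a, 'n) module_scheme \<Rightarrow> bool"
  where "essential K A \<longleftrightarrow>
    (\<exists>(S :: ('a \<Rightarrow> 'k) set) f. f \<in> alg_hom K A (power_algebra K S) \<and> inj_on f (carrier A))"

lemma essentialI:
  fixes K :: "('k, 'm) ring_scheme" and A :: "('k, 'a, 'n) module_scheme" and S :: "'s set"
  assumes A: "algebra K A"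
    and f: "f \<in> alg_hom K A (power_algebra K S)" and inj: "inj_on f (carrier A)"
  shows "essential K A"
proof -
  interpret algebra K A by fact
  define T where "T = (\<lambda>s x. f x s) ` S"
  define g where "g = (\<lambda>x. \<lambda>h\<in>T. h x)"
  have f_in: "f x \<in> S \<rightarrow>\<^sub>E carrier K" if "x \<in> carrier A" for x
    using f that by (auto simp: alg_hom_def ring_hom_def power_algebra_def)
  have g: "g \<in> alg_hom K A (power_algebra K T)"
    using f f_in
    by (fastforce simp: alg_hom_def ring_hom_def power_algebra_def g_def T_def intro!: restrict_ext)
  have "inj_on g (carrier A)"
  proof (rule inj_onI)
    fix x y assume xy: "x \<in> carrier A" "y \<in> carrier A" "g x = g y"
    have "f x s = f y s" if "s \<in> S" for s
      using fun_cong[OF xy(3), of "\<lambda>x. f x s"] that by (auto simp: g_def T_def)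
    then have "f x = f y"
      using f_in[OF xy(1)] f_in[OF xy(2)] by (intro PiE_ext) auto
    then show "x = y" using inj xy by (auto dest: inj_onD)
  qed
  with g show ?thesis unfolding essential_def by blast
qed

end

theory Submission
  imports Defs "HOL-Algebra.Chinese_Remainder"
begin

text \<open>
  An algebra that embeds into a power of \<open>k\<close> is special because each coordinate is. For the converse let
  \<open>B = k[x\<^sub>1, \<dots>, x\<^sub>m]\<close> be finitely generated and let \<open>c\<close> be killed by all homomorphisms
  \<open>B \<rightarrow> k\<close>; it suffices to find \<open>P \<in> \<H>\<close> and a tuple \<open>a\<close> from \<open>B\<close> with \<open>P(a, c) = 0\<close>. If \<open>k\<close> is
  algebraically closed, then \<open>c\<close> is nilpotent by the Nullstellensatz, and \<open>P = Y\<^sup>d\<close> works. Otherwise a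
  polynomial without roots yields anisotropic forms over \<open>k\<close> in any number of variables. By
  Hilbert's basis theorem finitely many relations \<open>f\<^sub>i\<close> of the generators have the same zeros in
  \<open>k\<^sup>m\<close> as all of them. Write \<open>c = g(x)\<close> and apply an anisotropic form to the
  homogenisations, in a new variable \<open>Z\<close>, of the \<open>f\<^sub>i(X)\<close> and of \<open>g(X) - Y\<close>, and to \<open>Y\<^sup>2 - ZW\<close>: the result
  vanishes at \<open>X = x\<close>, \<open>Z = 1\<close>, \<open>W = c\<^sup>2\<close>, \<open>Y = c\<close>, and every zero over \<open>k\<close> with \<open>Y \<noteq> 0\<close> has
  \<open>Z \<noteq> 0\<close> and so gives a homomorphism that does not kill \<open>c\<close>. For a canonical
  localisation, homomorphisms \<open>B \<rightarrow> k\<close> extend, because members of \<open>\<D>\<close> have no zero in \<open>k\<close>.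
\<close>

section \<open>Polynomials in one element\<close>

text \<open>The case split cannot be avoided. Over an algebraically closed field every form in at
  least two variables has a non-trivial zero, so a system cannot be compressed into one anisotropic
  form. Over any other field an element killed by all homomorphisms need not be nilpotent: take 1 in
  k[X]/(f) with f of positive degree without a root. The basis theorem enters because one form can
  test only finitely many relations.

  No polynomial ring, quotient, fraction field or algebraic closure is built. Subrings grow inside a
  given ring by adjoining one element at a time. Their members are values of coefficient lists,
  which are not unique, so degree and leading coefficient belong to the list and not to the element.
  Working modulo a prime \<open>p\<close> means testing membership in \<open>p\<close>, and a
  partial homomorphism to \<open>K\<close> is a subring of a product ring, so extending it is again
  an adjunction.\<close>

primrec horner :: "('a, 'm) ring_scheme \<Rightarrow> 'a \<Rightarrow> 'a list \<Rightarrow> 'a" where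
  "horner R x [] = \<zero>\<^bsub>R\<^esub>"
| "horner R x (a # p) = a \<oplus>\<^bsub>R\<^esub> x \<otimes>\<^bsub>R\<^esub> horner R x p"

text \<open>The ring S[x]. Lists start with the constant term, trailing zeros are allowed, and
  different lists may have the same value.\<close>

definition adjoin :: "('a, 'm) ring_scheme \<Rightarrow> 'a set \<Rightarrow> 'a \<Rightarrow> 'a set"
  where "adjoin R S x = {horner R x p | p. set p \<subseteq> S}"

context cring
begin

lemma horner_closed [simp]:
  "x \<in> carrier R \<Longrightarrow> set p \<subseteq> carrier R \<Longrightarrow> horner R x p \<in> carrier R"
  by (induction p) auto

lemma horner_append:
  assumes "x \<in> carrier R" "set p \<subseteq> carrier R" "set q \<subseteq> carrier R"
  shows "horner R x (p @ q) = horner R x p \<oplus> x [^] length p \<otimes> horner R x q"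
  using assms(2)
proof (induction p)
  case (Cons a p)
  have [simp]: "a \<in> carrier R" "horner R x p \<in> carrier R" "horner R x q \<in> carrier R" "x \<in> carrier R"
    using Cons assms by auto
  show ?case using Cons by (simp add: r_distr a_assoc m_ac)
qed (use assms in auto)

lemma horner_scale:
  assumes "x \<in> carrier R" "c \<in> carrier R" "set p \<subseteq> carrier R"
  shows "horner R x (map ((\<otimes>) c) p) = c \<otimes> horner R x p"
  using assms(3) by (induction p) (use assms in \<open>auto simp: r_distr m_lcomm\<close>)

lemma horner_replicate_zero:
  "x \<in> carrier R \<Longrightarrow> horner R x (replicate n \<zero>) = \<zero>"
  by (induction n) auto

text \<open>The combination by which pseudo-division cancels leading terms; equal lengths keep
  \<open>map2\<close> from truncating.\<close>

lemma horner_linear: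
  assumes "x \<in> carrier R" "c \<in> carrier R" "d \<in> carrier R"
    and "length p = length q" "set p \<subseteq> carrier R" "set q \<subseteq> carrier R"
  shows "horner R x (map2 (\<lambda>a b. c \<otimes> a \<ominus> d \<otimes> b) p q) = c \<otimes> horner R x p \<ominus> d \<otimes> horner R x q"
  using assms(4-)
proof (induction p q rule: list_induct2)
  case (Cons a p b q)
  have [simp]: "a \<in> carrier R" "b \<in> carrier R" "horner R x p \<in> carrier R" "horner R x q \<in> carrier R"
    using Cons assms by auto
  have "horner R x (map2 (\<lambda>a b. c \<otimes> a \<ominus> d \<otimes> b) p q) = c \<otimes> horner R x p \<ominus> d \<otimes> horner R x q"
    using Cons by auto
  then show ?case
    using assms(1-3) by (simp add: minus_eq r_distr l_minus r_minus minus_add m_lcomm a_ac)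
qed (use assms in \<open>auto simp: minus_eq\<close>)

text \<open>The length of the new list is recorded because the basis theorem bounds degrees by
  lengths of lists.\<close>

lemma horner_add:
  assumes "subring S R" "x \<in> carrier R" "set p \<subseteq> S" "set q \<subseteq> S"
  shows "\<exists>r. set r \<subseteq> S \<and> length r = max (length p) (length q) \<and>
    horner R x r = horner R x p \<oplus> horner R x q"
  using assms(3,4)
proof (induction p arbitrary: q)
  case Nil
  then show ?case using subringE(1)[OF assms(1)] assms(2) by (intro exI[of _ q]) auto
next
  case (Cons a p)
  note S = subringE[OF assms(1)]
  have [simp]: "a \<in> carrier R" "horner R x p \<in> carrier R" "x \<in> carrier R"
    using Cons S(1) assms by (auto intro!: horner_closed)
  show ?case
  proof (cases q)
    case Nil
    then show ?thesis using Cons by (intro exI[of _ "a # p"]) auto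
  next
    case (Cons b q')
    have [simp]: "b \<in> carrier R" "horner R x q' \<in> carrier R"
      using Cons.prems Cons S(1) assms by (auto intro!: horner_closed)
    obtain r where r: "set r \<subseteq> S" "length r = max (length p) (length q')"
      "horner R x r = horner R x p \<oplus> horner R x q'"
      using Cons.IH[of q'] Cons.prems Cons by auto
    then show ?thesis using Cons Cons.prems S(7)
      by (intro exI[of _ "(a \<oplus> b) # r"]) (auto simp: r_distr a_ac)
  qed
qed

lemma horner_mult:
  assumes "subring S R" "x \<in> carrier R" "set p \<subseteq> S" "set q \<subseteq> S"
  shows "\<exists>r. set r \<subseteq> S \<and> horner R x r = horner R x p \<otimes> horner R x q"
  using assms(3)
proof (induction p)
  case Nil
  then show ?case using subringE(1)[OF assms(1)] assms by (intro exI[of _ "[]"]) auto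
next
  case (Cons a p)
  note S = subringE[OF assms(1)]
  have [simp]: "a \<in> carrier R" "horner R x p \<in> carrier R" "x \<in> carrier R" "horner R x q \<in> carrier R"
    using Cons S(1) assms by (auto intro!: horner_closed)
  obtain r where r: "set r \<subseteq> S" "horner R x r = horner R x p \<otimes> horner R x q"
    using Cons by auto
  have "set (map ((\<otimes>) a) q) \<subseteq> S" "set (\<zero> # r) \<subseteq> S"
    using r(1) S(2,6) assms(4) Cons.prems by auto
  then obtain t where t: "set t \<subseteq> S"
    "horner R x t = horner R x (map ((\<otimes>) a) q) \<oplus> horner R x (\<zero> # r)"
    using horner_add[OF assms(1,2)] by meson
  show ?case
    using t r assms S(1) by (intro exI[of _ t]) (auto simp: horner_scale l_distr m_assoc)
qed

lemma adjoin_subring: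
  assumes S: "subring S R" and x: "x \<in> carrier R"
  shows "subring (adjoin R S x) R"
proof (rule subringI)
  note SE = subringE[OF S]
  show "adjoin R S x \<subseteq> carrier R"
    using SE(1) x by (auto simp: adjoin_def intro!: horner_closed)
  show "\<one> \<in> adjoin R S x"
    using SE(3) x by (auto simp: adjoin_def intro!: exI[of _ "[\<one>]"])
  show "h1 \<otimes> h2 \<in> adjoin R S x" if "h1 \<in> adjoin R S x" "h2 \<in> adjoin R S x" for h1 h2
    using that horner_mult[OF S x] unfolding adjoin_def mem_Collect_eq by metis
  show "h1 \<oplus> h2 \<in> adjoin R S x" if "h1 \<in> adjoin R S x" "h2 \<in> adjoin R S x" for h1 h2
    using that horner_add[OF S x] unfolding adjoin_def mem_Collect_eq by metis
  show "\<ominus> h \<in> adjoin R S x" if h: "h \<in> adjoin R S x" for h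
  proof -
    obtain p where p: "set p \<subseteq> S" "h = horner R x p"
      using h by (auto simp: adjoin_def)
    have "\<ominus> h = horner R x (map ((\<otimes>) (\<ominus> \<one>)) p)"
      using p SE(1) x by (subst horner_scale) (auto simp: l_minus)
    moreover have "set (map ((\<otimes>) (\<ominus> \<one>)) p) \<subseteq> S"
      using p SE by auto
    ultimately show ?thesis unfolding adjoin_def by blast
  qed
qed

lemma adjoin_incl:
  assumes "subring S R" "x \<in> carrier R"
  shows "S \<subseteq> adjoin R S x" and "x \<in> adjoin R S x"
proof -
  note SE = subringE[OF assms(1)]
  show "S \<subseteq> adjoin R S x"
    using SE(1) assms(2) by (auto simp: adjoin_def intro!: exI[of _ "[_]"])
  show "x \<in> adjoin R S x"
    using SE assms(2) by (auto simp: adjoin_def intro!: exI[of _ "[\<zero>, \<one>]"])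
qed

lemma horner_mem_subring:
  assumes "subring T R" "set p \<subseteq> T" "x \<in> T"
  shows "horner R x p \<in> T"
  using assms(2) by (induction p) (use assms subringE[OF assms(1)] in auto)

lemma adjoin_least:
  assumes "subring T R" "S \<subseteq> T" "x \<in> T"
  shows "adjoin R S x \<subseteq> T"
  using horner_mem_subring[OF assms(1)] assms by (auto simp: adjoin_def)

lemma adjoins_subring:
  assumes "subring S R" "set xs \<subseteq> carrier R"
  shows "subring (foldl (adjoin R) S xs) R" and "S \<union> set xs \<subseteq> foldl (adjoin R) S xs"
proof -
  have "subring (foldl (adjoin R) S xs) R \<and> S \<union> set xs \<subseteq> foldl (adjoin R) S xs"
    using assms
  proof (induction xs arbitrary: S)
    case (Cons x xs)
    have "subring (adjoin R S x) R" using Cons adjoin_subring by auto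
    from Cons.IH[OF this] show ?case
      using adjoin_incl[of S x] Cons.prems by auto
  qed auto
  then show "subring (foldl (adjoin R) S xs) R" and "S \<union> set xs \<subseteq> foldl (adjoin R) S xs" by auto
qed

lemma adjoins_least:
  assumes "subring T R" "S \<subseteq> T" "set xs \<subseteq> T"
  shows "foldl (adjoin R) S xs \<subseteq> T"
  using assms(2,3) by (induction xs arbitrary: S) (use adjoin_least[OF assms(1)] in auto)

end

section \<open>Noetherian subrings\<close>

text \<open>Ideals of the subring \<open>S\<close>, phrased in the surrounding ring. When
  \<open>S\<close> is a subring, closure under negation comes from multiplying by -1.\<close>

definition sub_ideal :: "('a, 'm) ring_scheme \<Rightarrow> 'a set \<Rightarrow> 'a set \<Rightarrow> bool"
  where "sub_ideal R S I \<longleftrightarrow> I \<subseteq> S \<and> \<zero>\<^bsub>R\<^esub> \<in> I \<and> (\<forall>a\<in>I. \<forall>b\<in>I. a \<oplus>\<^bsub>R\<^esub> b \<in> I) \<and>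
    (\<forall>s\<in>S. \<forall>a\<in>I. s \<otimes>\<^bsub>R\<^esub> a \<in> I)"

text \<open>Finite generation is expressed by minimality: whatever ideal contains \<open>F\<close>
  contains \<open>I\<close>. This avoids constructing the ideal generated by
  \<open>F\<close>.\<close>

definition noetherian_sub :: "('a, 'm) ring_scheme \<Rightarrow> 'a set \<Rightarrow> bool"
  where "noetherian_sub R S \<longleftrightarrow> (\<forall>I. sub_ideal R S I \<longrightarrow>
    (\<exists>F\<subseteq>I. finite F \<and> (\<forall>J. sub_ideal R S J \<and> F \<subseteq> J \<longrightarrow> I \<subseteq> J)))"

text \<open>Coefficients that occur at x^n in expressions of members of \<open>J\<close> of degree
  at most n, so 0 is included; \<open>length p \<le> n\<close> confines \<open>p\<close> to the
  lower degrees.\<close>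

definition lead_ideal :: "('a, 'm) ring_scheme \<Rightarrow> 'a set \<Rightarrow> 'a \<Rightarrow> 'a set \<Rightarrow> nat \<Rightarrow> 'a set"
  where "lead_ideal R S x J n = {r \<in> S. \<exists>p. set p \<subseteq> S \<and> length p \<le> n \<and>
    horner R x p \<oplus>\<^bsub>R\<^esub> x [^]\<^bsub>R\<^esub> n \<otimes>\<^bsub>R\<^esub> r \<in> J}"

lemma sub_idealD:
  assumes "sub_ideal R S I"
  shows "I \<subseteq> S" "\<zero>\<^bsub>R\<^esub> \<in> I" "\<And>a b. a \<in> I \<Longrightarrow> b \<in> I \<Longrightarrow> a \<oplus>\<^bsub>R\<^esub> b \<in> I"
    "\<And>s a. s \<in> S \<Longrightarrow> a \<in> I \<Longrightarrow> s \<otimes>\<^bsub>R\<^esub> a \<in> I"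
  using assms by (auto simp: sub_ideal_def)

context cring
begin

text \<open>An ideal with a non-zero member contains 1. This is the start of the tower, where
  \<open>S\<close> is the image of the base field.\<close>

lemma noetherian_sub_of_units:
  assumes "S \<subseteq> carrier R" "\<And>s. s \<in> S \<Longrightarrow> s \<noteq> \<zero> \<Longrightarrow> \<exists>t\<in>S. t \<otimes> s = \<one>"
  shows "noetherian_sub R S"
  unfolding noetherian_sub_def
proof (intro allI impI)
  fix I assume I: "sub_ideal R S I"
  show "\<exists>F\<subseteq>I. finite F \<and> (\<forall>J. sub_ideal R S J \<and> F \<subseteq> J \<longrightarrow> I \<subseteq> J)"
  proof (cases "I = {\<zero>}")
    case False
    then obtain s where s: "s \<in> I" "s \<noteq> \<zero>" using sub_idealD(2)[OF I] by auto
    then obtain t where t: "t \<in> S" "t \<otimes> s = \<one>" using assms(2) sub_idealD(1)[OF I] by blast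
    have "I \<subseteq> J" if J: "sub_ideal R S J" "s \<in> J" for J
    proof
      fix a assume a: "a \<in> I"
      have "\<one> \<in> J" using sub_idealD(4)[OF J(1) t(1) J(2)] t(2) by simp
      then have "a \<otimes> \<one> \<in> J" using sub_idealD(1)[OF I] sub_idealD(4)[OF J(1)] a by blast
      then show "a \<in> J" using a sub_idealD(1)[OF I] assms(1) by (metis r_one subset_iff)
    qed
    then show ?thesis using s by (intro exI[of _ "{s}"]) auto
  qed (auto simp: sub_ideal_def)
qed

section \<open>Ideals of leading coefficients\<close>

lemma lead_ideal_sub_ideal:
  assumes S: "subring S R" and x: "x \<in> carrier R" and J: "sub_ideal R (adjoin R S x) J"
  shows "sub_ideal R S (lead_ideal R S x J n)"
  unfolding sub_ideal_def
proof (intro conjI ballI)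
  note SE = subringE[OF S] and T = subringE[OF adjoin_subring[OF S x]] and JD = sub_idealD[OF J]
  have carr: "a \<in> S \<Longrightarrow> a \<in> carrier R" for a using SE by auto
  have h: "set p \<subseteq> S \<Longrightarrow> horner R x p \<in> carrier R" for p using SE(1) x by (auto intro!: horner_closed)
  show "lead_ideal R S x J n \<subseteq> S" by (auto simp: lead_ideal_def)
  show "\<zero> \<in> lead_ideal R S x J n"
    using SE x JD by (auto simp: lead_ideal_def intro!: exI[of _ "[]"])
  fix a assume a: "a \<in> lead_ideal R S x J n"
  then obtain p where p: "a \<in> S" "set p \<subseteq> S" "length p \<le> n"
    "horner R x p \<oplus> x [^] n \<otimes> a \<in> J" by (auto simp: lead_ideal_def)
  {
    fix b assume b: "b \<in> lead_ideal R S x J n"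
    then obtain q where q: "b \<in> S" "set q \<subseteq> S" "length q \<le> n"
      "horner R x q \<oplus> x [^] n \<otimes> b \<in> J" by (auto simp: lead_ideal_def)
    obtain r where r: "set r \<subseteq> S" "length r = max (length p) (length q)"
      "horner R x r = horner R x p \<oplus> horner R x q" using horner_add[OF S x p(2) q(2)] by auto
    have "horner R x r \<oplus> x [^] n \<otimes> (a \<oplus> b) =
      (horner R x p \<oplus> x [^] n \<otimes> a) \<oplus> (horner R x q \<oplus> x [^] n \<otimes> b)"
      unfolding r(3) using carr[OF p(1)] carr[OF q(1)] x h[OF p(2)] h[OF q(2)]
      by (simp add: r_distr a_ac)
    then have "horner R x r \<oplus> x [^] n \<otimes> (a \<oplus> b) \<in> J"
      using JD(3)[OF p(4) q(4)] by simp
    then show "a \<oplus> b \<in> lead_ideal R S x J n"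
      using r p q SE(7) by (auto simp: lead_ideal_def intro!: exI[of _ r])
  next
    fix s assume s: "s \<in> S"
    have "horner R x (map ((\<otimes>) s) p) \<oplus> x [^] n \<otimes> (s \<otimes> a) = s \<otimes> (horner R x p \<oplus> x [^] n \<otimes> a)"
      using carr[OF p(1)] carr[OF s] x h[OF p(2)] p(2) SE(1)
      by (simp add: horner_scale r_distr m_lcomm)
    moreover have "s \<otimes> (horner R x p \<oplus> x [^] n \<otimes> a) \<in> J"
      using JD(4)[OF _ p(4)] s adjoin_incl[OF S x] by auto
    ultimately show "s \<otimes> a \<in> lead_ideal R S x J n"
      using p s SE(6) by (auto simp: lead_ideal_def subset_iff intro!: exI[of _ "map ((\<otimes>) s) p"])
  }
qed

text \<open>Multiplication by x moves a leading coefficient one degree up; on lists this is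
  \<open>\<zero> # p\<close>.\<close>

lemma lead_ideal_mono:
  assumes S: "subring S R" and x: "x \<in> carrier R" and J: "sub_ideal R (adjoin R S x) J"
    and "m \<le> n"
  shows "lead_ideal R S x J m \<subseteq> lead_ideal R S x J n"
proof (rule lift_Suc_mono_le[OF _ \<open>m \<le> n\<close>])
  fix n show "lead_ideal R S x J n \<subseteq> lead_ideal R S x J (Suc n)"
  proof
    note SE = subringE[OF S] and JD = sub_idealD[OF J]
    fix a assume a: "a \<in> lead_ideal R S x J n"
    then obtain p where p: "a \<in> S" "set p \<subseteq> S" "length p \<le> n"
      "horner R x p \<oplus> x [^] n \<otimes> a \<in> J" by (auto simp: lead_ideal_def)
    have [simp]: "horner R x p \<in> carrier R" "a \<in> carrier R"
      using SE(1) x p by (auto intro!: horner_closed)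
    have "horner R x (\<zero> # p) \<oplus> x [^] Suc n \<otimes> a = x \<otimes> (horner R x p \<oplus> x [^] n \<otimes> a)"
      using x by (simp add: r_distr m_ac)
    then have "horner R x (\<zero> # p) \<oplus> x [^] Suc n \<otimes> a \<in> J"
      using JD(4)[OF adjoin_incl(2)[OF S x] p(4)] by simp
    moreover have "set (\<zero> # p) \<subseteq> S" "length (\<zero> # p) \<le> Suc n" using p SE by auto
    ultimately show "a \<in> lead_ideal R S x J (Suc n)"
      using p(1) unfolding lead_ideal_def by blast
  qed
qed

text \<open>Induction on the length of an expression: from a member of \<open>I\<close> subtract a
  member of \<open>J\<close> with the same top coefficient. Since \<open>J \<subseteq> I\<close>,
  the difference is again in \<open>I\<close>, and it has a shorter expression.\<close>

lemma sub_ideal_le_of_lead_ideal_le: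
  assumes S: "subring S R" and x: "x \<in> carrier R"
    and I: "sub_ideal R (adjoin R S x) I" and J: "sub_ideal R (adjoin R S x) J" and "J \<subseteq> I"
    and le: "\<And>n. lead_ideal R S x I n \<subseteq> lead_ideal R S x J n"
  shows "I \<subseteq> J"
proof -
  note SE = subringE[OF S] and JD = sub_idealD[OF J] and ID = sub_idealD[OF I]
  note T = subringE[OF adjoin_subring[OF S x]]
  have carr: "a \<in> S \<Longrightarrow> a \<in> carrier R" for a using SE by auto
  have h: "set p \<subseteq> S \<Longrightarrow> horner R x p \<in> carrier R" for p using SE(1) x by (auto intro!: horner_closed)
  have m1: "\<ominus> \<one> \<in> adjoin R S x" using T by auto
  have "horner R x p \<in> J" if "length p = n" "set p \<subseteq> S" "horner R x p \<in> I" for n p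
    using that
  proof (induction n arbitrary: p)
    case 0
    then show ?case using JD by auto
  next
    case (Suc n)
    then obtain p' r where p: "p = p' @ [r]" by (metis length_Suc_conv_rev)
    have p': "set p' \<subseteq> S" "r \<in> S" "length p' = n" using p Suc by auto
    have "horner R x (p' @ [r]) = horner R x p' \<oplus> x [^] length p' \<otimes> horner R x [r]"
      using p' SE x by (intro horner_append) auto
    then have hp: "horner R x p = horner R x p' \<oplus> x [^] n \<otimes> r"
      using carr[OF p'(2)] x p p'(3) by simp
    then have "r \<in> lead_ideal R S x I n"
      using Suc.prems p' unfolding lead_ideal_def by auto
    then obtain q where q: "set q \<subseteq> S" "length q \<le> n" "horner R x q \<oplus> x [^] n \<otimes> r \<in> J"
      using le unfolding lead_ideal_def by blast
    have "set (map ((\<otimes>) (\<ominus> \<one>)) q) \<subseteq> S" using q SE by auto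
    then obtain t where t: "set t \<subseteq> S" "length t = max (length p') (length (map ((\<otimes>) (\<ominus> \<one>)) q))"
      "horner R x t = horner R x p' \<oplus> horner R x (map ((\<otimes>) (\<ominus> \<one>)) q)"
      using horner_add[OF S x p'(1)] by meson
    have ht: "horner R x t = horner R x p' \<ominus> horner R x q"
      using t(3) q(1) h[OF q(1)] SE(1) x by (simp add: horner_scale l_minus minus_eq)
    define z where "z = x [^] n \<otimes> r"
    have z: "z \<in> carrier R" using carr[OF p'(2)] x by (simp add: z_def)
    note hh = h[OF p'(1)] h[OF q(1)] z
    have "horner R x t = horner R x p \<oplus> \<ominus> \<one> \<otimes> (horner R x q \<oplus> x [^] n \<otimes> r)"
      unfolding hp ht z_def[symmetric] using hh by algebra
    then have "horner R x t \<in> I"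
      using ID(3)[OF Suc.prems(3) ID(4)[OF m1 subsetD[OF \<open>J \<subseteq> I\<close> q(3)]]] by simp
    then have tJ: "horner R x t \<in> J"
      using Suc.IH[of t] t q p' by simp
    have "horner R x p = horner R x t \<oplus> (horner R x q \<oplus> x [^] n \<otimes> r)"
      unfolding hp ht z_def[symmetric] using hh by algebra
    then show ?case using JD(3)[OF tJ q(3)] by simp
  qed
  then show ?thesis using ID(1) unfolding adjoin_def by blast
qed

text \<open>Hilbert's basis theorem. The ring need not be a polynomial ring: the
  argument only uses that every element of \<open>S[x]\<close> has some expression as a polynomial in \<open>x\<close>.\<close>

theorem noetherian_sub_adjoin:
  assumes S: "subring S R" and x: "x \<in> carrier R" and N: "noetherian_sub R S"
  shows "noetherian_sub R (adjoin R S x)"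
  unfolding noetherian_sub_def
proof (intro allI impI)
  fix I assume I: "sub_ideal R (adjoin R S x) I"
  let ?L = "lead_ideal R S x"
  note LI = lead_ideal_sub_ideal[OF S x I]
  \<comment> \<open>The leading-coefficient ideals ascend, so their union is an ideal of
    \<open>S\<close>. Its finitely many generators all occur at one level \<open>N0\<close>, from
    which on the chain is constant.\<close>
  have U: "sub_ideal R S (\<Union>n. ?L I n)"
    unfolding sub_ideal_def
  proof (intro conjI ballI)
    fix a b assume "a \<in> (\<Union>n. ?L I n)" "b \<in> (\<Union>n. ?L I n)"
    then obtain m n where "a \<in> ?L I m" "b \<in> ?L I n" by auto
    then have "a \<in> ?L I (max m n)" "b \<in> ?L I (max m n)"
      using lead_ideal_mono[OF S x I, of m "max m n"] lead_ideal_mono[OF S x I, of n "max m n"] by auto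
    then show "a \<oplus> b \<in> (\<Union>n. ?L I n)" using sub_idealD(3)[OF LI] by blast
  next
    show "(\<Union>n. ?L I n) \<subseteq> S" using sub_idealD(1)[OF LI] by auto
    show "\<zero> \<in> (\<Union>n. ?L I n)" using sub_idealD(2)[OF LI] by auto
    show "s \<otimes> a \<in> (\<Union>n. ?L I n)" if "s \<in> S" "a \<in> (\<Union>n. ?L I n)" for s a
      using sub_idealD(4)[OF LI] that by auto
  qed
  then obtain F0 where F0: "F0 \<subseteq> (\<Union>n. ?L I n)" "finite F0"
    "\<And>J. sub_ideal R S J \<Longrightarrow> F0 \<subseteq> J \<Longrightarrow> (\<Union>n. ?L I n) \<subseteq> J"
    using N unfolding noetherian_sub_def by meson
  have "\<exists>N. F0 \<subseteq> ?L I N"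
    using F0(2,1)
  proof (induction F0)
    case (insert r F)
    then obtain m n where "F \<subseteq> ?L I m" "r \<in> ?L I n" by auto
    then have "insert r F \<subseteq> ?L I (max m n)"
      using lead_ideal_mono[OF S x I, of m "max m n"] lead_ideal_mono[OF S x I, of n "max m n"] by auto
    then show ?case by blast
  qed auto
  then obtain N0 where N0: "F0 \<subseteq> ?L I N0" by blast
  have "\<forall>n. \<exists>F. F \<subseteq> ?L I n \<and> finite F \<and> (\<forall>J. sub_ideal R S J \<and> F \<subseteq> J \<longrightarrow> ?L I n \<subseteq> J)"
    using N LI unfolding noetherian_sub_def by meson
  then obtain Fn where Fn: "\<And>n. Fn n \<subseteq> ?L I n" "\<And>n. finite (Fn n)"
    "\<And>n J. sub_ideal R S J \<Longrightarrow> Fn n \<subseteq> J \<Longrightarrow> ?L I n \<subseteq> J"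
    by metis
  have "\<forall>n r. r \<in> ?L I n \<longrightarrow> (\<exists>g. g \<in> I \<and> (\<exists>p. set p \<subseteq> S \<and> length p \<le> n \<and>
      g = horner R x p \<oplus> x [^] n \<otimes> r))"
    by (auto simp: lead_ideal_def)
  then obtain g where g: "\<And>n r. r \<in> ?L I n \<Longrightarrow> g n r \<in> I \<and> (\<exists>p. set p \<subseteq> S \<and> length p \<le> n \<and>
      g n r = horner R x p \<oplus> x [^] n \<otimes> r)"
    by metis
  \<comment> \<open>Lifts to \<open>I\<close> of generators at each level up to \<open>N0\<close>,
    and of \<open>F0\<close> at level \<open>N0\<close>, which serves all higher levels.\<close>
  define F where "F = (\<Union>n\<le>N0. g n ` Fn n) \<union> g N0 ` F0"
  have "F \<subseteq> I" using g Fn(1) N0 unfolding F_def by blast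
  moreover have "finite F" using Fn(2) F0(2) unfolding F_def by auto
  moreover have "I \<subseteq> J" if J: "sub_ideal R (adjoin R S x) J" "F \<subseteq> J" for J
  proof -
    \<comment> \<open>The comparison of leading coefficients requires the smaller ideal to lie
      inside \<open>I\<close>, hence the intersection.\<close>
    have K: "sub_ideal R (adjoin R S x) (I \<inter> J)"
      using I J(1) by (auto simp: sub_ideal_def)
    have FK: "F \<subseteq> I \<inter> J" using \<open>F \<subseteq> I\<close> J by auto
    have lift: "r \<in> ?L (I \<inter> J) n" if r: "r \<in> ?L I n" "g n r \<in> F" for n r
    proof -
      obtain p where p: "set p \<subseteq> S" "length p \<le> n" "g n r = horner R x p \<oplus> x [^] n \<otimes> r"
        using g[OF r(1)] by auto
      have "r \<in> S" using r(1) by (auto simp: lead_ideal_def)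
      then show ?thesis using p r(2) FK unfolding lead_ideal_def by auto
    qed
    note LK = lead_ideal_sub_ideal[OF S x K]
    have *: "?L I n \<subseteq> ?L (I \<inter> J) n" for n
    proof (cases "n \<le> N0")
      case True
      have "Fn n \<subseteq> ?L (I \<inter> J) n"
        using lift Fn(1) True unfolding F_def by blast
      then show ?thesis using Fn(3)[OF LK] by blast
    next
      case False
      have "F0 \<subseteq> ?L (I \<inter> J) N0"
        using lift N0 unfolding F_def by blast
      then have "(\<Union>n. ?L I n) \<subseteq> ?L (I \<inter> J) N0" using F0(3)[OF LK] by blast
      moreover have "?L (I \<inter> J) N0 \<subseteq> ?L (I \<inter> J) n"
        using lead_ideal_mono[OF S x K] False by simp
      ultimately show ?thesis by blast
    qed
    show ?thesis using sub_ideal_le_of_lead_ideal_le[OF S x I K _ *] by blast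
  qed
  ultimately show "\<exists>F\<subseteq>I. finite F \<and> (\<forall>J. sub_ideal R (adjoin R S x) J \<and> F \<subseteq> J \<longrightarrow> I \<subseteq> J)"
    by blast
qed

lemma noetherian_sub_adjoins:
  assumes "subring S R" "set xs \<subseteq> carrier R" "noetherian_sub R S"
  shows "noetherian_sub R (foldl (adjoin R) S xs)"
  using assms
  by (induction xs arbitrary: S) (auto simp: adjoin_subring noetherian_sub_adjoin)

end

section \<open>Pseudo-division\<close>

lemma set_map2_subset:
  "(\<And>c d. c \<in> A \<Longrightarrow> d \<in> B \<Longrightarrow> f c d \<in> C) \<Longrightarrow> set p \<subseteq> A \<Longrightarrow> set q \<subseteq> B \<Longrightarrow> set (map2 f p q) \<subseteq> C"
  by (induction p q rule: list_induct2') auto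

text \<open>The dividend times \<open>e\<close> and the divisor times \<open>a\<close> x^k have the
  same top coefficient, so the difference can be written with one coefficient fewer. Here
  \<open>e\<close> need not be invertible. The list \<open>r'\<close> is the divisor shifted up by
  zeros.\<close>

lemma (in cring) pseudo_division_step:
  assumes S: "subring S R" and x: "x \<in> carrier R"
    and q: "set (q @ [a]) \<subseteq> S" and r: "set (r @ [e]) \<subseteq> S" and le: "length r \<le> length q"
  shows "\<exists>u. set u \<subseteq> S \<and> length u = length q \<and> horner R x u =
    e \<otimes> horner R x (q @ [a]) \<ominus> a \<otimes> x [^] (length q - length r) \<otimes> horner R x (r @ [e])"
proof -
  note SE = subringE[OF S]
  define r' where "r' = replicate (length q - length r) \<zero> @ r"
  define u where "u = map2 (\<lambda>c d. e \<otimes> c \<ominus> a \<otimes> d) q r'"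
  have r': "length r' = length q" "set r' \<subseteq> S" "set q \<subseteq> S" using le r q SE(2) by (auto simp: r'_def)
  have ae: "a \<in> S" "e \<in> S" using q r by auto
  have c: "a \<in> carrier R" "e \<in> carrier R" "set q \<subseteq> carrier R" "set r \<subseteq> carrier R" "set r' \<subseteq> carrier R"
    using q r r' SE(1) subset_trans[OF _ SE(1)] by auto
  have "e \<otimes> c \<ominus> a \<otimes> d \<in> S" if "c \<in> S" "d \<in> S" for c d
    using that ae SE by (simp add: minus_eq)
  then have "set u \<subseteq> S"
    unfolding u_def using r'(2,3) by (intro set_map2_subset)
  moreover have "length u = length q" by (simp add: u_def r')
  moreover have "horner R x u =
    e \<otimes> horner R x (q @ [a]) \<ominus> a \<otimes> x [^] (length q - length r) \<otimes> horner R x (r @ [e])"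
  proof -
    let ?k = "length q - length r"
    have 1: "horner R x u = e \<otimes> horner R x q \<ominus> a \<otimes> horner R x r'"
      unfolding u_def using c r' x by (intro horner_linear) auto
    have 2: "horner R x r' = x [^] ?k \<otimes> horner R x r"
      unfolding r'_def using c x by (subst horner_append) (auto simp: horner_replicate_zero)
    have 3: "horner R x (q @ [a]) = horner R x q \<oplus> (x [^] ?k \<otimes> x [^] length r) \<otimes> a"
      using c x le by (subst horner_append) (auto simp: nat_pow_mult)
    have 4: "horner R x (r @ [e]) = horner R x r \<oplus> x [^] length r \<otimes> e"
      using c x by (subst horner_append) auto
    have h: "horner R x q \<in> carrier R" "horner R x r \<in> carrier R"
      "x [^] ?k \<in> carrier R" "x [^] length r \<in> carrier R" using c x by auto
    show ?thesis unfolding 1 2 3 4 using c(1,2) h by algebra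
  qed
  ultimately show ?thesis by blast
qed

text \<open>Length and top coefficient of the quotient are part of the conclusion because they
  cannot be read off its value. They are what later shows that some coefficient of the quotient is
  outside a prime.\<close>

lemma (in cring) pseudo_division:
  assumes S: "subring S R" and x: "x \<in> carrier R" and r: "set (r @ [e]) \<subseteq> S"
    and q: "set (q @ [a]) \<subseteq> S" and le: "length r \<le> length q"
  shows "\<exists>s w (i::nat) (j::nat). set s \<subseteq> S \<and> set w \<subseteq> S \<and> length s = length q - length r \<and>
    length w = length r \<and> e [^] j \<otimes> horner R x (q @ [a]) =
      horner R x (r @ [e]) \<otimes> horner R x (s @ [e [^] i \<otimes> a]) \<oplus> horner R x w"
  using q le
proof (induction "length q" arbitrary: q a rule: less_induct)
  case less
  note SE = subringE[OF S]
  obtain u where u: "set u \<subseteq> S" "length u = length q" "horner R x u =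
      e \<otimes> horner R x (q @ [a]) \<ominus> a \<otimes> x [^] (length q - length r) \<otimes> horner R x (r @ [e])"
    using pseudo_division_step[OF S x less(2) r less(3)] by auto
  have c: "a \<in> carrier R" "e \<in> carrier R" "horner R x (q @ [a]) \<in> carrier R" "horner R x (r @ [e]) \<in> carrier R"
    using less.prems r SE(1) x by (auto simp: subset_iff intro!: horner_closed)
  have ae: "a \<in> S" "e \<in> S" using less.prems r by auto
  have S_pow: "e [^] i \<in> S" for i :: nat using SE r by (induction i) auto
  show ?case
  proof (cases "length q = length r")
    case True
    have "e [^] (1::nat) \<otimes> horner R x (q @ [a]) =
      horner R x (r @ [e]) \<otimes> horner R x ([] @ [e [^] (0::nat) \<otimes> a]) \<oplus> horner R x u"
      unfolding u(3) using c True x by (simp) algebra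
    then show ?thesis using u True by (metis diff_self_eq_0 empty_iff list.set(1) list.size(3) subsetI)
  next
    case False
    then obtain v b where v: "u = v @ [b]" "length q = Suc (length v)"
      using u(2) less(3) by (cases u rule: rev_cases) auto
    have "length r \<le> length v" using False less(3) v by simp
    then obtain s w i j where IH: "set s \<subseteq> S" "set w \<subseteq> S" "length s = length v - length r"
      "length w = length r" "e [^] (j::nat) \<otimes> horner R x (v @ [b]) =
        horner R x (r @ [e]) \<otimes> horner R x (s @ [e [^] (i::nat) \<otimes> b]) \<oplus> horner R x w"
      using less(1)[of v b] v u by auto
    have b: "b \<in> S" using u v by auto
    \<comment> \<open>The quotient obtained for the shorter dividend fills the degrees below
      \<open>length q - length r\<close>; the multiple of \<open>a\<close> cancelled at this step
      goes on top of it.\<close>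
    let ?s = "s @ [e [^] i \<otimes> b]"
    have s: "set ?s \<subseteq> S" "length ?s = length q - length r"
      using IH b SE S_pow v \<open>length r \<le> length v\<close> by auto
    have hs: "horner R x ?s \<in> carrier R" "horner R x w \<in> carrier R" "e [^] j \<in> carrier R"
      "x [^] (length q - length r) \<in> carrier R"
      using horner_closed[OF x subset_trans[OF s(1) SE(1)]] horner_closed[OF x subset_trans[OF IH(2) SE(1)]] x c
      by auto
    have "set [e [^] j \<otimes> a] \<subseteq> carrier R" "set ?s \<subseteq> carrier R" using c subset_trans[OF s(1) SE(1)] by auto
    then have "horner R x (?s @ [e [^] j \<otimes> a]) = horner R x ?s \<oplus> x [^] (length q - length r) \<otimes> (e [^] j \<otimes> a)"
      using horner_append[OF x, of ?s "[e [^] j \<otimes> a]"] c x unfolding s(2)[symmetric] by simp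
    moreover have "e [^] Suc j \<otimes> horner R x (q @ [a]) = e [^] j \<otimes> horner R x u \<oplus>
      e [^] j \<otimes> (a \<otimes> x [^] (length q - length r) \<otimes> horner R x (r @ [e]))"
      unfolding u(3) nat_pow_Suc using c hs by algebra
    ultimately have "e [^] Suc j \<otimes> horner R x (q @ [a]) =
      horner R x (r @ [e]) \<otimes> horner R x (?s @ [e [^] j \<otimes> a]) \<oplus> horner R x w"
      using IH(5) c hs SE(1) ae unfolding v(1) by algebra
    then show ?thesis using s IH(2,4) by blast
  qed
qed

section \<open>Product rings, and polynomial values under homomorphisms and in ideals\<close>

lemma RDirProd_simps:
  "carrier (RDirProd R S) = carrier R \<times> carrier S"
  "(a, b) \<otimes>\<^bsub>RDirProd R S\<^esub> (c, d) = (a \<otimes>\<^bsub>R\<^esub> c, b \<otimes>\<^bsub>S\<^esub> d)"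
  "(a, b) \<oplus>\<^bsub>RDirProd R S\<^esub> (c, d) = (a \<oplus>\<^bsub>R\<^esub> c, b \<oplus>\<^bsub>S\<^esub> d)"
  "\<one>\<^bsub>RDirProd R S\<^esub> = (\<one>\<^bsub>R\<^esub>, \<one>\<^bsub>S\<^esub>)"
  "\<zero>\<^bsub>RDirProd R S\<^esub> = (\<zero>\<^bsub>R\<^esub>, \<zero>\<^bsub>S\<^esub>)"
  by (auto simp: RDirProd_def DirProd_def monoid.defs)

lemma RDirProd_cring:
  assumes "cring R" "cring S" shows "cring (RDirProd R S)"
proof -
  interpret R: cring R by fact
  interpret S: cring S by fact
  interpret D: ring "RDirProd R S" by (rule RDirProd_ring[OF R.ring_axioms S.ring_axioms])
  show ?thesis
    by unfold_locales (auto simp: RDirProd_simps R.m_comm S.m_comm)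
qed

lemma (in ring_hom_cring) horner_hom:
  "x \<in> carrier R \<Longrightarrow> set p \<subseteq> carrier R \<Longrightarrow> h (horner R x p) = horner S (h x) (map h p)"
  by (induction p) auto

lemma (in ideal) horner_mem:
  "x \<in> carrier R \<Longrightarrow> set p \<subseteq> I \<Longrightarrow> horner R x p \<in> I"
  by (induction p) (auto simp: I_l_closed)

lemma (in primeideal) pow_notin:
  "a \<in> carrier R \<Longrightarrow> a \<notin> I \<Longrightarrow> a [^] (n::nat) \<notin> I"
proof (induction n)
  case 0
  then show ?case using I_notcarr one_imp_carrier by auto
next
  case (Suc n)
  then show ?case using I_prime[of "a [^] n" a] by auto
qed

lemma lift_list: "set q \<subseteq> f ` G \<Longrightarrow> \<exists>Q. set Q \<subseteq> G \<and> map f Q = q"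
proof (induction q)
  case (Cons a q)
  then obtain Q z where "set Q \<subseteq> G" "map f Q = q" "z \<in> G" "f z = a" by auto
  then show ?case by (intro exI[of _ "z # Q"]) auto
qed auto

section \<open>Places\<close>

text \<open>Algebraic closedness: a list of length at least two with non-zero last entry is a
  polynomial of positive degree.\<close>

definition root_closed :: "('k, 'm) ring_scheme \<Rightarrow> bool"
  where "root_closed K \<longleftrightarrow> (\<forall>p. set p \<subseteq> carrier K \<and> 2 \<le> length p \<and> last p \<noteq> \<zero>\<^bsub>K\<^esub> \<longrightarrow>
    (\<exists>t\<in>carrier K. horner K t p = \<zero>\<^bsub>K\<^esub>))"

definition place :: "('a, 'm) ring_scheme \<Rightarrow> ('k, 'n) ring_scheme \<Rightarrow> 'a set \<Rightarrow> ('a \<times> 'k) set \<Rightarrow> bool"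
  where "place B K p G \<longleftrightarrow> subring G (RDirProd B K) \<and> (\<forall>(u, s)\<in>G. u \<in> p \<longrightarrow> s = \<zero>\<^bsub>K\<^esub>)"

lemma (in cring) horner_zeros: "x \<in> carrier R \<Longrightarrow> set p \<subseteq> {\<zero>} \<Longrightarrow> horner R x p = \<zero>"
  by (induction p) auto

text \<open>A non-constant polynomial takes the value 1, because subtracting 1 from it leaves a
  polynomial with a root. This spares a proof that the field is infinite.\<close>

lemma (in field) root_closed_nonroot:
  assumes "root_closed R" "set p \<subseteq> carrier R" "p \<noteq> []" "last p \<noteq> \<zero>"
  shows "\<exists>t\<in>carrier R. horner R t p \<noteq> \<zero>"
proof (cases p)
  case (Cons a q)
  show ?thesis
  proof (cases "q = []")
    case True
    then show ?thesis using Cons assms by (auto intro!: bexI[of _ \<zero>])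
  next
    case False
    have ca: "a \<in> carrier R" "set q \<subseteq> carrier R" using Cons assms by auto
    have "set ((a \<ominus> \<one>) # q) \<subseteq> carrier R" "2 \<le> length ((a \<ominus> \<one>) # q)" "last ((a \<ominus> \<one>) # q) \<noteq> \<zero>"
      using ca False assms Cons by (auto simp: Suc_le_eq)
    then obtain t where t: "t \<in> carrier R" "horner R t ((a \<ominus> \<one>) # q) = \<zero>"
      using assms(1) unfolding root_closed_def by blast
    have h: "horner R t q \<in> carrier R" using ca t by auto
    have "horner R t p = horner R t ((a \<ominus> \<one>) # q) \<oplus> \<one>"
      unfolding Cons horner.simps using ca t(1) h by algebra
    then have "horner R t p \<noteq> \<zero>" using t by simp
    then show ?thesis using t by blast
  qed
qed (use assms in auto)

locale prime_and_field = primeideal p B + K: field K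
  for p :: "'a set" and B :: "('a, 'm) ring_scheme" (structure) and K :: "('k, 'n) ring_scheme"
begin

sublocale D: cring "RDirProd B K"
  by (rule RDirProd_cring[OF is_cring K.is_cring])

sublocale F: ring_hom_cring "RDirProd B K" B fst
  by unfold_locales (auto simp: ring_hom_def RDirProd_simps)

sublocale E: ring_hom_cring "RDirProd B K" K snd
  by unfold_locales (auto simp: ring_hom_def RDirProd_simps)

lemma horner_pair:
  assumes "x \<in> carrier B" "t \<in> carrier K" "set Q \<subseteq> carrier (RDirProd B K)"
  shows "horner (RDirProd B K) (x, t) Q = (horner B x (map fst Q), horner K t (map snd Q))"
  using F.horner_hom[of "(x, t)" Q] E.horner_hom[of "(x, t)" Q] assms
  by (auto simp: RDirProd_simps prod_eq_iff)

lemma place_functional: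
  assumes G: "place B K p G" and "(u, s) \<in> G" "(v, t) \<in> G" "u \<ominus> v \<in> p"
  shows "s = t"
proof -
  note GE = subringE[OF conjunct1[OF G[unfolded place_def]]]
  have c: "(u, s) \<in> carrier (RDirProd B K)" "(v, t) \<in> carrier (RDirProd B K)" using assms GE(1) by auto
  have m: "(u, s) \<ominus>\<^bsub>RDirProd B K\<^esub> (v, t) \<in> G"
    using assms GE(5,7) by (simp add: D.minus_eq)
  have "fst ((u, s) \<ominus>\<^bsub>RDirProd B K\<^esub> (v, t)) = u \<ominus> v"
    "snd ((u, s) \<ominus>\<^bsub>RDirProd B K\<^esub> (v, t)) = s \<ominus>\<^bsub>K\<^esub> t"
    using c F.hom_add[OF c(1) D.a_inv_closed[OF c(2)]] E.hom_add[OF c(1) D.a_inv_closed[OF c(2)]]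
    by (simp_all add: D.minus_eq minus_eq K.minus_eq)
  then have "(u \<ominus> v, s \<ominus>\<^bsub>K\<^esub> t) \<in> G" using m by (metis prod.collapse)
  then have "s \<ominus>\<^bsub>K\<^esub> t = \<zero>\<^bsub>K\<^esub>" using assms G by (auto simp: place_def)
  then show ?thesis using c by (simp add: RDirProd_simps)
qed

lemma place_zeros:
  assumes G: "place B K p G" and R: "set R \<subseteq> G" "set (map fst R) \<subseteq> p"
  shows "set (map snd R) \<subseteq> {\<zero>\<^bsub>K\<^esub>}"
proof
  fix z assume "z \<in> set (map snd R)"
  then obtain u where "(u, z) \<in> set R" by auto
  then have "(u, z) \<in> G" "u \<in> p" using R by force+
  then show "z \<in> {\<zero>\<^bsub>K\<^esub>}" using G by (auto simp: place_def)
qed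

text \<open>Members of the enlarged subring are values of lists over \<open>G\<close> at (x, t). The
  assumption on \<open>Q\<close>, that t satisfies the image of every relation of x modulo
  \<open>p\<close>, is therefore exactly the place condition.\<close>

lemma extend_place:
  assumes G: "place B K p G" and x: "x \<in> carrier B" "t \<in> carrier K"
    and *: "\<And>Q. set Q \<subseteq> G \<Longrightarrow> horner B x (map fst Q) \<in> p \<Longrightarrow> horner K t (map snd Q) = \<zero>\<^bsub>K\<^esub>"
  shows "place B K p (adjoin (RDirProd B K) G (x, t))"
    and "G \<subseteq> adjoin (RDirProd B K) G (x, t)"
    and "fst ` adjoin (RDirProd B K) G (x, t) = adjoin B (fst ` G) x"
proof -
  have sG: "subring G (RDirProd B K)" using G by (simp add: place_def)
  have xt: "(x, t) \<in> carrier (RDirProd B K)" using x by (simp add: RDirProd_simps)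
  have hp: "horner (RDirProd B K) (x, t) Q = (horner B x (map fst Q), horner K t (map snd Q))"
    if "set Q \<subseteq> G" for Q
    using horner_pair x subset_trans[OF that subringE(1)[OF sG]] by auto
  show "G \<subseteq> adjoin (RDirProd B K) G (x, t)" by (rule D.adjoin_incl[OF sG xt])
  show "place B K p (adjoin (RDirProd B K) G (x, t))"
    using D.adjoin_subring[OF sG xt] hp * by (auto simp: place_def adjoin_def)
  show "fst ` adjoin (RDirProd B K) G (x, t) = adjoin B (fst ` G) x"
  proof
    show "fst ` adjoin (RDirProd B K) G (x, t) \<subseteq> adjoin B (fst ` G) x"
    proof
      fix u assume "u \<in> fst ` adjoin (RDirProd B K) G (x, t)"
      then obtain Q where Q: "set Q \<subseteq> G" "u = fst (horner (RDirProd B K) (x, t) Q)"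
        by (auto simp: adjoin_def)
      then have "u = horner B x (map fst Q)" "set (map fst Q) \<subseteq> fst ` G" using hp by auto
      then show "u \<in> adjoin B (fst ` G) x" unfolding adjoin_def by blast
    qed
    show "adjoin B (fst ` G) x \<subseteq> fst ` adjoin (RDirProd B K) G (x, t)"
    proof
      fix u assume "u \<in> adjoin B (fst ` G) x"
      then obtain q where q: "set q \<subseteq> fst ` G" "u = horner B x q" by (auto simp: adjoin_def)
      obtain Q where Q: "set Q \<subseteq> G" "map fst Q = q" using lift_list[OF q(1)] by blast
      then have "horner (RDirProd B K) (x, t) Q \<in> adjoin (RDirProd B K) G (x, t)"
        unfolding adjoin_def by blast
      then have "fst (horner (RDirProd B K) (x, t) Q) \<in> fst ` adjoin (RDirProd B K) G (x, t)"
        by (rule imageI)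
      then show "u \<in> fst ` adjoin (RDirProd B K) G (x, t)"
        using hp[OF Q(1)] Q(2) q(2) by simp
    qed
  qed
qed

text \<open>The form of the extension theorem that composes along a tower. The element
  \<open>a\<close> does not depend on the place, so descending from \<open>b\<close> through all
  adjunctions ends in a single condition on the ground ring.\<close>

definition lifts :: "'a set \<Rightarrow> 'a set \<Rightarrow> 'a \<Rightarrow> 'a \<Rightarrow> bool"
  where "lifts S T a b \<longleftrightarrow>
    (\<forall>G. place B K p G \<and> fst ` G = S \<and> (\<forall>s. (a, s) \<in> G \<longrightarrow> s \<noteq> \<zero>\<^bsub>K\<^esub>) \<longrightarrow>
      (\<exists>G'. place B K p G' \<and> G \<subseteq> G' \<and> fst ` G' = T \<and> (\<forall>s. (b, s) \<in> G' \<longrightarrow> s \<noteq> \<zero>\<^bsub>K\<^esub>)))"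

text \<open>One step of the extension theorem for homomorphisms into an algebraically closed field
  (Atiyah--Macdonald, Proposition 5.23), relative to the prime \<open>p\<close>: a place is the graph of a
  homomorphism that vanishes on \<open>p\<close>.\<close>

lemma extend_place_transcendental:
  assumes K: "root_closed K" and S: "subring S B" and x: "x \<in> carrier B"
    and tr: "\<And>q. set q \<subseteq> S \<Longrightarrow> horner B x q \<in> p \<Longrightarrow> set q \<subseteq> p"
    and b: "b \<in> adjoin B S x" "b \<notin> p"
  shows "\<exists>a\<in>S - p. lifts S (adjoin B S x) a b"
proof -
  obtain q where q: "set q \<subseteq> S" "b = horner B x q" using b by (auto simp: adjoin_def)
  have "\<exists>a\<in>set q. a \<notin> p" using horner_mem[OF x] b q by blast
  \<comment> \<open>\<open>a\<close> is the last coefficient outside \<open>p\<close>. The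
    coefficients above it are sent to 0 by every place, so the image of \<open>q\<close> has the
    image of \<open>a\<close> as its leading coefficient.\<close>
  then obtain q1 a q2 where q': "q = q1 @ a # q2" "a \<notin> p" "\<forall>z\<in>set q2. \<not> z \<notin> p"
    using split_list_last_prop[of q "\<lambda>a. a \<notin> p"] by blast
  show ?thesis
    unfolding lifts_def
  proof (intro bexI[of _ a] allI impI)
    show "a \<in> S - p" using q q' by auto
    fix G assume G: "place B K p G \<and> fst ` G = S \<and> (\<forall>s. (a, s) \<in> G \<longrightarrow> s \<noteq> \<zero>\<^bsub>K\<^esub>)"
    have GK: "snd ` G \<subseteq> carrier K"
      using G subringE(1)[of G "RDirProd B K"] by (auto simp: place_def RDirProd_simps)
    obtain Q where Q: "set Q \<subseteq> G" "map fst Q = q" using lift_list[of q fst G] G q by auto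
    then obtain Q1 s Q2 where Q': "Q = Q1 @ (a, s) # Q2" "map fst Q2 = q2"
      unfolding q'(1) by (auto simp: map_eq_append_conv map_eq_Cons_conv)
    have s: "s \<noteq> \<zero>\<^bsub>K\<^esub>" using G Q Q' by auto
    have Q2: "set (map snd Q2) \<subseteq> {\<zero>\<^bsub>K\<^esub>}"
      using Q Q' q'(3) G by (intro place_zeros) auto
    let ?h = "map snd Q1 @ [s]"
    have hK: "set ?h \<subseteq> carrier K" "set (map snd Q2) \<subseteq> carrier K" "set (map snd Q) \<subseteq> carrier K"
      using Q Q' GK by auto
    \<comment> \<open>Every t extends the place, since x satisfies no non-trivial relation modulo
      \<open>p\<close>; a t that is not a root of the image of \<open>q\<close> makes the value at
      \<open>b\<close> non-zero.\<close>
    then obtain t where t: "t \<in> carrier K" "horner K t ?h \<noteq> \<zero>\<^bsub>K\<^esub>"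
      using K.root_closed_nonroot[OF K, of ?h] s by auto
    have "map snd Q = ?h @ map snd Q2" using Q' by simp
    then have hQ: "horner K t (map snd Q) = horner K t ?h"
      using K.horner_append[OF t(1) hK(1,2)] K.horner_zeros[OF t(1) Q2] t hK by simp
    have *: "horner K t (map snd R) = \<zero>\<^bsub>K\<^esub>" if "set R \<subseteq> G" "horner B x (map fst R) \<in> p" for R
    proof (rule K.horner_zeros[OF t(1) place_zeros[OF _ that(1)]])
      show "set (map fst R) \<subseteq> p" using that G by (intro tr) auto
    qed (use G in blast)
    let ?G = "adjoin (RDirProd B K) G (x, t)"
    have e: "place B K p ?G" "G \<subseteq> ?G" "fst ` ?G = adjoin B S x"
      using extend_place[OF _ x t(1) *] G by auto
    have "set Q \<subseteq> carrier (RDirProd B K)"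
      using Q G subringE(1)[of G "RDirProd B K"] by (auto simp: place_def)
    then have "(b, horner K t (map snd Q)) = horner (RDirProd B K) (x, t) Q"
      using horner_pair[OF x t(1)] Q(2) q(2) by simp
    then have "(b, horner K t (map snd Q)) \<in> ?G"
      using Q(1) unfolding adjoin_def by blast
    then have "s \<noteq> \<zero>\<^bsub>K\<^esub>" if "(b, s) \<in> ?G" for s
      using place_functional[OF e(1) that] t hQ x b(1) subringE(1)[OF adjoin_subring[OF S x]]
      by (metis additive_subgroup.zero_closed additive_subgroup_axioms r_right_minus_eq subsetD)
    with e show "\<exists>G'. place B K p G' \<and> G \<subseteq> G' \<and> fst ` G' = adjoin B S x \<and> (\<forall>s. (b, s) \<in> G' \<longrightarrow> s \<noteq> \<zero>\<^bsub>K\<^esub>)"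
      by blast
  qed
qed

text \<open>Reduce both \<open>b\<close> and the minimal equation of \<open>x\<close> modulo each other until a multiple
  of \<open>b\<close> is congruent to an element of \<open>S\<close>.\<close>

lemma algebraic_multiple:
  assumes S: "subring S B" and x: "x \<in> carrier B"
    and q: "set (q @ [a]) \<subseteq> S" "horner B x (q @ [a]) \<in> p" "a \<notin> p"
    and min: "\<And>r. set r \<subseteq> S \<Longrightarrow> length r \<le> length q \<Longrightarrow> horner B x r \<in> p \<Longrightarrow> set r \<subseteq> p"
    and b: "b \<in> adjoin B S x" "b \<notin> p"
  shows "\<exists>e\<in>S - p. \<exists>t\<in>adjoin B S x. e \<ominus> b \<otimes> t \<in> p"
proof -
  note SE = subringE[OF S] and TE = subringE[OF adjoin_subring[OF S x]]
  have pI: "u \<oplus> v \<in> p" "\<ominus> u \<in> p" if "u \<in> p" "v \<in> p" for u v using that by auto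
  have hT: "horner B x r \<in> adjoin B S x" if "set r \<subseteq> S" for r using that by (auto simp: adjoin_def)
  have TC: "u \<in> carrier B" if "u \<in> adjoin B S x" for u using that TE(1) by auto
  have SC: "u \<in> carrier B" if "u \<in> S" for u using that SE(1) by auto
  have ST: "u \<in> adjoin B S x" if "u \<in> S" for u using that adjoin_incl[OF S x] by auto
  have Spow: "u [^] i \<in> S" if "u \<in> S" for u and i :: nat using SE that by (induction i) auto
  \<comment> \<open>Candidates are polynomials whose value is outside \<open>p\<close> but congruent
    to a multiple of \<open>b\<close>. A shortest one will turn out to be a constant, which is the
    required \<open>e\<close>.\<close>
  define cand where "cand r \<longleftrightarrow> set r \<subseteq> S \<and> horner B x r \<notin> p \<and>
    (\<exists>t\<in>adjoin B S x. horner B x r \<ominus> b \<otimes> t \<in> p)" for r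
  have "\<exists>r. cand r"
  proof -
    obtain r where r: "set r \<subseteq> S" "b = horner B x r" using b by (auto simp: adjoin_def)
    have "b \<ominus> b \<otimes> \<one> \<in> p" using TC[OF b(1)] by (simp add: minus_eq r_neg)
    then have "cand r" using r b TE(3) by (auto simp: cand_def)
    then show ?thesis ..
  qed
  then obtain r where r: "cand r" "\<And>r'. cand r' \<Longrightarrow> length r \<le> length r'"
    using ex_has_least_nat[of cand _ length] by blast
  then obtain t where t: "set r \<subseteq> S" "horner B x r \<notin> p" "t \<in> adjoin B S x" "horner B x r \<ominus> b \<otimes> t \<in> p"
    by (auto simp: cand_def)
  have "r \<noteq> []" using t(2) by auto
  then obtain r' e where r': "r = r' @ [e]" by (cases r rule: rev_cases) auto
  have rS: "set r' \<subseteq> S" "e \<in> S" using t r' by auto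
  have bC: "b \<in> carrier B" "t \<in> carrier B" using TC b t by auto
  \<comment> \<open>Otherwise dropping the top term changes the value only modulo \<open>p\<close>
    and gives a shorter candidate.\<close>
  have "e \<notin> p"
  proof
    assume e: "e \<in> p"
    have he: "horner B x r = horner B x r' \<oplus> x [^] length r' \<otimes> e"
      unfolding r' using x rS SC SE(1) subset_trans[OF _ SE(1)] by (subst horner_append) auto
    have m: "x [^] length r' \<otimes> e \<in> p" using e x I_l_closed by auto
    have c: "horner B x r' \<in> carrier B" "x [^] length r' \<otimes> e \<in> carrier B"
      using hT[OF rS(1)] TC m a_Hcarr by auto
    have "horner B x r' \<notin> p" using t(2) he m pI by auto
    moreover have "horner B x r' \<ominus> b \<otimes> t = (horner B x r \<ominus> b \<otimes> t) \<oplus> \<ominus> (x [^] length r' \<otimes> e)"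
      unfolding he using c bC by algebra
    then have "horner B x r' \<ominus> b \<otimes> t \<in> p" using pI t(4) m by auto
    ultimately have "cand r'" using t(3) rS by (auto simp: cand_def)
    then show False using r(2) r' by fastforce
  qed
  have hC: "horner B x r \<in> carrier B" "horner B x (q @ [a]) \<in> carrier B"
    using hT[OF t(1)] hT[OF q(1)] TC by auto
  show ?thesis
  proof (cases "r' = []")
    case True
    then have "horner B x r = e" using r' x SC[OF rS(2)] by simp
    then show ?thesis using t rS(2) \<open>e \<notin> p\<close> by auto
  next
    case False
    have False
    proof (cases "length r' \<le> length q")
      \<comment> \<open>The equation is divided by the candidate. The remainder is congruent to a
        multiple of \<open>b\<close> and shorter than \<open>r\<close>, so it lies in
        \<open>p\<close>. By primality the quotient then lies in \<open>p\<close> too, and it is a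
        relation of length at most \<open>length q\<close> with top coefficient
        \<open>e [^] i \<otimes> a\<close> outside \<open>p\<close>, against minimality.\<close>
      case True
      obtain s w i j where sw: "set s \<subseteq> S" "set w \<subseteq> S" "length s = length q - length r'"
        "length w = length r'" "e [^] (j::nat) \<otimes> horner B x (q @ [a]) =
          horner B x (r' @ [e]) \<otimes> horner B x (s @ [e [^] (i::nat) \<otimes> a]) \<oplus> horner B x w"
        using pseudo_division[OF S x t(1)[unfolded r'] q(1) True] by blast
      let ?s = "s @ [e [^] i \<otimes> a]"
      have sS: "set ?s \<subseteq> S" using sw Spow[OF rS(2)] q(1) SE(6) by auto
      have c: "horner B x ?s \<in> carrier B" "horner B x w \<in> carrier B" "e [^] j \<in> carrier B"
        using TC[OF hT[OF sS]] TC[OF hT[OF sw(2)]] SC[OF rS(2)] by auto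
      have m: "e [^] j \<otimes> horner B x (q @ [a]) \<in> p" using I_l_closed q(2) c by auto
      have "horner B x w \<in> p"
      proof (rule ccontr)
        assume w: "horner B x w \<notin> p"
        have "horner B x w \<ominus> b \<otimes> (\<ominus> (t \<otimes> horner B x ?s)) =
          e [^] j \<otimes> horner B x (q @ [a]) \<oplus> \<ominus> ((horner B x r \<ominus> b \<otimes> t) \<otimes> horner B x ?s)"
          unfolding sw(5) r'[symmetric] using c(1,2) hC(1) bC by algebra
        moreover have "(horner B x r \<ominus> b \<otimes> t) \<otimes> horner B x ?s \<in> p" using t(4) c I_r_closed by auto
        ultimately have "horner B x w \<ominus> b \<otimes> (\<ominus> (t \<otimes> horner B x ?s)) \<in> p" using m pI by auto
        moreover have "\<ominus> (t \<otimes> horner B x ?s) \<in> adjoin B S x" using TE(5,6) t(3) hT[OF sS] by blast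
        ultimately have "cand w" using w sw by (auto simp: cand_def)
        then show False using r(2)[of w] sw(4) r' by auto
      qed
      moreover have "horner B x r \<otimes> horner B x ?s = e [^] j \<otimes> horner B x (q @ [a]) \<oplus> \<ominus> horner B x w"
        unfolding sw(5) r'[symmetric] using c(1,2) hC(1) by algebra
      ultimately have "horner B x r \<otimes> horner B x ?s \<in> p" using m pI by auto
      then have "horner B x ?s \<in> p" using I_prime hC c t(2) by blast
      then have "set ?s \<subseteq> p"
        using min[OF sS] sw(3) False True by (cases r') auto
      then have "e [^] i \<otimes> a \<in> p" by simp
      then show False
        using I_prime[of "e [^] i" a] pow_notin[OF SC[OF rS(2)] \<open>e \<notin> p\<close>, of i] q SC[OF rS(2)] SC by auto
    next
      \<comment> \<open>The candidate is divided by the equation. The remainder is congruent to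
        \<open>a [^] j\<close> times the candidate, so it is itself a candidate, and a shorter
        one.\<close>
      case nle: False
      obtain s w i j where sw: "set s \<subseteq> S" "set w \<subseteq> S"
        "length w = length q" "a [^] (j::nat) \<otimes> horner B x (r' @ [e]) =
          horner B x (q @ [a]) \<otimes> horner B x (s @ [a [^] (i::nat) \<otimes> e]) \<oplus> horner B x w"
        using pseudo_division[OF S x q(1) t(1)[unfolded r']] nle by fastforce
      let ?s = "s @ [a [^] i \<otimes> e]"
      have aS: "a \<in> S" using q by auto
      have sS: "set ?s \<subseteq> S" using sw Spow[OF aS] rS SE(6) by auto
      have c: "horner B x ?s \<in> carrier B" "horner B x w \<in> carrier B" "a [^] j \<in> carrier B"
        using TC[OF hT[OF sS]] TC[OF hT[OF sw(2)]] SC[OF aS] by auto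
      have m: "horner B x (q @ [a]) \<otimes> horner B x ?s \<in> p" using I_r_closed q(2) c by auto
      have w: "horner B x w \<notin> p"
      proof
        assume "horner B x w \<in> p"
        then have "a [^] j \<otimes> horner B x (r' @ [e]) \<in> p" unfolding sw(4) using pI m by blast
        then show False
          using I_prime[OF c(3) hC(1)] pow_notin[OF SC[OF aS] q(3), of j] t(2) r' by auto
      qed
      have "horner B x w \<ominus> b \<otimes> (a [^] j \<otimes> t) =
        a [^] j \<otimes> (horner B x r \<ominus> b \<otimes> t) \<oplus> \<ominus> (horner B x (q @ [a]) \<otimes> horner B x ?s)"
      proof -
        have "horner B x w = a [^] j \<otimes> horner B x r \<oplus> \<ominus> (horner B x (q @ [a]) \<otimes> horner B x ?s)"
          unfolding r' sw(4) using c(1,2) hC(2) by algebra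
        then show ?thesis using c hC bC by algebra
      qed
      moreover have "a [^] j \<otimes> (horner B x r \<ominus> b \<otimes> t) \<in> p" using t(4) c I_l_closed by auto
      ultimately have "horner B x w \<ominus> b \<otimes> (a [^] j \<otimes> t) \<in> p" using m pI by auto
      moreover have "a [^] j \<otimes> t \<in> adjoin B S x" using TE(6) t(3) ST[OF Spow[OF aS]] by blast
      ultimately have "cand w" using w sw by (auto simp: cand_def)
      then show False using r(2)[of w] sw(3) nle r' by auto
    qed
    then show ?thesis ..
  qed
qed

end

context prime_and_field
begin

text \<open>A shortest relation of x modulo \<open>p\<close> acts as minimal polynomial, and x is
  sent to a root of its image. The witness is a product because two values must be non-zero: that of
  the leading coefficient \<open>a\<close>, so that the image keeps its degree and relations can be
  reduced by it, and that of \<open>e\<close>, which is congruent to a multiple of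
  \<open>b\<close>.\<close>

lemma extend_place_algebraic:
  assumes K: "root_closed K" and S: "subring S B" and x: "x \<in> carrier B"
    and alg: "set r0 \<subseteq> S" "horner B x r0 \<in> p" "\<not> set r0 \<subseteq> p"
    and b: "b \<in> adjoin B S x" "b \<notin> p"
  shows "\<exists>a\<in>S - p. lifts S (adjoin B S x) a b"
proof -
  note SE = subringE[OF S]
  let ?P = "\<lambda>r. set r \<subseteq> S \<and> horner B x r \<in> p \<and> \<not> set r \<subseteq> p"
  obtain r where r: "?P r" "\<And>r'. ?P r' \<Longrightarrow> length r \<le> length r'"
    using ex_has_least_nat[of ?P r0 length] alg by blast
  have "r \<noteq> []" using r by auto
  then obtain q a where qa: "r = q @ [a]" by (cases r rule: rev_cases) auto
  have qS: "set q \<subseteq> S" "a \<in> S" using r qa by auto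
  have qC: "set q \<subseteq> carrier B" "a \<in> carrier B" using qS SE(1) by blast+
  have min: "set r' \<subseteq> p" if "set r' \<subseteq> S" "length r' \<le> length q" "horner B x r' \<in> p" for r'
    using r(2)[of r'] that qa by fastforce
  have hr: "horner B x r = horner B x q \<oplus> x [^] length q \<otimes> a"
    unfolding qa using qC x by (subst horner_append) auto
  have "a \<notin> p"
  proof
    assume a: "a \<in> p"
    then have m: "x [^] length q \<otimes> a \<in> p" using x I_l_closed by auto
    have "horner B x q = horner B x r \<oplus> \<ominus> (x [^] length q \<otimes> a)"
      unfolding hr using qC x horner_closed[OF x qC(1)] by (simp add: a_assoc r_neg)
    then have "horner B x q \<in> p" using r m by auto
    then have "set q \<subseteq> p" using min qS by auto
    then show False using r a qa by auto
  qed
  \<comment> \<open>A relation of length one would be \<open>a\<close> itself, which is outside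
    \<open>p\<close>. Hence the image polynomial is non-constant and has a root.\<close>
  have "q \<noteq> []" using r qa \<open>a \<notin> p\<close> qC x by auto
  obtain e t where e: "e \<in> S" "e \<notin> p" "t \<in> adjoin B S x" "e \<ominus> b \<otimes> t \<in> p"
    using algebraic_multiple[OF S x, of q a b] min b r(1) \<open>a \<notin> p\<close> unfolding qa by blast
  have eC: "e \<in> carrier B" using e SE(1) by blast
  show ?thesis
    unfolding lifts_def
  proof (intro bexI[of _ "a \<otimes> e"] allI impI)
    show "a \<otimes> e \<in> S - p" using qS e I_prime[OF qC(2) eC] \<open>a \<notin> p\<close> SE(6) by auto
    fix G assume "place B K p G \<and> fst ` G = S \<and> (\<forall>s. (a \<otimes> e, s) \<in> G \<longrightarrow> s \<noteq> \<zero>\<^bsub>K\<^esub>)"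
    then have G: "place B K p G" "fst ` G = S" "\<And>s. (a \<otimes> e, s) \<in> G \<Longrightarrow> s \<noteq> \<zero>\<^bsub>K\<^esub>" by blast+
    have sG: "subring G (RDirProd B K)" using G(1) unfolding place_def by blast
    note GE = subringE[OF sG]
    have "e \<in> fst ` G" using G(2) e(1) by simp
    then obtain e' where e': "(e, e') \<in> G" by auto
    have nz: "s \<noteq> \<zero>\<^bsub>K\<^esub> \<and> e' \<noteq> \<zero>\<^bsub>K\<^esub>" if "(a, s) \<in> G" for s
    proof -
      have c: "s \<in> carrier K" "e' \<in> carrier K" using that e' GE(1) by (auto simp: RDirProd_simps)
      have "(a \<otimes> e, s \<otimes>\<^bsub>K\<^esub> e') \<in> G" using GE(6)[OF that e'] by (simp add: RDirProd_simps)
      then show ?thesis using G(3) c by fastforce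
    qed
    obtain Q where Q: "set Q \<subseteq> G" "map fst Q = r" using lift_list[of r fst G] G(2) r(1) by blast
    then obtain Q1 z where Q1: "Q = Q1 @ [(a, z)]" "map fst Q1 = q"
      unfolding qa by (auto simp: map_eq_append_conv)
    have z: "(a, z) \<in> G" "z \<noteq> \<zero>\<^bsub>K\<^esub>" using Q Q1 nz by auto
    have len: "length Q1 = length q" using Q1 by auto
    have sndK: "set (map snd R) \<subseteq> carrier K" if "set R \<subseteq> G" for R
      using that GE(1) by (auto simp: RDirProd_simps)
    have zK: "z \<in> carrier K" using sndK[OF Q(1)] Q1 by auto
    have "2 \<le> length (map snd Q)" "last (map snd Q) \<noteq> \<zero>\<^bsub>K\<^esub>"
      using Q1 len z(2) \<open>q \<noteq> []\<close> by (cases q; auto)+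
    then obtain y where y: "y \<in> carrier K" "horner K y (map snd Q) = \<zero>\<^bsub>K\<^esub>"
      using K sndK[OF Q(1)] unfolding root_closed_def by blast
    have xy: "(x, y) \<in> carrier (RDirProd B K)" using x y by (simp add: RDirProd_simps)
    have hp: "horner (RDirProd B K) (x, y) R = (horner B x (map fst R), horner K y (map snd R))"
      if "set R \<subseteq> G" for R
      using horner_pair x y subset_trans[OF that GE(1)] by auto
    \<comment> \<open>Induction on the length of the relation. Up to \<open>length q\<close> all
      coefficients are in \<open>p\<close> by minimality and map to 0. Beyond that, one cancellation
      against \<open>Q\<close> shortens it; carried out in the product ring, it treats
      \<open>B\<close> and \<open>K\<close> simultaneously.\<close>
    have *: "horner K y (map snd R) = \<zero>\<^bsub>K\<^esub>" if "set R \<subseteq> G" "horner B x (map fst R) \<in> p" for R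
      using that
    proof (induction "length R" arbitrary: R rule: less_induct)
      case less
      show ?case
      proof (cases "length R \<le> length q")
        case True
        have "set (map fst R) \<subseteq> p"
          using less.prems True G(2) by (intro min) auto
        then have "set (map snd R) \<subseteq> {\<zero>\<^bsub>K\<^esub>}"
          using place_zeros[OF G(1) less.prems(1)] by blast
        then show ?thesis using K.horner_zeros y by blast
      next
        case False
        then have "R \<noteq> []" by auto
        then obtain R1 v w where R1: "R = R1 @ [(v, w)]" by (cases R rule: rev_cases) auto
        have le: "length Q1 \<le> length R1" using False len R1 by auto
        obtain U where U: "set U \<subseteq> G" "length U = length R1" "horner (RDirProd B K) (x, y) U =
            (a, z) \<otimes>\<^bsub>RDirProd B K\<^esub> horner (RDirProd B K) (x, y) R
            \<ominus>\<^bsub>RDirProd B K\<^esub> (v, w) \<otimes>\<^bsub>RDirProd B K\<^esub> (x, y) [^]\<^bsub>RDirProd B K\<^esub> (length R1 - length Q1)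
              \<otimes>\<^bsub>RDirProd B K\<^esub> horner (RDirProd B K) (x, y) Q"
          using D.pseudo_division_step[OF sG xy _ _ le, of "(v, w)" "(a, z)"] less.prems(1) R1 Q(1) Q1(1)
          by auto
        define W where "W = (v, w) \<otimes>\<^bsub>RDirProd B K\<^esub> (x, y) [^]\<^bsub>RDirProd B K\<^esub> (length R1 - length Q1)"
        have vw: "(v, w) \<in> carrier (RDirProd B K)" using less.prems(1) R1 GE(1) by auto
        have WC: "W \<in> carrier (RDirProd B K)" unfolding W_def using vw xy by auto
        obtain X1 X2 where W: "W = (X1, X2)" by (cases W)
        have Xc: "X1 \<in> carrier B" "X2 \<in> carrier K" using WC W by (auto simp: RDirProd_simps)
        let ?R = "(horner B x (map fst R), horner K y (map snd R))"
        have RC: "horner B x (map fst R) \<in> carrier B" "horner K y (map snd R) \<in> carrier K"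
          using less.prems(2) a_Hcarr K.horner_closed[OF y(1) sndK[OF less.prems(1)]] by auto
        have rC: "horner B x r \<in> carrier B" using r a_Hcarr by auto
        \<comment> \<open>The subtracted pair has second entry 0 because y is a root of the image of
          \<open>r\<close>; so over \<open>K\<close> only the factor \<open>z\<close>, which is
          non-zero, has to be cancelled.\<close>
        have eq: "(horner B x (map fst U), horner K y (map snd U)) =
            (a \<otimes> horner B x (map fst R), z \<otimes>\<^bsub>K\<^esub> horner K y (map snd R))
            \<ominus>\<^bsub>RDirProd B K\<^esub> (X1 \<otimes> horner B x r, \<zero>\<^bsub>K\<^esub>)"
          using U(3) unfolding W_def[symmetric] hp[OF U(1)] hp[OF less.prems(1)] hp[OF Q(1)]
          by (simp add: W RDirProd_simps Q(2) y(2) Xc)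
        have m: "(X1 \<otimes> horner B x r, \<zero>\<^bsub>K\<^esub>) \<in> carrier (RDirProd B K)"
          "(a \<otimes> horner B x (map fst R), z \<otimes>\<^bsub>K\<^esub> horner K y (map snd R)) \<in> carrier (RDirProd B K)"
          using Xc rC RC zK qC by (auto simp: RDirProd_simps)
        have eq1: "horner B x (map fst U) = a \<otimes> horner B x (map fst R) \<oplus> \<ominus> (X1 \<otimes> horner B x r)"
          using arg_cong[OF eq, of fst] F.hom_add[OF m(2) D.a_inv_closed[OF m(1)]] F.hom_a_inv[OF m(1)]
          by (simp add: D.minus_eq)
        have eq2: "horner K y (map snd U) = z \<otimes>\<^bsub>K\<^esub> horner K y (map snd R)"
          using arg_cong[OF eq, of snd] E.hom_add[OF m(2) D.a_inv_closed[OF m(1)]] E.hom_a_inv[OF m(1)] zK RC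
          by (simp add: D.minus_eq)
        have "horner B x (map fst U) \<in> p"
          unfolding eq1 using r less.prems(2) qC Xc by (auto intro!: a_closed I_l_closed)
        then have "horner K y (map snd U) = \<zero>\<^bsub>K\<^esub>"
          using less.hyps[of U] U R1 by auto
        then show ?thesis using eq2 z zK RC K.integral by auto
      qed
    qed
    let ?G = "adjoin (RDirProd B K) G (x, y)"
    have G': "place B K p ?G" "G \<subseteq> ?G" "fst ` ?G = adjoin B S x"
      using extend_place[OF G(1) x y(1) *] G(2) by simp_all
    have "s \<noteq> \<zero>\<^bsub>K\<^esub>" if s: "(b, s) \<in> ?G" for s
    proof
      assume "s = \<zero>\<^bsub>K\<^esub>"
      obtain t' where t': "(t, t') \<in> ?G" using e(3) G'(3) by force
      have sG': "subring ?G (RDirProd B K)" using G' by (simp add: place_def)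
      have "t' \<in> carrier K" using t' subringE(1)[OF sG'] by (auto simp: RDirProd_simps)
      moreover have "(b \<otimes> t, s \<otimes>\<^bsub>K\<^esub> t') \<in> ?G"
        using subringE(6)[OF sG' s t'] by (simp add: RDirProd_simps)
      ultimately have "e' = \<zero>\<^bsub>K\<^esub>"
        using place_functional[OF G'(1) subsetD[OF G'(2) e'] _ e(4)] \<open>s = \<zero>\<^bsub>K\<^esub>\<close> by auto
      then show False using nz[OF z(1)] by auto
    qed
    with G' show "\<exists>G'. place B K p G' \<and> G \<subseteq> G' \<and> fst ` G' = adjoin B S x \<and> (\<forall>s. (b, s) \<in> G' \<longrightarrow> s \<noteq> \<zero>\<^bsub>K\<^esub>)"
      by blast
  qed
qed

lemma lifts_trans:
  assumes "lifts S T a b" "lifts T U b c"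
  shows "lifts S U a c"
  unfolding lifts_def
proof (intro allI impI)
  fix G assume "place B K p G \<and> fst ` G = S \<and> (\<forall>s. (a, s) \<in> G \<longrightarrow> s \<noteq> \<zero>\<^bsub>K\<^esub>)"
  then obtain G1 where G1: "place B K p G1" "G \<subseteq> G1" "fst ` G1 = T" "\<forall>s. (b, s) \<in> G1 \<longrightarrow> s \<noteq> \<zero>\<^bsub>K\<^esub>"
    using assms(1) unfolding lifts_def by blast
  then obtain G2 where G2: "place B K p G2" "G1 \<subseteq> G2" "fst ` G2 = U" "\<forall>s. (c, s) \<in> G2 \<longrightarrow> s \<noteq> \<zero>\<^bsub>K\<^esub>"
    using assms(2) unfolding lifts_def by blast
  show "\<exists>G'. place B K p G' \<and> G \<subseteq> G' \<and> fst ` G' = U \<and> (\<forall>s. (c, s) \<in> G' \<longrightarrow> s \<noteq> \<zero>\<^bsub>K\<^esub>)"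
    by (rule exI[of _ G2]) (intro conjI G2 order_trans[OF G1(2) G2(2)])
qed

text \<open>The non-vanishing condition is pushed down the tower one generator at a time, according
  to whether that generator is algebraic or transcendental modulo \<open>p\<close>.\<close>

lemma extend_place_adjoins:
  assumes K: "root_closed K" and "subring S B" and "set xs \<subseteq> carrier B"
    and "b \<in> foldl (adjoin B) S xs" "b \<notin> p"
  shows "\<exists>a\<in>S - p. lifts S (foldl (adjoin B) S xs) a b"
  using assms(2-)
proof (induction xs arbitrary: S)
  case Nil
  then show ?case by (intro bexI[of _ b]) (auto simp: lifts_def)
next
  case (Cons x xs)
  have x: "x \<in> carrier B" "set xs \<subseteq> carrier B" using Cons.prems by auto
  obtain a where a: "a \<in> adjoin B S x" "a \<notin> p" "lifts (adjoin B S x) (foldl (adjoin B) S (x # xs)) a b"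
    using Cons.IH[OF adjoin_subring[OF Cons.prems(1) x(1)] x(2)] Cons.prems by auto
  have "\<exists>a'\<in>S - p. lifts S (adjoin B S x) a' a"
  proof (cases "\<exists>q. set q \<subseteq> S \<and> horner B x q \<in> p \<and> \<not> set q \<subseteq> p")
    case True
    then show ?thesis using extend_place_algebraic[OF K Cons.prems(1) x(1) _ _ _ a(1,2)] by blast
  next
    case False
    then show ?thesis using extend_place_transcendental[OF K Cons.prems(1) x(1) _ a(1,2)] by blast
  qed
  then show ?case using lifts_trans[OF _ a(3)] by blast
qed

end

text \<open>An ideal M maximal among those containing no power of \<open>c\<close> is prime:
  enlarging M by a and by b brings in powers of \<open>c\<close>, and their product lies in M +
  (ab). The exponent 0 makes all these ideals proper.\<close>

lemma (in cring) ex_primeideal_avoiding: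
  assumes c: "c \<in> carrier R" and nil: "\<And>n::nat. c [^] n \<noteq> \<zero>"
  shows "\<exists>p. primeideal p R \<and> c \<notin> p"
proof -
  define A where "A = {I. ideal I R \<and> (\<forall>n::nat. c [^] n \<notin> I)}"
  have "\<exists>M\<in>A. \<forall>I\<in>A. M \<subseteq> I \<longrightarrow> I = M"
  proof (rule subset_Zorn)
    fix C assume C: "subset.chain A C"
    show "\<exists>U\<in>A. \<forall>I\<in>C. I \<subseteq> U"
    proof (cases "C = {}")
      case True
      then show ?thesis using zeroideal nil by (intro bexI[of _ "{\<zero>}"]) (auto simp: A_def)
    next
      case False
      have "subset.chain {I. ideal I R} C"
        using C unfolding pred_on.chain_def A_def by auto
      then have "ideal (\<Union>C) R" using chain_Union_is_ideal False by presburger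
      then have "\<Union>C \<in> A" using C unfolding pred_on.chain_def A_def by blast
      then show ?thesis by blast
    qed
  qed
  then obtain M where M: "M \<in> A" and max: "\<And>I. I \<in> A \<Longrightarrow> M \<subseteq> I \<Longrightarrow> I = M" by blast
  then interpret M: ideal M R by (simp add: A_def)
  have bigger: "\<exists>(n::nat) i r. i \<in> M \<and> r \<in> carrier R \<and> c [^] n = i \<oplus> r \<otimes> a"
    if a: "a \<in> carrier R" "a \<notin> M" for a
  proof (rule ccontr)
    assume no: "\<not> ?thesis"
    have I: "ideal (M <+> PIdl a) R"
      by (rule add_ideals[OF M.is_ideal cgenideal_ideal[OF a(1)]])
    have mem: "z \<in> M <+> PIdl a \<longleftrightarrow> (\<exists>i\<in>M. \<exists>r\<in>carrier R. z = i \<oplus> r \<otimes> a)" for z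
      by (auto simp: set_add_def' cgenideal_def)
    have "M <+> PIdl a \<in> A" using I no unfolding A_def mem_Collect_eq mem by blast
    moreover have "M \<subseteq> M <+> PIdl a"
    proof
      fix i assume i: "i \<in> M"
      then have "i = i \<oplus> \<zero> \<otimes> a" using a M.a_Hcarr by simp
      then show "i \<in> M <+> PIdl a" unfolding mem using i by blast
    qed
    ultimately have "M <+> PIdl a = M" using max by blast
    moreover have "a = \<zero> \<oplus> \<one> \<otimes> a" using a by simp
    then have "a \<in> M <+> PIdl a" unfolding mem using M.zero_closed one_closed by blast
    ultimately show False using a by blast
  qed
  have "primeideal M R"
  proof (rule primeidealI[OF M.is_ideal is_cring])
    have "c [^] (0::nat) \<notin> M" using M unfolding A_def by blast
    then show "carrier R \<noteq> M" by auto
    fix a b assume ab: "a \<in> carrier R" "b \<in> carrier R" "a \<otimes> b \<in> M"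
    show "a \<in> M \<or> b \<in> M"
    proof (rule ccontr)
      assume "\<not> (a \<in> M \<or> b \<in> M)"
      then obtain m n i j r s where *: "i \<in> M" "r \<in> carrier R" "c [^] (m::nat) = i \<oplus> r \<otimes> a"
        "j \<in> M" "s \<in> carrier R" "c [^] (n::nat) = j \<oplus> s \<otimes> b"
        using bigger[of a] bigger[of b] ab by blast
      have C: "i \<in> carrier R" "j \<in> carrier R" using * M.a_Hcarr by auto
      have "c [^] (m + n) = (i \<oplus> r \<otimes> a) \<otimes> (j \<oplus> s \<otimes> b)"
        using c *(3,6) nat_pow_mult[of c m n] by simp
      also have "\<dots> = i \<otimes> (j \<oplus> s \<otimes> b) \<oplus> ((r \<otimes> a) \<otimes> j \<oplus> (r \<otimes> s) \<otimes> (a \<otimes> b))"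
        using * C ab by algebra
      also have "\<dots> \<in> M"
        using * C ab M.a_closed[OF M.I_r_closed M.a_closed[OF M.I_l_closed M.I_l_closed]] by simp
      finally show False using M unfolding A_def by blast
    qed
  qed
  moreover have "c [^] (1::nat) \<notin> M" using M unfolding A_def by blast
  ultimately show ?thesis using c by auto
qed

section \<open>Homomorphisms to an algebraically closed field\<close>

text \<open>The k-rational points of the spectrum of \<open>A\<close>.\<close>

abbreviation points :: "('k, 'm) ring_scheme \<Rightarrow> ('k, 'a, 'n) module_scheme \<Rightarrow> ('a \<Rightarrow> 'k) set"
  where "points K A \<equiv> alg_hom K A (scalar_algebra K)"

lemma scalar_algebra_simps [simp]:
  "carrier (scalar_algebra K) = carrier K" "monoid.mult (scalar_algebra K) = monoid.mult K"
  "one (scalar_algebra K) = one K" "zero (scalar_algebra K) = zero K"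
  "add (scalar_algebra K) = add K" "smult (scalar_algebra K) = monoid.mult K"
  by (simp_all add: scalar_algebra_def)

lemma scalar_algebra_algebra:
  assumes "cring K" shows "algebra K (scalar_algebra K)"
proof -
  interpret K: cring K by fact
  have cr: "cring (scalar_algebra K)"
    by (intro cringI abelian_groupI comm_monoidI)
      (auto simp: K.a_ac K.m_ac K.l_distr K.r_distr intro: bexI[of _ "\<ominus>\<^bsub>K\<^esub> _"] K.l_neg)
  show ?thesis
    by (intro algebraI assms cr) (auto simp: K.l_distr K.r_distr K.m_ac)
qed

lemma (in algebra) scalars_subring: "subring ((\<lambda>c. c \<odot>\<^bsub>M\<^esub> \<one>\<^bsub>M\<^esub>) ` carrier R) M"
proof (rule subringI; clarsimp?)
  show "\<one>\<^bsub>M\<^esub> \<in> (\<lambda>c. c \<odot>\<^bsub>M\<^esub> \<one>\<^bsub>M\<^esub>) ` carrier R"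
    by (intro image_eqI[of _ _ \<one>]) auto
  fix c assume c: "c \<in> carrier R"
  show "\<ominus>\<^bsub>M\<^esub> (c \<odot>\<^bsub>M\<^esub> \<one>\<^bsub>M\<^esub>) \<in> (\<lambda>c. c \<odot>\<^bsub>M\<^esub> \<one>\<^bsub>M\<^esub>) ` carrier R"
    using c by (intro image_eqI[of _ _ "\<ominus> c"]) (auto simp: smult_l_minus)
  fix d assume d: "d \<in> carrier R"
  show "c \<odot>\<^bsub>M\<^esub> \<one>\<^bsub>M\<^esub> \<otimes>\<^bsub>M\<^esub> (d \<odot>\<^bsub>M\<^esub> \<one>\<^bsub>M\<^esub>) \<in> (\<lambda>c. c \<odot>\<^bsub>M\<^esub> \<one>\<^bsub>M\<^esub>) ` carrier R"
    using c d by (intro image_eqI[of _ _ "c \<otimes> d"]) (auto simp: smult_assoc1 smult_assoc2)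
  show "c \<odot>\<^bsub>M\<^esub> \<one>\<^bsub>M\<^esub> \<oplus>\<^bsub>M\<^esub> d \<odot>\<^bsub>M\<^esub> \<one>\<^bsub>M\<^esub> \<in> (\<lambda>c. c \<odot>\<^bsub>M\<^esub> \<one>\<^bsub>M\<^esub>) ` carrier R"
    using c d by (intro image_eqI[of _ _ "c \<oplus> d"]) (auto simp: smult_l_distr)
qed

text \<open>The generated subring becomes a tower of single adjunctions, along which places are
  extended and elements are written as polynomial values.\<close>

lemma finitely_generated_adjoins:
  assumes "finitely_generated_algebra K B"
  obtains xs where "set xs \<subseteq> carrier B"
    "carrier B = foldl (adjoin B) ((\<lambda>c. c \<odot>\<^bsub>B\<^esub> \<one>\<^bsub>B\<^esub>) ` carrier K) xs"
proof -
  interpret algebra K B using assms by (simp add: finitely_generated_algebra_def)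
  let ?S = "(\<lambda>c. c \<odot>\<^bsub>B\<^esub> \<one>\<^bsub>B\<^esub>) ` carrier K"
  obtain F where F: "finite F" "F \<subseteq> carrier B" "generate_ring B (?S \<union> F) = carrier B"
    using assms by (auto simp: finitely_generated_algebra_def)
  obtain xs where xs: "set xs = F" using F(1) finite_list by blast
  note A = adjoins_subring[OF scalars_subring, of xs]
  have "carrier B \<subseteq> foldl (adjoin B) ?S xs"
    unfolding F(3)[symmetric] using A F(2) xs
    by (intro generate_ring_min_subring1) auto
  moreover have "foldl (adjoin B) ?S xs \<subseteq> carrier B"
    using subringE(1)[OF A(1)] F(2) xs by auto
  ultimately show ?thesis using that[of xs] xs F(2) by auto
qed

text \<open>The Nullstellensatz: relative to a prime that avoids \<open>c\<close>, the inverse of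
  the structure map on the scalars is extended to all of \<open>B\<close> with a non-zero value at
  \<open>c\<close>. Linearity is inherited from the scalars.\<close>

theorem ex_alg_hom_of_not_nilpotent:
  assumes "field K" and rc: "root_closed K" and fg: "finitely_generated_algebra K B"
    and c: "c \<in> carrier B" "\<And>n::nat. c [^]\<^bsub>B\<^esub> n \<noteq> \<zero>\<^bsub>B\<^esub>"
  shows "\<exists>\<phi>\<in>points K B. \<phi> c \<noteq> \<zero>\<^bsub>K\<^esub>"
proof -
  interpret algebra K B using fg by (simp add: finitely_generated_algebra_def)
  obtain p where p: "primeideal p B" "c \<notin> p" using ex_primeideal_avoiding[OF c] by auto
  interpret P: prime_and_field p B K using p(1) assms(1) by (simp add: prime_and_field_def)
  let ?S = "(\<lambda>k. k \<odot>\<^bsub>B\<^esub> \<one>\<^bsub>B\<^esub>) ` carrier K"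
  obtain xs where xs: "set xs \<subseteq> carrier B" "carrier B = foldl (adjoin B) ?S xs"
    using finitely_generated_adjoins[OF fg] by blast
  have "c \<in> foldl (adjoin B) ?S xs" using c(1) xs(2) by simp
  from P.extend_place_adjoins[OF rc scalars_subring xs(1) this p(2)]
  obtain a where a: "a \<in> ?S - p"
    "P.lifts ?S (foldl (adjoin B) ?S xs) a c"
    by (rule bexE) (rule that)
  \<comment> \<open>The ground place sends the scalar k times 1 to k. It respects \<open>p\<close>,
    as a non-zero k gives a unit of \<open>B\<close> and \<open>p\<close> is proper.\<close>
  define G where "G = (\<lambda>k. (k \<odot>\<^bsub>B\<^esub> \<one>\<^bsub>B\<^esub>, k)) ` carrier K"
  have "subring G (RDirProd B K)"
  proof (rule P.D.subringI)
    show "G \<subseteq> carrier (RDirProd B K)" by (auto simp: G_def RDirProd_simps)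
    show "\<one>\<^bsub>RDirProd B K\<^esub> \<in> G"
      unfolding G_def RDirProd_simps by (intro image_eqI[of _ _ "\<one>\<^bsub>K\<^esub>"]) auto
    show "h1 \<otimes>\<^bsub>RDirProd B K\<^esub> h2 \<in> G" "h1 \<oplus>\<^bsub>RDirProd B K\<^esub> h2 \<in> G" if "h1 \<in> G" "h2 \<in> G" for h1 h2
    proof -
      obtain k l where kl: "k \<in> carrier K" "l \<in> carrier K" "h1 = (k \<odot>\<^bsub>B\<^esub> \<one>\<^bsub>B\<^esub>, k)" "h2 = (l \<odot>\<^bsub>B\<^esub> \<one>\<^bsub>B\<^esub>, l)"
        using \<open>h1 \<in> G\<close> \<open>h2 \<in> G\<close> by (auto simp: G_def)
      show "h1 \<otimes>\<^bsub>RDirProd B K\<^esub> h2 \<in> G"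
        unfolding G_def using kl
        by (intro image_eqI[of _ _ "k \<otimes>\<^bsub>K\<^esub> l"]) (auto simp: RDirProd_simps smult_assoc1 smult_assoc2)
      show "h1 \<oplus>\<^bsub>RDirProd B K\<^esub> h2 \<in> G"
        unfolding G_def using kl
        by (intro image_eqI[of _ _ "k \<oplus>\<^bsub>K\<^esub> l"]) (auto simp: RDirProd_simps smult_l_distr)
    qed
    show "\<ominus>\<^bsub>RDirProd B K\<^esub> h \<in> G" if "h \<in> G" for h
    proof -
      obtain k where k: "k \<in> carrier K" "h = (k \<odot>\<^bsub>B\<^esub> \<one>\<^bsub>B\<^esub>, k)" using \<open>h \<in> G\<close> by (auto simp: G_def)
      then have h: "h \<in> carrier (RDirProd B K)" by (auto simp: RDirProd_simps)
      have "\<ominus>\<^bsub>RDirProd B K\<^esub> h = (\<ominus>\<^bsub>B\<^esub> (k \<odot>\<^bsub>B\<^esub> \<one>\<^bsub>B\<^esub>), \<ominus>\<^bsub>K\<^esub> k)"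
        using P.F.hom_a_inv[OF h] P.E.hom_a_inv[OF h] unfolding k(2) by (simp add: prod_eq_iff)
      then show ?thesis
        unfolding G_def using k by (intro image_eqI[of _ _ "\<ominus>\<^bsub>K\<^esub> k"]) (auto simp: smult_l_minus)
    qed
  qed
  moreover have "k = \<zero>\<^bsub>K\<^esub>" if k: "k \<in> carrier K" "k \<odot>\<^bsub>B\<^esub> \<one>\<^bsub>B\<^esub> \<in> p" for k
  proof (rule ccontr)
    assume "k \<noteq> \<zero>\<^bsub>K\<^esub>"
    then have i: "inv\<^bsub>K\<^esub> k \<in> carrier K" "inv\<^bsub>K\<^esub> k \<otimes>\<^bsub>K\<^esub> k = \<one>\<^bsub>K\<^esub>"
      using k(1) P.K.field_Units by auto
    have "(inv\<^bsub>K\<^esub> k \<odot>\<^bsub>B\<^esub> \<one>\<^bsub>B\<^esub>) \<otimes>\<^bsub>B\<^esub> (k \<odot>\<^bsub>B\<^esub> \<one>\<^bsub>B\<^esub>) = \<one>\<^bsub>B\<^esub>"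
      using i k by (simp add: smult_assoc1[symmetric] smult_assoc2)
    moreover have "(inv\<^bsub>K\<^esub> k \<odot>\<^bsub>B\<^esub> \<one>\<^bsub>B\<^esub>) \<otimes>\<^bsub>B\<^esub> (k \<odot>\<^bsub>B\<^esub> \<one>\<^bsub>B\<^esub>) \<in> p" using k(2) i P.I_l_closed by auto
    ultimately show False using P.one_imp_carrier P.I_notcarr by auto
  qed
  ultimately have pG: "place B K p G" by (auto simp: place_def G_def)
  have G: "fst ` G = ?S" by (auto simp: G_def image_image)
  \<comment> \<open>With s = 0 the element \<open>a\<close> would be 0 and so belong to
    \<open>p\<close>.\<close>
  have nz: "\<forall>s. (a, s) \<in> G \<longrightarrow> s \<noteq> \<zero>\<^bsub>K\<^esub>" using a(1) by (auto simp: G_def)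
  obtain G' where G': "place B K p G'" "G \<subseteq> G'" "fst ` G' = carrier B"
    "\<forall>s. (c, s) \<in> G' \<longrightarrow> s \<noteq> \<zero>\<^bsub>K\<^esub>"
    using mp[OF spec[OF a(2)[unfolded P.lifts_def], of G] conjI[OF pG conjI[OF G nz]]] unfolding xs(2)[symmetric] by blast
  have sub: "subring G' (RDirProd B K)" using G'(1) by (simp add: place_def)
  note GE = subringE[OF sub]
  define \<phi> where "\<phi> u = (THE s. (u, s) \<in> G')" for u
  have \<phi>: "\<phi> u = s" if "(u, s) \<in> G'" for u s
  proof -
    have "u \<in> carrier B" using that GE(1) by (auto simp: RDirProd_simps)
    then have "t = s" if "(u, t) \<in> G'" for t
      using P.place_functional[OF G'(1) that \<open>(u, s) \<in> G'\<close>] by (simp add: M.minus_eq M.r_neg)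
    then show ?thesis unfolding \<phi>_def using that by blast
  qed
  have gr: "(u, \<phi> u) \<in> G'" if "u \<in> carrier B" for u
  proof -
    have "u \<in> fst ` G'" using that G'(3) by simp
    then obtain s where "(u, s) \<in> G'" by auto
    then show ?thesis using \<phi> by simp
  qed
  have K: "\<phi> u \<in> carrier K" if "u \<in> carrier B" for u
    using gr[OF that] GE(1) by (auto simp: RDirProd_simps)
  have sc: "\<phi> (k \<odot>\<^bsub>B\<^esub> \<one>\<^bsub>B\<^esub>) = k" if "k \<in> carrier K" for k
    using that G'(2) by (intro \<phi>) (auto simp: G_def)
  have mu: "\<phi> (u \<otimes>\<^bsub>B\<^esub> v) = \<phi> u \<otimes>\<^bsub>K\<^esub> \<phi> v" if "u \<in> carrier B" "v \<in> carrier B" for u v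
    using GE(6)[OF gr[OF that(1)] gr[OF that(2)]] by (intro \<phi>) (simp add: RDirProd_simps)
  have "\<phi> \<in> points K B"
    unfolding alg_hom_def ring_hom_def
  proof (safe; simp)
    show "\<phi> \<one>\<^bsub>B\<^esub> = \<one>\<^bsub>K\<^esub>" using sc[of "\<one>\<^bsub>K\<^esub>"] by simp
    fix u v assume uv: "u \<in> carrier B" "v \<in> carrier B"
    show "\<phi> (u \<oplus>\<^bsub>B\<^esub> v) = \<phi> u \<oplus>\<^bsub>K\<^esub> \<phi> v"
      using GE(7)[OF gr[OF uv(1)] gr[OF uv(2)]] by (intro \<phi>) (simp add: RDirProd_simps)
  next
    fix k u assume ku: "k \<in> carrier K" "u \<in> carrier B"
    have "k \<odot>\<^bsub>B\<^esub> u = (k \<odot>\<^bsub>B\<^esub> \<one>\<^bsub>B\<^esub>) \<otimes>\<^bsub>B\<^esub> u" using ku by (simp add: smult_assoc2)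
    then show "\<phi> (k \<odot>\<^bsub>B\<^esub> u) = k \<otimes>\<^bsub>K\<^esub> \<phi> u" using mu sc ku by simp
  qed (use K mu in auto)
  moreover have "\<phi> c \<noteq> \<zero>\<^bsub>K\<^esub>" using gr[OF c(1)] G'(4) by auto
  ultimately show ?thesis by blast
qed

section \<open>Polynomials in several variables\<close>

text \<open>A list of pairs of a coefficient and a word in the variables represents the
  polynomial that is the sum of the corresponding monomials.\<close>

definition word_eval :: "('a, 'm) ring_scheme \<Rightarrow> ('i \<Rightarrow> 'a) \<Rightarrow> 'i list \<Rightarrow> 'a"
  where "word_eval A a w = foldr (\<lambda>i z. a i \<otimes>\<^bsub>A\<^esub> z) w \<one>\<^bsub>A\<^esub>"

definition lp_eval :: "('k, 'a, 'm) module_scheme \<Rightarrow> ('i \<Rightarrow> 'a) \<Rightarrow> ('k \<times> 'i list) list \<Rightarrow> 'a"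
  where "lp_eval A a l = foldr (\<lambda>t z. fst t \<odot>\<^bsub>A\<^esub> word_eval A a (snd t) \<oplus>\<^bsub>A\<^esub> z) l \<zero>\<^bsub>A\<^esub>"

definition lp_over :: "('k, 'm) ring_scheme \<Rightarrow> 'i set \<Rightarrow> ('k \<times> 'i list) list \<Rightarrow> bool"
  where "lp_over K I l \<longleftrightarrow> (\<forall>t\<in>set l. fst t \<in> carrier K \<and> set (snd t) \<subseteq> I)"

text \<open>A property of the list: terms that cancel or have coefficient 0 count as well, and the
  empty list has every degree.\<close>

definition lp_homog :: "nat \<Rightarrow> ('k \<times> 'i list) list \<Rightarrow> bool"
  where "lp_homog d l \<longleftrightarrow> (\<forall>t\<in>set l. length (snd t) = d)"

definition lp_scale :: "('k, 'm) ring_scheme \<Rightarrow> 'k \<Rightarrow> ('k \<times> 'i list) list \<Rightarrow> ('k \<times> 'i list) list"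
  where "lp_scale K c l = map (\<lambda>t. (c \<otimes>\<^bsub>K\<^esub> fst t, snd t)) l"

definition lp_mult ::
    "('k, 'm) ring_scheme \<Rightarrow> ('k \<times> 'i list) list \<Rightarrow> ('k \<times> 'i list) list \<Rightarrow> ('k \<times> 'i list) list"
  where "lp_mult K l l' = concat (map (\<lambda>t. map (\<lambda>t'. (fst t \<otimes>\<^bsub>K\<^esub> fst t', snd t @ snd t')) l') l)"

primrec lp_power :: "('k, 'm) ring_scheme \<Rightarrow> ('k \<times> 'i list) list \<Rightarrow> nat \<Rightarrow> ('k \<times> 'i list) list" where
  "lp_power K l 0 = [(\<one>\<^bsub>K\<^esub>, [])]"
| "lp_power K l (Suc n) = lp_mult K l (lp_power K l n)"

definition lp_rename :: "('i \<Rightarrow> 'j) \<Rightarrow> ('k \<times> 'i list) list \<Rightarrow> ('k \<times> 'j list) list"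
  where "lp_rename f l = map (\<lambda>t. (fst t, map f (snd t))) l"

abbreviation lp_value :: "('k, 'm) ring_scheme \<Rightarrow> ('i \<Rightarrow> 'k) \<Rightarrow> ('k \<times> 'i list) list \<Rightarrow> 'k"
  where "lp_value K \<equiv> lp_eval (scalar_algebra K)"

lemma word_eval_simps [simp]:
  "word_eval A a [] = \<one>\<^bsub>A\<^esub>" "word_eval A a (i # w) = a i \<otimes>\<^bsub>A\<^esub> word_eval A a w"
  by (simp_all add: word_eval_def)

lemma lp_eval_simps [simp]:
  "lp_eval A a [] = \<zero>\<^bsub>A\<^esub>"
  "lp_eval A a (t # l) = fst t \<odot>\<^bsub>A\<^esub> word_eval A a (snd t) \<oplus>\<^bsub>A\<^esub> lp_eval A a l"
  by (simp_all add: lp_eval_def)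

lemma lp_over_simps [simp]:
  "lp_over K I []"
  "lp_over K I (t # l) \<longleftrightarrow> fst t \<in> carrier K \<and> set (snd t) \<subseteq> I \<and> lp_over K I l"
  "lp_over K I (l @ l') \<longleftrightarrow> lp_over K I l \<and> lp_over K I l'"
  by (auto simp: lp_over_def)

lemma lp_over_mono: "lp_over K I l \<Longrightarrow> I \<subseteq> J \<Longrightarrow> lp_over K J l"
  by (auto simp: lp_over_def)

lemma lp_over_scale: "cring K \<Longrightarrow> c \<in> carrier K \<Longrightarrow> lp_over K I l \<Longrightarrow> lp_over K I (lp_scale K c l)"
  by (auto simp: lp_over_def lp_scale_def cring.cring_simprules)

lemma lp_over_mult: "cring K \<Longrightarrow> lp_over K I l \<Longrightarrow> lp_over K I l' \<Longrightarrow> lp_over K I (lp_mult K l l')"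
  by (fastforce simp: lp_over_def lp_mult_def cring.cring_simprules)

lemma lp_over_power: "cring K \<Longrightarrow> lp_over K I l \<Longrightarrow> lp_over K I (lp_power K l n)"
  by (induction n) (auto simp: lp_over_mult cring.cring_simprules)

lemma lp_over_rename: "lp_over K I l \<Longrightarrow> f ` I \<subseteq> J \<Longrightarrow> lp_over K J (lp_rename f l)"
  by (fastforce simp: lp_over_def lp_rename_def)

lemma lp_homog_append: "lp_homog d l \<Longrightarrow> lp_homog d l' \<Longrightarrow> lp_homog d (l @ l')"
  by (auto simp: lp_homog_def)

lemma lp_homog_scale: "lp_homog d l \<Longrightarrow> lp_homog d (lp_scale K c l)"
  by (auto simp: lp_homog_def lp_scale_def)

lemma lp_homog_mult: "lp_homog d l \<Longrightarrow> lp_homog e l' \<Longrightarrow> lp_homog (d + e) (lp_mult K l l')"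
  by (auto simp: lp_homog_def lp_mult_def)

lemma lp_homog_power: "lp_homog d l \<Longrightarrow> lp_homog (d * n) (lp_power K l n)"
  by (induction n) (auto simp: lp_homog_mult lp_homog_def[of 0])

lemma word_eval_cong: "(\<And>i. i \<in> set w \<Longrightarrow> a i = b i) \<Longrightarrow> word_eval A a w = word_eval A b w"
  by (induction w) auto

lemma lp_eval_cong:
  "lp_over K I l \<Longrightarrow> (\<And>i. i \<in> I \<Longrightarrow> a i = b i) \<Longrightarrow> lp_eval A a l = lp_eval A b l"
  by (induction l) (auto intro!: arg_cong2[where f = "add A"] arg_cong2[where f = "smult A"] word_eval_cong)

lemma lp_eval_rename: "lp_eval A a (lp_rename f l) = lp_eval A (a \<circ> f) l"
proof -
  have "word_eval A a (map f w) = word_eval A (a \<circ> f) w" for w by (induction w) auto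
  then show ?thesis by (induction l) (auto simp: lp_rename_def)
qed

context algebra
begin

lemma word_eval_closed [simp]:
  "a \<in> I \<rightarrow> carrier M \<Longrightarrow> set w \<subseteq> I \<Longrightarrow> word_eval M a w \<in> carrier M"
  by (induction w) (auto simp: Pi_iff)

lemma word_eval_append:
  "a \<in> I \<rightarrow> carrier M \<Longrightarrow> set w \<subseteq> I \<Longrightarrow> set v \<subseteq> I \<Longrightarrow>
    word_eval M a (w @ v) = word_eval M a w \<otimes>\<^bsub>M\<^esub> word_eval M a v"
  by (induction w) (auto simp: Pi_iff m_assoc)

lemma lp_eval_closed [simp]:
  "a \<in> I \<rightarrow> carrier M \<Longrightarrow> lp_over R I l \<Longrightarrow> lp_eval M a l \<in> carrier M"
  by (induction l) auto

lemma lp_eval_append: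
  "a \<in> I \<rightarrow> carrier M \<Longrightarrow> lp_over R I l \<Longrightarrow> lp_over R I l' \<Longrightarrow>
    lp_eval M a (l @ l') = lp_eval M a l \<oplus>\<^bsub>M\<^esub> lp_eval M a l'"
  by (induction l) (auto simp: M.a_assoc)

lemma lp_eval_scale:
  "a \<in> I \<rightarrow> carrier M \<Longrightarrow> lp_over R I l \<Longrightarrow> c \<in> carrier R \<Longrightarrow>
    lp_eval M a (lp_scale R c l) = c \<odot>\<^bsub>M\<^esub> lp_eval M a l"
  by (induction l) (auto simp: lp_scale_def smult_r_distr smult_assoc1)

lemma lp_eval_mult:
  assumes "a \<in> I \<rightarrow> carrier M" "lp_over R I l" "lp_over R I l'"
  shows "lp_eval M a (lp_mult R l l') = lp_eval M a l \<otimes>\<^bsub>M\<^esub> lp_eval M a l'"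
proof -
  have *: "lp_eval M a (map (\<lambda>t'. (c \<otimes>\<^bsub>R\<^esub> fst t', w @ snd t')) l') =
    (c \<odot>\<^bsub>M\<^esub> word_eval M a w) \<otimes>\<^bsub>M\<^esub> lp_eval M a l'"
    if "c \<in> carrier R" "set w \<subseteq> I" for c w
    using assms(3)
  proof (induction l')
    case (Cons t l')
    let ?x = "word_eval M a w" and ?y = "word_eval M a (snd t)"
    have c: "?x \<in> carrier M" "?y \<in> carrier M" "fst t \<in> carrier R" "lp_eval M a l' \<in> carrier M"
      using Cons.prems that assms(1) by auto
    have "(c \<otimes>\<^bsub>R\<^esub> fst t) \<odot>\<^bsub>M\<^esub> (?x \<otimes>\<^bsub>M\<^esub> ?y) = (c \<odot>\<^bsub>M\<^esub> ?x) \<otimes>\<^bsub>M\<^esub> (fst t \<odot>\<^bsub>M\<^esub> ?y)"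
      using that c by (simp add: smult_assoc1 smult_assoc2 m_comm[of ?x] m_comm[of "_ \<odot>\<^bsub>M\<^esub> ?x"])
    then show ?case using Cons that c assms(1)
      by (simp add: word_eval_append[OF assms(1)] r_distr)
  qed (use that assms in auto)
  show ?thesis using assms(2)
  proof (induction l)
    case (Cons t l)
    have o: "lp_over R I (map (\<lambda>t'. (fst t \<otimes>\<^bsub>R\<^esub> fst t', snd t @ snd t')) l')"
      using Cons.prems assms(3) by (auto simp: lp_over_def)
    have o': "lp_over R I (lp_mult R l l')" using Cons.prems assms(3) by (intro lp_over_mult R_cring) auto
    have "lp_eval M a (lp_mult R (t # l) l') =
      lp_eval M a (map (\<lambda>t'. (fst t \<otimes>\<^bsub>R\<^esub> fst t', snd t @ snd t')) l') \<oplus>\<^bsub>M\<^esub> lp_eval M a (lp_mult R l l')"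
      using lp_eval_append[OF assms(1) o o'] by (simp add: lp_mult_def)
    then show ?case
      using Cons * assms by (simp add: l_distr)
  qed (use assms in \<open>auto simp: lp_mult_def\<close>)
qed

lemma lp_eval_power:
  assumes "a \<in> I \<rightarrow> carrier M" "lp_over R I l"
  shows "lp_eval M a (lp_power R l n) = lp_eval M a l [^]\<^bsub>M\<^esub> n"
proof (induction n)
  case 0
  then show ?case by simp
next
  case (Suc n)
  then show ?case
    using lp_eval_mult[OF assms lp_over_power[OF R_cring assms(2)]] lp_eval_closed[OF assms]
    by (simp add: m_comm)
qed

end

lemma lp_eval_alg_hom:
  assumes "algebra K A" "algebra K B" "\<phi> \<in> alg_hom K A B" "a \<in> I \<rightarrow> carrier A" "lp_over K I l"
  shows "\<phi> (lp_eval A a l) = lp_eval B (\<phi> \<circ> a) l"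
proof -
  interpret A: algebra K A by fact
  interpret B: algebra K B by fact
  have h: "\<phi> \<in> ring_hom A B" "\<And>c x. c \<in> carrier K \<Longrightarrow> x \<in> carrier A \<Longrightarrow> \<phi> (c \<odot>\<^bsub>A\<^esub> x) = c \<odot>\<^bsub>B\<^esub> \<phi> x"
    using assms(3) by (auto simp: alg_hom_def)
  have 0: "\<phi> \<zero>\<^bsub>A\<^esub> = \<zero>\<^bsub>B\<^esub>"
    using ring_hom_zero[OF h(1)] A.ring_axioms B.ring_axioms by blast
  have w: "\<phi> (word_eval A a w) = word_eval B (\<phi> \<circ> a) w" if "set w \<subseteq> I" for w
    using that
  proof (induction w)
    case (Cons i w)
    have "a i \<in> carrier A" "word_eval A a w \<in> carrier A"
      using Cons.prems assms(4) A.word_eval_closed[OF assms(4)] by auto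
    then show ?case using Cons ring_hom_mult[OF h(1)] by simp
  qed (use ring_hom_one[OF h(1)] in simp)
  show ?thesis using assms(5)
  proof (induction l)
    case (Cons t l)
    then show ?case using ring_hom_add[OF h(1)] h(2) w assms(4) by (simp add: comp_def)
  qed (simp add: 0)
qed

section \<open>Lists of terms versus polynomials as coefficient functions\<close>

lemma (in ring) indexed_pset_support:
  assumes "P \<in> indexed_pset I (carrier R)" "P m \<noteq> \<zero>"
  shows "set_mset m \<subseteq> I"
  using assms
proof (induction arbitrary: m)
  case (indexed_const k)
  then show ?case by (auto simp: indexed_const_def split: if_splits)
next
  case (indexed_padd P Q)
  have "P m \<in> carrier R" "Q m \<in> carrier R"
    using indexed_padd.hyps indexed_pset_in_carrier[OF order_refl] carrier_coeffE by blast+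
  then have "P m \<noteq> \<zero> \<or> Q m \<noteq> \<zero>"
    using indexed_padd.prems by (auto simp: indexed_padd_def)
  then show ?case using indexed_padd.IH by blast
next
  case (indexed_pmult P i)
  then have "i \<in># m" "P (m - {#i#}) \<noteq> \<zero>" by (auto simp: indexed_pmult_def split: if_splits)
  then have "set_mset (m - {#i#}) \<subseteq> I" "m = add_mset i (m - {#i#})" using indexed_pmult.IH by auto
  then show ?case using indexed_pmult.hyps(2) by (metis insert_subset set_mset_add_mset_insert)
qed

context algebra
begin

definition mon_eval :: "('i \<Rightarrow> 'c) \<Rightarrow> 'i multiset \<Rightarrow> 'c"
  where "mon_eval a m = (\<Otimes>\<^bsub>M\<^esub>i\<in>set_mset m. a i [^]\<^bsub>M\<^esub> count m i)"

lemma mon_eval_closed: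
  "a \<in> I \<rightarrow> carrier M \<Longrightarrow> set_mset m \<subseteq> I \<Longrightarrow> mon_eval a m \<in> carrier M"
  unfolding mon_eval_def by (rule finprod_closed) (auto simp: Pi_iff)

lemma mon_eval_add_mset:
  assumes a: "a \<in> I \<rightarrow> carrier M" and m: "set_mset m \<subseteq> I" and i: "i \<in> I"
  shows "mon_eval a (add_mset i m) = a i \<otimes>\<^bsub>M\<^esub> mon_eval a m"
proof -
  let ?S = "set_mset m - {i}" and ?g = "\<lambda>j. a j [^]\<^bsub>M\<^esub> count m j"
  have c: "a j \<in> carrier M" if "j \<in> insert i (set_mset m)" for j using that assms by auto
  have r: "(\<Otimes>\<^bsub>M\<^esub>j\<in>?S. ?g j) \<in> carrier M" using c by (intro finprod_closed) auto
  have "mon_eval a (add_mset i m) = (\<Otimes>\<^bsub>M\<^esub>j\<in>insert i ?S. a j [^]\<^bsub>M\<^esub> count (add_mset i m) j)"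
    unfolding mon_eval_def by simp
  also have "\<dots> = a i [^]\<^bsub>M\<^esub> Suc (count m i) \<otimes>\<^bsub>M\<^esub> (\<Otimes>\<^bsub>M\<^esub>j\<in>?S. a j [^]\<^bsub>M\<^esub> count (add_mset i m) j)"
    using c by (subst finprod_insert) auto
  also have "(\<Otimes>\<^bsub>M\<^esub>j\<in>?S. a j [^]\<^bsub>M\<^esub> count (add_mset i m) j) = (\<Otimes>\<^bsub>M\<^esub>j\<in>?S. ?g j)"
    using c by (intro finprod_cong') auto
  also have "a i [^]\<^bsub>M\<^esub> Suc (count m i) \<otimes>\<^bsub>M\<^esub> (\<Otimes>\<^bsub>M\<^esub>j\<in>?S. ?g j) = a i \<otimes>\<^bsub>M\<^esub> (?g i \<otimes>\<^bsub>M\<^esub> (\<Otimes>\<^bsub>M\<^esub>j\<in>?S. ?g j))"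
    using c r by (simp add: m_ac)
  also have "?g i \<otimes>\<^bsub>M\<^esub> (\<Otimes>\<^bsub>M\<^esub>j\<in>?S. ?g j) = mon_eval a m"
  proof (cases "i \<in># m")
    case True
    then have "mon_eval a m = (\<Otimes>\<^bsub>M\<^esub>j\<in>insert i ?S. ?g j)"
      unfolding mon_eval_def by (simp add: insert_absorb)
    then show ?thesis using c by (subst (asm) finprod_insert) auto
  next
    case False
    then have "?S = set_mset m" "count m i = 0" by (auto simp: not_in_iff)
    then show ?thesis using r by (simp add: mon_eval_def)
  qed
  finally show ?thesis .
qed

text \<open>Cancellation makes the support of a sum differ from the supports of its summands; a
  common finite index set is needed to compare the sums.\<close>

lemma poly_eval_superset:
  assumes a: "a \<in> I \<rightarrow> carrier M" and P: "P \<in> R.indexed_pset I (carrier R)"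
    and S: "finite S" "{m. P m \<noteq> \<zero>} \<subseteq> S" "\<And>m. m \<in> S \<Longrightarrow> set_mset m \<subseteq> I"
  shows "poly_eval R M P a = (\<Oplus>\<^bsub>M\<^esub>m\<in>S. P m \<odot>\<^bsub>M\<^esub> mon_eval a m)"
proof -
  have Pc: "P m \<in> carrier R" for m
    using R.indexed_pset_in_carrier[OF order_refl P] R.carrier_coeffE by blast
  show ?thesis
    unfolding poly_eval_def mon_eval_def[symmetric]
    by (rule add.finprod_mono_neutral_cong_left)
      (use S Pc mon_eval_closed[OF a] in auto)
qed

lemma poly_eval_const:
  assumes "k \<in> carrier R" "a \<in> I \<rightarrow> carrier M"
  shows "poly_eval R M (R.indexed_const k) a = k \<odot>\<^bsub>M\<^esub> \<one>\<^bsub>M\<^esub>"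
proof -
  have "poly_eval R M (R.indexed_const k) a = (\<Oplus>\<^bsub>M\<^esub>m\<in>{{#}}. R.indexed_const k m \<odot>\<^bsub>M\<^esub> mon_eval a m)"
    using assms by (intro poly_eval_superset[of a I] R.indexed_pset.intros)
      (auto simp: R.indexed_const_def split: if_splits)
  then show ?thesis using assms by (simp add: mon_eval_def R.indexed_const_def)
qed

lemma poly_eval_padd:
  assumes a: "a \<in> I \<rightarrow> carrier M"
    and P: "P \<in> R.indexed_pset I (carrier R)" and Q: "Q \<in> R.indexed_pset I (carrier R)"
  shows "poly_eval R M (R.indexed_padd P Q) a = poly_eval R M P a \<oplus>\<^bsub>M\<^esub> poly_eval R M Q a"
proof -
  let ?S = "{m. P m \<noteq> \<zero>} \<union> {m. Q m \<noteq> \<zero>}"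
  have fin: "finite ?S"
    using indexed_pset_finite_support[OF R.ring_axioms P]
      indexed_pset_finite_support[OF R.ring_axioms Q] by simp
  have "set_mset m \<subseteq> I" if "m \<in> ?S" for m
    using that R.indexed_pset_support[OF P, of m] R.indexed_pset_support[OF Q, of m] by blast
  note S = fin this
  note c = R.carrier_coeffE[OF R.indexed_pset_in_carrier[OF order_refl P]]
    R.carrier_coeffE[OF R.indexed_pset_in_carrier[OF order_refl Q]]
  have "poly_eval R M (R.indexed_padd P Q) a =
      (\<Oplus>\<^bsub>M\<^esub>m\<in>?S. R.indexed_padd P Q m \<odot>\<^bsub>M\<^esub> mon_eval a m)"
    using S a R.indexed_pset.indexed_padd[OF P Q]
    by (intro poly_eval_superset[of a I]) (auto simp: R.indexed_padd_def)
  also have "\<dots> = (\<Oplus>\<^bsub>M\<^esub>m\<in>?S. P m \<odot>\<^bsub>M\<^esub> mon_eval a m \<oplus>\<^bsub>M\<^esub> Q m \<odot>\<^bsub>M\<^esub> mon_eval a m)"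
    using c mon_eval_closed[OF a] S(2)
    by (intro add.finprod_cong') (auto simp: R.indexed_padd_def smult_l_distr)
  also have "\<dots> = (\<Oplus>\<^bsub>M\<^esub>m\<in>?S. P m \<odot>\<^bsub>M\<^esub> mon_eval a m) \<oplus>\<^bsub>M\<^esub> (\<Oplus>\<^bsub>M\<^esub>m\<in>?S. Q m \<odot>\<^bsub>M\<^esub> mon_eval a m)"
    using c mon_eval_closed[OF a] S(2) by (intro finsum_addf) auto
  also have "(\<Oplus>\<^bsub>M\<^esub>m\<in>?S. P m \<odot>\<^bsub>M\<^esub> mon_eval a m) = poly_eval R M P a"
    using S by (intro poly_eval_superset[OF a P, symmetric]) auto
  also have "(\<Oplus>\<^bsub>M\<^esub>m\<in>?S. Q m \<odot>\<^bsub>M\<^esub> mon_eval a m) = poly_eval R M Q a"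
    using S by (intro poly_eval_superset[OF a Q, symmetric]) auto
  finally show ?thesis .
qed

text \<open>Multiplying by a variable moves the support along the injection
  \<open>add_mset i\<close>, which reindexes the sum.\<close>

lemma poly_eval_pmult:
  assumes a: "a \<in> I \<rightarrow> carrier M"
    and P: "P \<in> R.indexed_pset I (carrier R)" and i: "i \<in> I"
  shows "poly_eval R M (R.indexed_pmult P i) a = a i \<otimes>\<^bsub>M\<^esub> poly_eval R M P a"
proof -
  let ?S = "{m. P m \<noteq> \<zero>}"
  have S: "finite ?S" "\<And>m. m \<in> ?S \<Longrightarrow> set_mset m \<subseteq> I"
    using indexed_pset_finite_support[OF R.ring_axioms P] R.indexed_pset_support[OF P] by auto
  have c: "P m \<in> carrier R" for m
    using R.indexed_pset_in_carrier[OF order_refl P] R.carrier_coeffE by blast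
  have ai: "a i \<in> carrier M" using a i by auto
  have sub: "{m. R.indexed_pmult P i m \<noteq> \<zero>} \<subseteq> add_mset i ` ?S"
    by (auto simp: R.indexed_pmult_def image_iff split: if_splits) (metis insert_DiffM)
  have "poly_eval R M (R.indexed_pmult P i) a =
      (\<Oplus>\<^bsub>M\<^esub>m\<in>add_mset i ` ?S. R.indexed_pmult P i m \<odot>\<^bsub>M\<^esub> mon_eval a m)"
  proof (rule poly_eval_superset[OF a R.indexed_pset.indexed_pmult[OF P i] _ sub])
    show "finite (add_mset i ` ?S)" using S(1) by simp
    fix m assume "m \<in> add_mset i ` ?S"
    then obtain m' where "m = add_mset i m'" "m' \<in> ?S" by blast
    then show "set_mset m \<subseteq> I" using S(2)[of m'] i by simp
  qed
  also have "\<dots> = (\<Oplus>\<^bsub>M\<^esub>m\<in>?S. R.indexed_pmult P i (add_mset i m) \<odot>\<^bsub>M\<^esub> mon_eval a (add_mset i m))"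
    using c S i mon_eval_closed[OF a]
    by (intro add.finprod_reindex) (auto simp: R.indexed_pmult_def inj_on_def)
  also have "\<dots> = (\<Oplus>\<^bsub>M\<^esub>m\<in>?S. a i \<otimes>\<^bsub>M\<^esub> (P m \<odot>\<^bsub>M\<^esub> mon_eval a m))"
  proof (rule add.finprod_cong'[OF refl])
    fix m assume "m \<in> ?S"
    then have m: "set_mset m \<subseteq> I" "mon_eval a m \<in> carrier M" using S mon_eval_closed[OF a] by auto
    show "R.indexed_pmult P i (add_mset i m) \<odot>\<^bsub>M\<^esub> mon_eval a (add_mset i m) =
        a i \<otimes>\<^bsub>M\<^esub> (P m \<odot>\<^bsub>M\<^esub> mon_eval a m)"
      unfolding mon_eval_add_mset[OF a m(1) i] using ai m c[of m]
      by (simp add: R.indexed_pmult_def m_comm[of "a i"] smult_assoc2)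
  qed (use c S mon_eval_closed[OF a] ai in auto)
  also have "\<dots> = a i \<otimes>\<^bsub>M\<^esub> (\<Oplus>\<^bsub>M\<^esub>m\<in>?S. P m \<odot>\<^bsub>M\<^esub> mon_eval a m)"
    using S c ai mon_eval_closed[OF a] by (intro finsum_rdistr[symmetric]) auto
  also have "(\<Oplus>\<^bsub>M\<^esub>m\<in>?S. P m \<odot>\<^bsub>M\<^esub> mon_eval a m) = poly_eval R M P a"
    using S by (intro poly_eval_superset[OF a P, symmetric]) auto
  finally show ?thesis .
qed

end

text \<open>Built only from the operations that generate \<open>indexed_pset\<close>, so membership
  and evaluation follow by induction on the list.\<close>

definition lp_poly :: "('k, 'm) ring_scheme \<Rightarrow> ('k \<times> 'i list) list \<Rightarrow> 'i multiset \<Rightarrow> 'k"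
  where "lp_poly K l = foldr (\<lambda>t. ring.indexed_padd K
    (foldr (\<lambda>i P. ring.indexed_pmult K P i) (snd t) (ring.indexed_const K (fst t)))) l
    (ring.indexed_const K \<zero>\<^bsub>K\<^esub>)"

lemma (in algebra) lp_poly:
  assumes "lp_over R I l"
  shows "lp_poly R l \<in> R.indexed_pset I (carrier R)"
    and "a \<in> I \<rightarrow> carrier M \<Longrightarrow> poly_eval R M (lp_poly R l) a = lp_eval M a l"
proof -
  have w: "foldr (\<lambda>i P. R.indexed_pmult P i) w (R.indexed_const c) \<in> R.indexed_pset I (carrier R) \<and>
    (a \<in> I \<rightarrow> carrier M \<longrightarrow>
      poly_eval R M (foldr (\<lambda>i P. R.indexed_pmult P i) w (R.indexed_const c)) a = c \<odot>\<^bsub>M\<^esub> word_eval M a w)"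
    if "c \<in> carrier R" "set w \<subseteq> I" for c w
    using that(2)
  proof (induction w)
    case Nil
    then show ?case using that poly_eval_const by (auto intro: R.indexed_pset.intros)
  next
    case (Cons i w)
    let ?P = "foldr (\<lambda>i P. R.indexed_pmult P i) w (R.indexed_const c)"
    have IH: "?P \<in> R.indexed_pset I (carrier R)" "set w \<subseteq> I" "i \<in> I" using Cons by auto
    have "poly_eval R M (R.indexed_pmult ?P i) a = c \<odot>\<^bsub>M\<^esub> word_eval M a (i # w)"
      if a: "a \<in> I \<rightarrow> carrier M"
    proof -
      have "a i \<in> carrier M" "word_eval M a w \<in> carrier M" using a IH by auto
      then show ?thesis
        using Cons.IH a IH(2) poly_eval_pmult[OF a IH(1,3)] \<open>c \<in> carrier R\<close>
        by (simp add: m_comm[of "a i"] smult_assoc2)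
    qed
    then show ?case using IH by (auto intro: R.indexed_pset.intros)
  qed
  have "lp_poly R l \<in> R.indexed_pset I (carrier R) \<and>
    (a \<in> I \<rightarrow> carrier M \<longrightarrow> poly_eval R M (lp_poly R l) a = lp_eval M a l)"
    using assms
  proof (induction l)
    case Nil
    then show ?case using poly_eval_const[OF R.zero_closed]
      by (auto simp: lp_poly_def intro: R.indexed_pset.intros)
  next
    case (Cons t l)
    have "lp_poly R (t # l) = R.indexed_padd
      (foldr (\<lambda>i P. R.indexed_pmult P i) (snd t) (R.indexed_const (fst t))) (lp_poly R l)"
      by (simp add: lp_poly_def)
    then show ?case
      using Cons w[of "fst t" "snd t"] poly_eval_padd[of a I _ "lp_poly R l"]
        R.indexed_pset.indexed_padd[of _ I "carrier R" "lp_poly R l"] by simp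
  qed
  then show "lp_poly R l \<in> R.indexed_pset I (carrier R)"
    "a \<in> I \<rightarrow> carrier M \<Longrightarrow> poly_eval R M (lp_poly R l) a = lp_eval M a l" by auto
qed

text \<open>Every monomial of the polynomial is the multiset of one of the words; cancellation can
  only remove monomials.\<close>

lemma lp_poly_homogeneous:
  fixes l :: "('k \<times> 'i list) list"
  assumes "ring K" "lp_homog d l"
  shows "homogeneous K (lp_poly K l)"
proof -
  interpret ring K by fact
  have w: "m = mset w" if "foldr (\<lambda>i P. indexed_pmult P i) w (indexed_const c) m \<noteq> \<zero>\<^bsub>K\<^esub>"
    for w c and m :: "'i multiset"
    using that
  proof (induction w arbitrary: m)
    case Nil
    then show ?case by (auto simp: indexed_const_def split: if_splits)
  next
    case (Cons i w)
    then have "i \<in># m" "m - {#i#} = mset w" by (auto simp: indexed_pmult_def split: if_splits)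
    then show ?case by (metis insert_DiffM mset.simps(2))
  qed
  have "\<exists>t\<in>set l. m = mset (snd t)" if "lp_poly K l m \<noteq> \<zero>\<^bsub>K\<^esub>" for m
    using that
  proof (induction l)
    case Nil
    then show ?case by (auto simp: lp_poly_def indexed_const_def split: if_splits)
  next
    case (Cons t l)
    show ?case
    proof (cases "lp_poly K l m = \<zero>\<^bsub>K\<^esub>")
      case True
      then have "foldr (\<lambda>i P. indexed_pmult P i) (snd t) (indexed_const (fst t)) m \<noteq> \<zero>\<^bsub>K\<^esub>"
        using Cons.prems by (auto simp: lp_poly_def indexed_padd_def)
      then show ?thesis using w by auto
    qed (use Cons.IH in auto)
  qed
  then show ?thesis using assms(2) unfolding homogeneous_def lp_homog_def by (metis size_mset)
qed

text \<open>One list has to serve two algebras at once, for instance \<open>K\<close> itself, where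
  zeros are tested, and \<open>B\<close>, where the polynomial is evaluated.\<close>

lemma ex_lp:
  assumes A: "algebra K A" and B: "algebra K B" and P: "P \<in> ring.indexed_pset K I (carrier K)"
  shows "\<exists>l. lp_over K I l \<and> (\<forall>a\<in>I \<rightarrow> carrier A. poly_eval K A P a = lp_eval A a l) \<and>
    (\<forall>a\<in>I \<rightarrow> carrier B. poly_eval K B P a = lp_eval B a l)"
proof -
  interpret A: algebra K A by fact
  interpret B: algebra K B by fact
  show ?thesis using P
  proof induction
    case (indexed_const k)
    then show ?case
      by (intro exI[of _ "[(k, [])]"]) (auto simp: A.poly_eval_const B.poly_eval_const)
  next
    case (indexed_padd P Q)
    then obtain l l' where "lp_over K I l" "lp_over K I l'"
      "\<forall>a\<in>I \<rightarrow> carrier A. poly_eval K A P a = lp_eval A a l"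
      "\<forall>a\<in>I \<rightarrow> carrier A. poly_eval K A Q a = lp_eval A a l'"
      "\<forall>a\<in>I \<rightarrow> carrier B. poly_eval K B P a = lp_eval B a l"
      "\<forall>a\<in>I \<rightarrow> carrier B. poly_eval K B Q a = lp_eval B a l'" by blast
    then show ?case using indexed_padd.hyps
      by (intro exI[of _ "l @ l'"])
        (simp add: A.poly_eval_padd B.poly_eval_padd A.lp_eval_append B.lp_eval_append)
  next
    case (indexed_pmult P i)
    then obtain l where l: "lp_over K I l"
      "\<forall>a\<in>I \<rightarrow> carrier A. poly_eval K A P a = lp_eval A a l"
      "\<forall>a\<in>I \<rightarrow> carrier B. poly_eval K B P a = lp_eval B a l" by blast
    let ?v = "[(\<one>\<^bsub>K\<^esub>, [i])]"
    have v: "lp_over K I ?v" using indexed_pmult.hyps by auto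
    have "lp_eval A a ?v = a i" if "a \<in> I \<rightarrow> carrier A" for a
      using that indexed_pmult.hyps(2) by (auto simp: Pi_iff)
    moreover have "lp_eval B a ?v = a i" if "a \<in> I \<rightarrow> carrier B" for a
      using that indexed_pmult.hyps(2) by (auto simp: Pi_iff)
    ultimately show ?case using indexed_pmult.hyps l v lp_over_mult[OF A.R_cring v l(1)]
      by (intro exI[of _ "lp_mult K ?v l"])
        (simp add: A.poly_eval_pmult B.poly_eval_pmult A.lp_eval_mult[OF _ v l(1)] B.lp_eval_mult[OF _ v l(1)])
  qed
qed

lemma poly_eval_alg_hom:
  assumes A: "algebra K A" and B: "algebra K B" and P: "P \<in> ring.indexed_pset K I (carrier K)"
    and \<phi>: "\<phi> \<in> alg_hom K A B" and a: "a \<in> I \<rightarrow> carrier A"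
  shows "\<phi> (poly_eval K A P a) = poly_eval K B P (\<phi> \<circ> a)"
proof -
  obtain l where l: "lp_over K I l" "\<forall>a\<in>I \<rightarrow> carrier A. poly_eval K A P a = lp_eval A a l"
    "\<forall>a\<in>I \<rightarrow> carrier B. poly_eval K B P a = lp_eval B a l"
    using ex_lp[OF A B P] by blast
  moreover have "\<phi> \<circ> a \<in> I \<rightarrow> carrier B"
    using a \<phi> by (auto simp: alg_hom_def ring_hom_def)
  ultimately show ?thesis using lp_eval_alg_hom[OF A B \<phi> a l(1)] a by simp
qed

section \<open>Fields with a polynomial that has no root\<close>

lemma scalar_algebra_pow [simp]: "x [^]\<^bsub>scalar_algebra K\<^esub> (n::nat) = x [^]\<^bsub>K\<^esub> n"
  by (simp add: nat_pow_def)

section \<open>Powers of k, and subalgebras of polynomial values\<close>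

lemma power_algebra_simps:
  "carrier (power_algebra K S) = S \<rightarrow>\<^sub>E carrier K"
  "f \<otimes>\<^bsub>power_algebra K S\<^esub> g = (\<lambda>s\<in>S. f s \<otimes>\<^bsub>K\<^esub> g s)"
  "f \<oplus>\<^bsub>power_algebra K S\<^esub> g = (\<lambda>s\<in>S. f s \<oplus>\<^bsub>K\<^esub> g s)"
  "\<one>\<^bsub>power_algebra K S\<^esub> = (\<lambda>s\<in>S. \<one>\<^bsub>K\<^esub>)"
  "\<zero>\<^bsub>power_algebra K S\<^esub> = (\<lambda>s\<in>S. \<zero>\<^bsub>K\<^esub>)"
  "c \<odot>\<^bsub>power_algebra K S\<^esub> f = (\<lambda>s\<in>S. c \<otimes>\<^bsub>K\<^esub> f s)"
  by (simp_all add: power_algebra_def)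

lemma power_algebra_algebra:
  assumes "cring K" shows "algebra K (power_algebra K S)"
proof -
  interpret K: cring K by fact
  have E: "f = g" if "f \<in> S \<rightarrow>\<^sub>E carrier K" "g \<in> S \<rightarrow>\<^sub>E carrier K" "\<And>s. s \<in> S \<Longrightarrow> f s = g s" for f g
    using that by (rule PiE_ext)
  have V: "f s \<in> carrier K" if "f \<in> S \<rightarrow>\<^sub>E carrier K" "s \<in> S" for f s
    using that by auto
  have ab: "abelian_group (power_algebra K S)"
  proof (rule abelian_groupI; unfold power_algebra_simps)
    fix f assume f: "f \<in> S \<rightarrow>\<^sub>E carrier K"
    show "\<exists>g\<in>S \<rightarrow>\<^sub>E carrier K. (\<lambda>s\<in>S. g s \<oplus>\<^bsub>K\<^esub> f s) = (\<lambda>s\<in>S. \<zero>\<^bsub>K\<^esub>)"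
      using V[OF f] by (intro bexI[of _ "\<lambda>s\<in>S. \<ominus>\<^bsub>K\<^esub> f s"]) (auto simp: K.l_neg cong: restrict_cong)
  qed (auto simp: V K.a_ac intro!: E)
  have mo: "comm_monoid (power_algebra K S)"
    by (rule comm_monoidI; unfold power_algebra_simps) (auto simp: V K.m_ac intro!: E)
  have cr: "cring (power_algebra K S)"
    by (rule cringI[OF ab mo]; unfold power_algebra_simps) (auto simp: V K.l_distr intro!: E)
  show ?thesis
    by (rule algebraI[OF assms cr]; unfold power_algebra_simps)
      (auto simp: V K.l_distr K.r_distr K.m_ac intro!: E)
qed

lemma power_algebra_proj:
  assumes "s \<in> S"
  shows "(\<lambda>f. f s) \<in> alg_hom K (power_algebra K S) (scalar_algebra K)"
  using assms by (auto simp: alg_hom_def ring_hom_def power_algebra_simps)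

context algebra
begin

lemma lp_values_subring:
  assumes a: "a \<in> I \<rightarrow> carrier M"
  shows "subring {lp_eval M a l | l. lp_over R I l} M"
proof (rule subringI)
  let ?V = "{lp_eval M a l | l. lp_over R I l}"
  show "?V \<subseteq> carrier M" using a by auto
  have "\<one>\<^bsub>M\<^esub> = lp_eval M a [(\<one>, [])]" by simp
  then show "\<one>\<^bsub>M\<^esub> \<in> ?V" by (metis (mono_tags, lifting) R.one_closed empty_set empty_subsetI
      fst_conv lp_over_simps(1,2) mem_Collect_eq snd_conv)
  fix u assume "u \<in> ?V"
  then obtain l where l: "lp_over R I l" "u = lp_eval M a l" by blast
  have "\<ominus>\<^bsub>M\<^esub> u = lp_eval M a (lp_scale R (\<ominus> \<one>) l)"
    using l a lp_eval_scale[OF a l(1), of "\<ominus> \<one>"] by (simp add: smult_l_minus)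
  then show "\<ominus>\<^bsub>M\<^esub> u \<in> ?V" using lp_over_scale[OF R_cring _ l(1), of "\<ominus> \<one>"] by blast
  fix v assume "v \<in> ?V"
  then obtain l' where l': "lp_over R I l'" "v = lp_eval M a l'" by blast
  show "u \<otimes>\<^bsub>M\<^esub> v \<in> ?V"
    unfolding l(2) l'(2) lp_eval_mult[OF a l(1) l'(1), symmetric]
    using lp_over_mult[OF R_cring l(1) l'(1)] by blast
  have "lp_over R I (l @ l')" using l l' by simp
  then show "u \<oplus>\<^bsub>M\<^esub> v \<in> ?V"
    unfolding l(2) l'(2) lp_eval_append[OF a l(1) l'(1), symmetric] by blast
qed

lemma lp_eval_mem_subring:
  assumes "subring T M" "(\<lambda>c. c \<odot>\<^bsub>M\<^esub> \<one>\<^bsub>M\<^esub>) ` carrier R \<subseteq> T" "a ` I \<subseteq> T" "lp_over R I l"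
  shows "lp_eval M a l \<in> T"
proof -
  note T = subringE[OF assms(1)]
  have w: "word_eval M a w \<in> T" if "set w \<subseteq> I" for w
    using that by (induction w) (use T assms in auto)
  have "c \<odot>\<^bsub>M\<^esub> word_eval M a w \<in> T" if "c \<in> carrier R" "set w \<subseteq> I" for c w
  proof -
    have "word_eval M a w \<in> carrier M" using w[OF that(2)] T(1) by blast
    then have "c \<odot>\<^bsub>M\<^esub> word_eval M a w = (c \<odot>\<^bsub>M\<^esub> \<one>\<^bsub>M\<^esub>) \<otimes>\<^bsub>M\<^esub> word_eval M a w"
      using that by (simp add: smult_assoc2)
    then show ?thesis using T(6)[OF _ w[OF that(2)]] assms(2) that by auto
  qed
  then show ?thesis using assms(4) by (induction l) (use T in auto)
qed

text \<open>Joins two descriptions of a finitely generated subalgebra: the tower, suited to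
  induction, and the values of polynomials, suited to explicit relations.\<close>

lemma lp_values_eq_adjoins:
  assumes "set xs \<subseteq> carrier M"
  shows "{lp_eval M ((!) xs) l | l. lp_over R {..<length xs} l} =
    foldl (adjoin M) ((\<lambda>c. c \<odot>\<^bsub>M\<^esub> \<one>\<^bsub>M\<^esub>) ` carrier R) xs"
proof
  have a: "(!) xs \<in> {..<length xs} \<rightarrow> carrier M" using assms by auto
  note A = adjoins_subring[OF scalars_subring assms]
  show "{lp_eval M ((!) xs) l | l. lp_over R {..<length xs} l} \<subseteq>
      foldl (adjoin M) ((\<lambda>c. c \<odot>\<^bsub>M\<^esub> \<one>\<^bsub>M\<^esub>) ` carrier R) xs"
  proof clarify
    fix l assume l: "lp_over R {..<length xs} l"
    have "(!) xs ` {..<length xs} \<subseteq> set xs" by auto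
    then show "lp_eval M ((!) xs) l \<in> foldl (adjoin M) ((\<lambda>c. c \<odot>\<^bsub>M\<^esub> \<one>\<^bsub>M\<^esub>) ` carrier R) xs"
      using lp_eval_mem_subring[OF A(1) _ _ l] A(2) by blast
  qed
  show "foldl (adjoin M) ((\<lambda>c. c \<odot>\<^bsub>M\<^esub> \<one>\<^bsub>M\<^esub>) ` carrier R) xs \<subseteq>
      {lp_eval M ((!) xs) l | l. lp_over R {..<length xs} l}"
  proof (rule adjoins_least[OF lp_values_subring[OF a]])
    show "(\<lambda>c. c \<odot>\<^bsub>M\<^esub> \<one>\<^bsub>M\<^esub>) ` carrier R \<subseteq> {lp_eval M ((!) xs) l | l. lp_over R {..<length xs} l}"
    proof clarsimp
      fix c assume "c \<in> carrier R"
      then show "\<exists>l. c \<odot>\<^bsub>M\<^esub> \<one>\<^bsub>M\<^esub> = lp_eval M ((!) xs) l \<and> lp_over R {..<length xs} l"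
        by (intro exI[of _ "[(c, [])]"]) auto
    qed
    show "set xs \<subseteq> {lp_eval M ((!) xs) l | l. lp_over R {..<length xs} l}"
    proof
      fix x assume "x \<in> set xs"
      then obtain i where "i < length xs" "x = xs ! i" by (auto simp: in_set_conv_nth)
      moreover from this have "xs ! i \<in> carrier M" using assms nth_mem by blast
      ultimately show "x \<in> {lp_eval M ((!) xs) l | l. lp_over R {..<length xs} l}"
        by (auto intro!: exI[of _ "[(\<one>, [i])]"])
    qed
  qed
qed

end

text \<open>Hilbert's basis theorem in the ring of polynomial functions on \<open>k\<^sup>m\<close> replaces an ideal of
  polynomials by finitely many of its members with the same zeros in \<open>k\<^sup>m\<close>.\<close>

lemma finite_zero_set:
  fixes K :: "('k, 'm) ring_scheme" (structure) and T :: "('k \<times> nat list) list set"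
  assumes "field K" and T: "\<And>l. l \<in> T \<Longrightarrow> lp_over K {..<m} l"
    and T0: "[] \<in> T" and Tadd: "\<And>l l'. l \<in> T \<Longrightarrow> l' \<in> T \<Longrightarrow> l @ l' \<in> T"
    and Tmult: "\<And>l l'. lp_over K {..<m} l \<Longrightarrow> l' \<in> T \<Longrightarrow> lp_mult K l l' \<in> T"
  shows "\<exists>T0\<subseteq>T. finite T0 \<and> (\<forall>z\<in>{..<m} \<rightarrow> carrier K.
    (\<forall>l\<in>T0. lp_value K z l = \<zero>) \<longrightarrow> (\<forall>l\<in>T. lp_value K z l = \<zero>))"
proof -
  interpret K: field K by fact
  \<comment> \<open>Points are functions on all natural numbers, arbitrary from \<open>m\<close> on;
    polynomials in the first \<open>m\<close> variables do not see the rest.\<close>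
  define Z where "Z = {..<m} \<rightarrow> carrier K"
  let ?F = "power_algebra K Z"
  have aF: "algebra K ?F" by (rule power_algebra_algebra[OF K.is_cring])
  interpret F: algebra K ?F by (rule aF)
  define xs where "xs = map (\<lambda>i. \<lambda>z\<in>Z. z i) [0..<m]"
  have "(\<lambda>z\<in>Z. z i) \<in> carrier ?F" if "i < m" for i
    unfolding power_algebra_simps restrict_PiE_iff using that by (auto simp: Z_def)
  then have xs: "set xs \<subseteq> carrier ?F" "length xs = m" by (auto simp: xs_def)
  let ?c = "(\<lambda>c. c \<odot>\<^bsub>?F\<^esub> \<one>\<^bsub>?F\<^esub>) ` carrier K"
  define S where "S = foldl (adjoin ?F) ?c xs"
  have SV: "S = {lp_eval ?F ((!) xs) l | l. lp_over K {..<m} l}"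
    unfolding S_def using F.lp_values_eq_adjoins[OF xs(1)] xs(2) by simp
  have a: "(!) xs \<in> {..<m} \<rightarrow> carrier ?F" using xs by auto
  have ev: "lp_eval ?F ((!) xs) l z = lp_value K z l"
    if "z \<in> Z" "lp_over K {..<m} l" for z l
  proof -
    have "lp_eval ?F ((!) xs) l z = lp_value K ((\<lambda>f. f z) \<circ> (!) xs) l"
      by (rule lp_eval_alg_hom[OF aF scalar_algebra_algebra[OF K.is_cring] power_algebra_proj[OF that(1)] a that(2)])
    also have "\<dots> = lp_value K z l"
      by (rule lp_eval_cong[OF that(2)]) (use that(1) in \<open>auto simp: xs_def\<close>)
    finally show ?thesis .
  qed
  have "noetherian_sub ?F ?c"
  proof (rule F.noetherian_sub_of_units)
    show "?c \<subseteq> carrier ?F" by auto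
    fix s assume s: "s \<in> ?c" "s \<noteq> \<zero>\<^bsub>?F\<^esub>"
    then obtain k where k: "k \<in> carrier K" "s = k \<odot>\<^bsub>?F\<^esub> \<one>\<^bsub>?F\<^esub>" by auto
    have "k \<noteq> \<zero>" using k s by auto
    then have i: "inv k \<in> carrier K" "inv k \<otimes> k = \<one>"
      using k(1) K.field_Units by auto
    have "(inv k \<odot>\<^bsub>?F\<^esub> \<one>\<^bsub>?F\<^esub>) \<otimes>\<^bsub>?F\<^esub> s = \<one>\<^bsub>?F\<^esub>"
      using i k by (simp add: F.smult_assoc1[symmetric] F.smult_assoc2)
    then show "\<exists>t\<in>?c. t \<otimes>\<^bsub>?F\<^esub> s = \<one>\<^bsub>?F\<^esub>" using i by blast
  qed
  then have N: "noetherian_sub ?F S"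
    unfolding S_def using F.noetherian_sub_adjoins[OF F.scalars_subring xs(1)] by blast
  define J where "J = (\<lambda>l. lp_eval ?F ((!) xs) l) ` T"
  have "sub_ideal ?F S J"
    unfolding sub_ideal_def
  proof (intro conjI ballI)
    show "J \<subseteq> S" using T by (auto simp: J_def SV)
    show "\<zero>\<^bsub>?F\<^esub> \<in> J" using T0 by (auto simp: J_def intro: image_eqI[of _ _ "[]"])
    fix f assume f: "f \<in> J"
    then obtain l where l: "l \<in> T" "f = lp_eval ?F ((!) xs) l" by (auto simp: J_def)
    show "f \<oplus>\<^bsub>?F\<^esub> g \<in> J" if "g \<in> J" for g
    proof -
      obtain l' where l': "l' \<in> T" "g = lp_eval ?F ((!) xs) l'" using \<open>g \<in> J\<close> by (auto simp: J_def)
      then have "f \<oplus>\<^bsub>?F\<^esub> g = lp_eval ?F ((!) xs) (l @ l')"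
        using F.lp_eval_append[OF a T T] l by simp
      then show ?thesis using Tadd[OF l(1) l'(1)] by (auto simp: J_def)
    qed
    show "s \<otimes>\<^bsub>?F\<^esub> f \<in> J" if "s \<in> S" for s
    proof -
      obtain l' where l': "lp_over K {..<m} l'" "s = lp_eval ?F ((!) xs) l'" using \<open>s \<in> S\<close> by (auto simp: SV)
      then have "s \<otimes>\<^bsub>?F\<^esub> f = lp_eval ?F ((!) xs) (lp_mult K l' l)"
        using F.lp_eval_mult[OF a l'(1) T[OF l(1)]] l by simp
      then show ?thesis using Tmult[OF l'(1) l(1)] by (auto simp: J_def)
    qed
  qed
  then obtain E where E: "E \<subseteq> J" "finite E" "\<And>J'. sub_ideal ?F S J' \<Longrightarrow> E \<subseteq> J' \<Longrightarrow> J \<subseteq> J'"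
    using N unfolding noetherian_sub_def by meson
  obtain T1 where T1: "T1 \<subseteq> T" "finite T1" "E = (\<lambda>l. lp_eval ?F ((!) xs) l) ` T1"
    using finite_subset_image[OF E(2,1)[unfolded J_def]] by blast
  have SC: "S \<subseteq> carrier ?F" unfolding SV using F.lp_eval_closed[OF a] by auto
  have "\<forall>l\<in>T. lp_value K z l = \<zero>"
    if z: "z \<in> Z" "\<forall>l\<in>T1. lp_value K z l = \<zero>" for z
  proof -
    \<comment> \<open>The functions in \<open>S\<close> that vanish at z form an ideal. It contains
      the generators \<open>E\<close>, hence all of \<open>J\<close>.\<close>
    let ?J = "{f \<in> S. f z = \<zero>}"
    have SE: "subring S ?F" unfolding SV by (rule F.lp_values_subring[OF a])
    have v: "f z \<in> carrier K" if "f \<in> S" for f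
      using that SC z(1) by (auto simp: power_algebra_simps)
    have "sub_ideal ?F S ?J"
      using subringE[OF SE] z(1) v by (auto simp: sub_ideal_def power_algebra_simps)
    moreover have "E \<subseteq> ?J"
    proof
      fix f assume "f \<in> E"
      then obtain l where l: "l \<in> T1" "f = lp_eval ?F ((!) xs) l" using T1(3) by blast
      then have "lp_over K {..<m} l" using T T1(1) by blast
      then show "f \<in> ?J" using ev[OF z(1)] z(2) l unfolding SV by auto
    qed
    ultimately have "J \<subseteq> ?J" using E(3) by blast
    then show ?thesis using ev[OF z(1)] T by (auto simp: J_def)
  qed
  then show ?thesis using T1(1,2) unfolding Z_def by blast
qed

text \<open>The form \<open>\<Sum>\<^sub>i h\<^sub>i g\<^sup>i g'\<^sup>d\<^sup>-\<^sup>i\<close>, which is anisotropic in \<open>g\<close> and \<open>g'\<close> if the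
  polynomial with coefficients \<open>h\<close> of degree \<open>d \<ge> 1\<close> has no root.\<close>

primrec lp_form :: "('k, 'm) ring_scheme \<Rightarrow> 'k list \<Rightarrow> ('k \<times> 'i list) list \<Rightarrow> ('k \<times> 'i list) list \<Rightarrow>
    ('k \<times> 'i list) list" where
  "lp_form K [] g g' = []"
| "lp_form K (c # h) g g' = lp_scale K c (lp_power K g' (length h)) @ lp_mult K g (lp_form K h g g')"

text \<open>The same form in two ring elements instead of two lists; its anisotropy is shown by
  dehomogenising to \<open>horner\<close>.\<close>

primrec form_value :: "('k, 'a, 'm) module_scheme \<Rightarrow> 'k list \<Rightarrow> 'a \<Rightarrow> 'a \<Rightarrow> 'a" where
  "form_value A [] u v = \<zero>\<^bsub>A\<^esub>"
| "form_value A (c # h) u v = c \<odot>\<^bsub>A\<^esub> v [^]\<^bsub>A\<^esub> length h \<oplus>\<^bsub>A\<^esub> u \<otimes>\<^bsub>A\<^esub> form_value A h u v"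

lemma lp_over_form:
  "cring K \<Longrightarrow> set h \<subseteq> carrier K \<Longrightarrow> lp_over K I g \<Longrightarrow> lp_over K I g' \<Longrightarrow> lp_over K I (lp_form K h g g')"
  by (induction h) (auto intro!: lp_over_scale lp_over_power lp_over_mult)

lemma lp_homog_form:
  assumes "lp_homog e g" "lp_homog e g'"
  shows "lp_homog (e * (length h - 1)) (lp_form K h g g')"
proof (induction h)
  case (Cons c h)
  show ?case
  proof (cases h)
    \<comment> \<open>Truncated subtraction spoils the degree count of the product here, but the
      product has no terms.\<close>
    case Nil
    have "lp_homog 0 (lp_mult K g [])" by (auto simp: lp_homog_def lp_mult_def)
    then show ?thesis using Nil by (auto intro!: lp_homog_append lp_homog_scale simp: lp_homog_def[of 0] lp_scale_def)
  next
    case h: (Cons d h')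
    have "lp_homog (e + e * (length h - 1)) (lp_mult K g (lp_form K h g g'))"
      by (rule lp_homog_mult[OF assms(1) Cons.IH])
    then have "lp_homog (e * length h) (lp_mult K g (lp_form K h g g'))" using h by simp
    then show ?thesis
      using lp_homog_power[OF assms(2)] by (auto intro!: lp_homog_append lp_homog_scale)
  qed
qed (simp add: lp_homog_def)

lemma (in algebra) form_value_closed:
  "set h \<subseteq> carrier R \<Longrightarrow> u \<in> carrier M \<Longrightarrow> v \<in> carrier M \<Longrightarrow> form_value M h u v \<in> carrier M"
  by (induction h) auto

lemma (in algebra) lp_eval_form:
  assumes a: "a \<in> I \<rightarrow> carrier M" and h: "set h \<subseteq> carrier R" and g: "lp_over R I g" "lp_over R I g'"
  shows "lp_eval M a (lp_form R h g g') = form_value M h (lp_eval M a g) (lp_eval M a g')"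
  using h
proof (induction h)
  case (Cons c h)
  have c: "c \<in> carrier R" "set h \<subseteq> carrier R" using Cons.prems by auto
  have p: "lp_over R I (lp_power R g' (length h))" by (rule lp_over_power[OF R_cring g(2)])
  have f: "lp_over R I (lp_form R h g g')" by (rule lp_over_form[OF R_cring c(2) g])
  show ?case
    using lp_eval_append[OF a lp_over_scale[OF R_cring c(1) p] lp_over_mult[OF R_cring g(1) f]]
      lp_eval_scale[OF a p c(1)] lp_eval_power[OF a g(2)] lp_eval_mult[OF a g(1) f] Cons.IH[OF c(2)]
    by simp
qed simp

text \<open>Length at least two means positive degree; a constant form need not vanish at the
  origin.\<close>

lemma (in algebra) form_value_zero:
  assumes "set h \<subseteq> carrier R" "2 \<le> length h"
  shows "form_value M h \<zero>\<^bsub>M\<^esub> \<zero>\<^bsub>M\<^esub> = \<zero>\<^bsub>M\<^esub>"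
proof -
  obtain c d h' where h: "h = c # d # h'" using assms(2) by (cases h; cases "tl h") auto
  have "form_value M (d # h') \<zero>\<^bsub>M\<^esub> \<zero>\<^bsub>M\<^esub> \<in> carrier M"
    using assms h by (intro form_value_closed) auto
  then show ?thesis using h assms
    by (simp add: nat_pow_zero del: form_value.simps(2)) (simp add: nat_pow_zero)
qed

context field
begin

lemma form_value_dehomogenise:
  assumes "set (c # h) \<subseteq> carrier R" "t \<in> carrier R" "v \<in> carrier R"
  shows "form_value (scalar_algebra R) (c # h) (v \<otimes> t) v = v [^] length h \<otimes> horner R t (c # h)"
  using assms(1)
proof (induction h arbitrary: c)
  case (Cons d h)
  have IH: "form_value (scalar_algebra R) (d # h) (v \<otimes> t) v = v [^] length h \<otimes> horner R t (d # h)"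
    using Cons by auto
  have h: "horner R t (d # h) \<in> carrier R" "c \<in> carrier R" "v [^] length h \<in> carrier R"
    using Cons.prems assms by auto
  have "form_value (scalar_algebra R) (c # d # h) (v \<otimes> t) v =
    c \<otimes> v [^] Suc (length h) \<oplus> (v \<otimes> t) \<otimes> form_value (scalar_algebra R) (d # h) (v \<otimes> t) v"
    by simp
  also have "\<dots> = v [^] Suc (length h) \<otimes> (c \<oplus> t \<otimes> horner R t (d # h))"
    unfolding IH nat_pow_Suc using h assms(2,3) by algebra
  finally show ?case by simp
qed (use assms in auto)

lemma form_value_at_zero:
  assumes "set h \<subseteq> carrier R" "c \<in> carrier R" "u \<in> carrier R"
  shows "form_value (scalar_algebra R) (h @ [c]) u \<zero> = u [^] length h \<otimes> c"
  using assms(1)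
  by (induction h) (use assms in \<open>auto simp: nat_pow_zero m_ac\<close>)

lemma pow_eq_zero: "u \<in> carrier R \<Longrightarrow> u [^] (n::nat) = \<zero> \<Longrightarrow> u = \<zero>"
  by (induction n) (auto simp: integral_iff)

text \<open>If v is non-zero, then u/v would be a root of \<open>h\<close>; if v = 0, only the top
  coefficient times a power of u is left.\<close>

lemma form_value_anisotropic:
  assumes h: "set h \<subseteq> carrier R" "2 \<le> length h" "last h \<noteq> \<zero>"
    and nr: "\<And>t. t \<in> carrier R \<Longrightarrow> horner R t h \<noteq> \<zero>"
    and uv: "u \<in> carrier R" "v \<in> carrier R" "form_value (scalar_algebra R) h u v = \<zero>"
  shows "u = \<zero> \<and> v = \<zero>"
proof (cases "v = \<zero>")
  case True
  obtain h' c where h': "h = h' @ [c]" using h(2) by (cases h rule: rev_cases) auto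
  then have "u [^] length h' \<otimes> c = \<zero>"
    using form_value_at_zero[of h' c u] h uv True by simp
  then have "u [^] length h' = \<zero>" using h h' uv by (auto simp: integral_iff)
  then show ?thesis using pow_eq_zero uv True by blast
next
  case False
  then have i: "inv v \<in> carrier R" "v \<otimes> inv v = \<one>" using uv field_Units by auto
  obtain c h' where h': "h = c # h'" using h(2) by (cases h) auto
  have "v \<otimes> (u \<otimes> inv v) = u" using i uv by (simp add: m_lcomm)
  then have "v [^] length h' \<otimes> horner R (u \<otimes> inv v) h = \<zero>"
    using form_value_dehomogenise[of c h' "u \<otimes> inv v" v] h h' i uv by simp
  moreover have "horner R (u \<otimes> inv v) h \<in> carrier R" using h i uv by simp
  ultimately have "v [^] length h' = \<zero>" using nr[of "u \<otimes> inv v"] i uv by (auto simp: integral_iff)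
  then show ?thesis using pow_eq_zero uv False by blast
qed

end

text \<open>The powers with exponents \<open>d'\<close> and \<open>d\<close> bring \<open>g\<close>
  and \<open>g'\<close> to the common degree \<open>d * d'\<close>, as the binary form requires.
  Degrees are kept positive so that these powers vanish where \<open>g\<close> and \<open>g'\<close>
  do and the construction can be repeated.\<close>

lemma ex_lp_pair:
  fixes K :: "('k, 'm) ring_scheme" (structure) and B :: "('k, 'b, 'n) module_scheme"
  assumes K: "field K" and nrc: "\<not> root_closed K" and B: "algebra K B"
    and g: "lp_over K I g" "lp_homog d g" "1 \<le> d" and g': "lp_over K I g'" "lp_homog d' g'" "1 \<le> d'"
  shows "\<exists>G D. 1 \<le> D \<and> lp_over K I G \<and> lp_homog D G \<and>
    (\<forall>a\<in>I \<rightarrow> carrier B. lp_eval B a g = \<zero>\<^bsub>B\<^esub> \<and> lp_eval B a g' = \<zero>\<^bsub>B\<^esub> \<longrightarrow> lp_eval B a G = \<zero>\<^bsub>B\<^esub>) \<and>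
    (\<forall>a\<in>I \<rightarrow> carrier K. lp_value K a G = \<zero> \<longrightarrow>
      lp_value K a g = \<zero> \<and> lp_value K a g' = \<zero>)"
proof -
  interpret K: field K by fact
  interpret B: algebra K B by fact
  interpret S: algebra K "scalar_algebra K" by (rule scalar_algebra_algebra[OF K.is_cring])
  obtain h where h: "set h \<subseteq> carrier K" "2 \<le> length h" "last h \<noteq> \<zero>"
    "\<And>t. t \<in> carrier K \<Longrightarrow> horner K t h \<noteq> \<zero>"
    using nrc unfolding root_closed_def by blast
  define u v where "u = lp_power K g d'" and "v = lp_power K g' d"
  have o: "lp_over K I u" "lp_over K I v"
    using g g' lp_over_power[OF K.is_cring] by (auto simp: u_def v_def)
  have hom: "lp_homog (d * d') u" "lp_homog (d * d') v"
    using lp_homog_power[OF g(2), of d' K] lp_homog_power[OF g'(2), of d K]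
    by (simp_all add: u_def v_def mult.commute)
  let ?G = "lp_form K h u v" and ?D = "d * d' * (length h - 1)"
  have "1 \<le> ?D" using g(3) g'(3) h(2) by (simp add: Suc_le_eq)
  moreover have "lp_over K I ?G" by (rule lp_over_form[OF K.is_cring h(1) o])
  moreover have "lp_homog ?D ?G" by (rule lp_homog_form[OF hom])
  moreover have "lp_eval B a ?G = \<zero>\<^bsub>B\<^esub>"
    if a: "a \<in> I \<rightarrow> carrier B" "lp_eval B a g = \<zero>\<^bsub>B\<^esub>" "lp_eval B a g' = \<zero>\<^bsub>B\<^esub>" for a
  proof -
    have "lp_eval B a u = \<zero>\<^bsub>B\<^esub>" "lp_eval B a v = \<zero>\<^bsub>B\<^esub>"
      using B.lp_eval_power[OF a(1) g(1), of d'] B.lp_eval_power[OF a(1) g'(1), of d] a(2,3) g(3) g'(3)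
      by (simp_all add: u_def v_def B.nat_pow_zero)
    then show ?thesis
      using B.lp_eval_form[OF a(1) h(1) o] B.form_value_zero[OF h(1,2)] by simp
  qed
  moreover have "lp_value K a g = \<zero> \<and> lp_value K a g' = \<zero>"
    if a: "a \<in> I \<rightarrow> carrier K" "lp_value K a ?G = \<zero>" for a
  proof -
    have a': "a \<in> I \<rightarrow> carrier (scalar_algebra K)" using a(1) by simp
    have c: "lp_value K a l \<in> carrier K" if "lp_over K I l" for l
      using S.lp_eval_closed[OF a' that] by simp
    have "lp_value K a u = \<zero> \<and> lp_value K a v = \<zero>"
      using K.form_value_anisotropic[OF h c[OF o(1)] c[OF o(2)]] a(2) S.lp_eval_form[OF a' h(1) o] by simp
    then have "lp_value K a g [^] d' = \<zero>" "lp_value K a g' [^] d = \<zero>"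
      using S.lp_eval_power[OF a' g(1), of d'] S.lp_eval_power[OF a' g'(1), of d]
      by (simp_all add: u_def v_def)
    then show ?thesis using K.pow_eq_zero c g(1) g'(1) by blast
  qed
  ultimately show ?thesis by blast
qed

text \<open>Anisotropic forms in more variables arise by nesting the binary one. The empty system is
  represented by the empty list, to which degree 1 may be assigned.\<close>

lemma ex_lp_system:
  fixes K :: "('k, 'm) ring_scheme" (structure) and B :: "('k, 'b, 'n) module_scheme"
  assumes K: "field K" and nrc: "\<not> root_closed K" and B: "algebra K B"
    and gs: "\<And>g. g \<in> set gs \<Longrightarrow> lp_over K I g \<and> (\<exists>d\<ge>1. lp_homog d g)"
  obtains G D where "lp_over K I G" "lp_homog D G"
    "\<forall>a\<in>I \<rightarrow> carrier B. (\<forall>g\<in>set gs. lp_eval B a g = \<zero>\<^bsub>B\<^esub>) \<longrightarrow> lp_eval B a G = \<zero>\<^bsub>B\<^esub>"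
    "\<forall>a\<in>I \<rightarrow> carrier K. lp_value K a G = \<zero> \<longrightarrow>
      (\<forall>g\<in>set gs. lp_value K a g = \<zero>)"
proof -
  have "\<exists>G D. 1 \<le> D \<and> lp_over K I G \<and> lp_homog D G \<and>
    (\<forall>a\<in>I \<rightarrow> carrier B. (\<forall>g\<in>set gs. lp_eval B a g = \<zero>\<^bsub>B\<^esub>) \<longrightarrow> lp_eval B a G = \<zero>\<^bsub>B\<^esub>) \<and>
    (\<forall>a\<in>I \<rightarrow> carrier K. lp_value K a G = \<zero> \<longrightarrow>
      (\<forall>g\<in>set gs. lp_value K a g = \<zero>))"
    using gs
  proof (induction gs)
    case Nil
    show ?case by (rule exI[of _ "[]"], rule exI[of _ 1]) (auto simp: lp_homog_def)
  next
    case (Cons g gs)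
    obtain d where g: "lp_over K I g" "lp_homog d g" "1 \<le> d" using Cons.prems[of g] by auto
    obtain G D where G: "lp_over K I G" "lp_homog D G" "1 \<le> D"
      "\<And>a. a \<in> I \<rightarrow> carrier B \<Longrightarrow> (\<forall>g\<in>set gs. lp_eval B a g = \<zero>\<^bsub>B\<^esub>) \<Longrightarrow> lp_eval B a G = \<zero>\<^bsub>B\<^esub>"
      "\<And>a. a \<in> I \<rightarrow> carrier K \<Longrightarrow> lp_value K a G = \<zero> \<Longrightarrow>
        (\<forall>g\<in>set gs. lp_value K a g = \<zero>)"
      using Cons.IH Cons.prems by (metis (no_types, lifting) list.set_intros(2))
    obtain H E where H: "1 \<le> E" "lp_over K I H" "lp_homog E H"
      "\<And>a. a \<in> I \<rightarrow> carrier B \<Longrightarrow> lp_eval B a g = \<zero>\<^bsub>B\<^esub> \<and> lp_eval B a G = \<zero>\<^bsub>B\<^esub> \<Longrightarrow> lp_eval B a H = \<zero>\<^bsub>B\<^esub>"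
      "\<And>a. a \<in> I \<rightarrow> carrier K \<Longrightarrow> lp_value K a H = \<zero> \<Longrightarrow>
        lp_value K a g = \<zero> \<and> lp_value K a G = \<zero>"
      using ex_lp_pair[OF K nrc B g G(1-3)] by blast
    show ?case
    proof (intro exI[of _ H] exI[of _ E] conjI ballI impI)
      fix a assume "a \<in> I \<rightarrow> carrier B" "\<forall>g\<in>set (g # gs). lp_eval B a g = \<zero>\<^bsub>B\<^esub>"
      then show "lp_eval B a H = \<zero>\<^bsub>B\<^esub>" using H(4) G(4) by simp
    next
      fix a g' assume a: "a \<in> I \<rightarrow> carrier K" "lp_value K a H = \<zero>" and g': "g' \<in> set (g # gs)"
      show "lp_value K a g' = \<zero>"
        using H(5)[OF a] G(5)[OF a(1)] g' by auto
    qed (use H in auto)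
  qed
  then show thesis using that by blast
qed

section \<open>Homogenisation, and homomorphisms from points\<close>

definition lp_hom :: "'i \<Rightarrow> nat \<Rightarrow> ('k \<times> 'i list) list \<Rightarrow> ('k \<times> 'i list) list"
  where "lp_hom z e l = map (\<lambda>t. (fst t, snd t @ replicate (e - length (snd t)) z)) l"

lemma lp_over_hom: "lp_over K I l \<Longrightarrow> z \<in> I \<Longrightarrow> lp_over K I (lp_hom z e l)"
  by (auto simp: lp_over_def lp_hom_def)

text \<open>The bound on the words is essential: truncated subtraction leaves words longer than
  \<open>e\<close> unpadded.\<close>

lemma lp_homog_hom: "(\<And>t. t \<in> set l \<Longrightarrow> length (snd t) \<le> e) \<Longrightarrow> lp_homog e (lp_hom z e l)"
  by (auto simp: lp_homog_def lp_hom_def)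

lemma (in algebra) lp_eval_hom_one:
  assumes a: "a \<in> I \<rightarrow> carrier M" and l: "lp_over R I l" and z: "z \<in> I" "a z = \<one>\<^bsub>M\<^esub>"
  shows "lp_eval M a (lp_hom z e l) = lp_eval M a l"
proof -
  have "word_eval M a (replicate n z) = \<one>\<^bsub>M\<^esub>" for n using z by (induction n) auto
  then have "word_eval M a (w @ replicate n z) = word_eval M a w" if "set w \<subseteq> I" for w n
    using that z word_eval_append[OF a that, of "replicate n z"] a by (auto simp: set_replicate_conv_if)
  then show ?thesis using l by (induction l) (auto simp: lp_hom_def)
qed

text \<open>All padded words have length \<open>e\<close>, so dividing every coordinate by
  \<open>a z\<close> takes out the factor \<open>a z [^] e\<close>, after which the padding
  evaluates to 1.\<close>

lemma (in field) lp_eval_hom_scale: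
  assumes a: "a \<in> I \<rightarrow> carrier R" and l: "lp_over R I l" and z: "z \<in> I" "a z \<noteq> \<zero>"
    and le: "\<And>t. t \<in> set l \<Longrightarrow> length (snd t) \<le> e"
  shows "lp_value R a (lp_hom z e l) =
    a z [^] e \<otimes> lp_value R (\<lambda>i. a i \<otimes> inv (a z)) l"
proof -
  interpret S: algebra R "scalar_algebra R" by (rule scalar_algebra_algebra[OF is_cring])
  let ?b = "\<lambda>i. a i \<otimes> inv (a z)"
  have az: "a z \<in> carrier R" "inv (a z) \<in> carrier R" "a z \<otimes> inv (a z) = \<one>"
  proof -
    show "a z \<in> carrier R" using a z by auto
    then have "a z \<in> Units R" using z field_Units by simp
    then show "inv (a z) \<in> carrier R" "a z \<otimes> inv (a z) = \<one>" by simp_all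
  qed
  have a': "a \<in> I \<rightarrow> carrier (scalar_algebra R)" and b': "?b \<in> I \<rightarrow> carrier (scalar_algebra R)"
    using a az by auto
  have r: "word_eval (scalar_algebra R) a (replicate n z) = a z [^] n" for n
    using az by (induction n) (auto simp: m_comm)
  have w: "word_eval (scalar_algebra R) a w = a z [^] length w \<otimes> word_eval (scalar_algebra R) ?b w"
    if "set w \<subseteq> I" for w
    using that
  proof (induction w)
    case (Cons i w)
    have c: "a i \<in> carrier R" "word_eval (scalar_algebra R) ?b w \<in> carrier R" "a z [^] length w \<in> carrier R"
      using Cons.prems a az S.word_eval_closed[OF b', of w] by auto
    have "a z [^] length (i # w) \<otimes> word_eval (scalar_algebra R) ?b (i # w) =
      (a z \<otimes> inv (a z)) \<otimes> (a i \<otimes> (a z [^] length w \<otimes> word_eval (scalar_algebra R) ?b w))"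
      using c az(1,2) by (simp add: m_ac)
    then show ?case using Cons c az(3) by simp
  qed simp
  have m: "word_eval (scalar_algebra R) a (w @ replicate (e - length w) z) =
    a z [^] e \<otimes> word_eval (scalar_algebra R) ?b w" if "set w \<subseteq> I" "length w \<le> e" for w
  proof -
    have "set (replicate (e - length w) z) \<subseteq> I" using z by auto
    then have "word_eval (scalar_algebra R) a (w @ replicate (e - length w) z) =
      (a z [^] length w \<otimes> word_eval (scalar_algebra R) ?b w) \<otimes> a z [^] (e - length w)"
      using S.word_eval_append[OF a' that(1)] w[OF that(1)] r by simp
    also have "\<dots> = (a z [^] length w \<otimes> a z [^] (e - length w)) \<otimes> word_eval (scalar_algebra R) ?b w"
      using S.word_eval_closed[OF b' that(1)] az by (simp add: m_ac)
    finally show ?thesis using az that(2) by (simp add: nat_pow_mult)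
  qed
  show ?thesis using l le
  proof (induction l)
    case (Cons t l)
    have c: "fst t \<in> carrier R" "set (snd t) \<subseteq> I" "length (snd t) \<le> e" "lp_over R I l"
      using Cons.prems by auto
    have v: "word_eval (scalar_algebra R) ?b (snd t) \<in> carrier R" "lp_value R ?b l \<in> carrier R"
      using S.word_eval_closed[OF b' c(2)] S.lp_eval_closed[OF b' c(4)] by auto
    have "lp_value R a (lp_hom z e l) = a z [^] e \<otimes> lp_value R ?b l"
      using Cons by auto
    then show ?case
      using m[OF c(2,3)] c v az by (simp add: lp_hom_def r_distr m_lcomm)
  qed (use az in \<open>simp add: lp_hom_def\<close>)
qed

text \<open>A point satisfying all relations of the generators defines a homomorphism by evaluation.
  In place of a quotient of a polynomial ring, \<open>\<phi>\<close> chooses some polynomial for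
  each element; the difference of two choices is a relation, so the choice is immaterial.\<close>

lemma alg_hom_of_point:
  assumes "cring K" and B: "algebra K B" and x: "x \<in> I \<rightarrow> carrier B"
    and gen: "carrier B = {lp_eval B x l | l. lp_over K I l}"
    and z: "z \<in> I \<rightarrow> carrier K"
      "\<And>l. lp_over K I l \<Longrightarrow> lp_eval B x l = \<zero>\<^bsub>B\<^esub> \<Longrightarrow> lp_value K z l = \<zero>\<^bsub>K\<^esub>"
  obtains \<phi> where "\<phi> \<in> points K B"
    "\<forall>l. lp_over K I l \<longrightarrow> \<phi> (lp_eval B x l) = lp_value K z l"
proof -
  interpret K: cring K by fact
  interpret B: algebra K B by fact
  interpret S: algebra K "scalar_algebra K" by (rule scalar_algebra_algebra[OF K.is_cring])
  have z': "z \<in> I \<rightarrow> carrier (scalar_algebra K)" using z by simp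
  have c: "lp_value K z l \<in> carrier K" if "lp_over K I l" for l
    using S.lp_eval_closed[OF z' that] by simp
  have m: "\<ominus>\<^bsub>K\<^esub> \<one>\<^bsub>K\<^esub> \<in> carrier K" by simp
  have wd: "lp_value K z l = lp_value K z l'"
    if l: "lp_over K I l" "lp_over K I l'" "lp_eval B x l = lp_eval B x l'" for l l'
  proof -
    let ?d = "l @ lp_scale K (\<ominus>\<^bsub>K\<^esub> \<one>\<^bsub>K\<^esub>) l'"
    have s: "lp_over K I (lp_scale K (\<ominus>\<^bsub>K\<^esub> \<one>\<^bsub>K\<^esub>) l')" by (rule lp_over_scale[OF K.is_cring m l(2)])
    have "lp_eval B x ?d = \<zero>\<^bsub>B\<^esub>"
      using B.lp_eval_append[OF x l(1) s] B.lp_eval_scale[OF x l(2) m] l B.lp_eval_closed[OF x l(2)]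
      by (simp add: B.smult_l_minus B.r_neg)
    moreover have "lp_over K I ?d" using l s by simp
    ultimately have "lp_value K z ?d = \<zero>\<^bsub>K\<^esub>" using z(2) by blast
    then have "lp_value K z l \<oplus>\<^bsub>K\<^esub> \<ominus>\<^bsub>K\<^esub> lp_value K z l' = \<zero>\<^bsub>K\<^esub>"
      using S.lp_eval_append[OF z' l(1) s] S.lp_eval_scale[OF z' l(2) m] c[OF l(2)]
      by (simp add: K.l_minus)
    then show ?thesis using c[OF l(1)] c[OF l(2)] K.minus_eq K.r_right_minus_eq by metis
  qed
  define \<phi> where "\<phi> u = lp_value K z (SOME l. lp_over K I l \<and> lp_eval B x l = u)" for u
  have \<phi>: "\<phi> (lp_eval B x l) = lp_value K z l" if "lp_over K I l" for l
    unfolding \<phi>_def using someI[of "\<lambda>l'. lp_over K I l' \<and> lp_eval B x l' = lp_eval B x l" l] wd that by blast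
  have "\<phi> \<in> points K B"
    unfolding alg_hom_def ring_hom_def
  proof (safe; unfold scalar_algebra_simps)
    show "\<phi> \<one>\<^bsub>B\<^esub> = \<one>\<^bsub>K\<^esub>" using \<phi>[of "[(\<one>\<^bsub>K\<^esub>, [])]"] by simp
    fix u assume "u \<in> carrier B"
    then obtain l where l: "lp_over K I l" "u = lp_eval B x l" using gen by blast
    show "\<phi> u \<in> carrier K" using \<phi> c l by simp
    show "\<phi> (k \<odot>\<^bsub>B\<^esub> u) = k \<otimes>\<^bsub>K\<^esub> \<phi> u" if "k \<in> carrier K" for k
      using \<phi>[OF lp_over_scale[OF K.is_cring that l(1)]] \<phi>[OF l(1)] l that
        B.lp_eval_scale[OF x l(1) that] S.lp_eval_scale[OF z' l(1) that] by simp
    fix v assume "v \<in> carrier B"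
    then obtain l' where l': "lp_over K I l'" "v = lp_eval B x l'" using gen by blast
    show "\<phi> (u \<otimes>\<^bsub>B\<^esub> v) = \<phi> u \<otimes>\<^bsub>K\<^esub> \<phi> v"
      using \<phi>[OF lp_over_mult[OF K.is_cring l(1) l'(1)]] \<phi>[OF l(1)] \<phi>[OF l'(1)] l l'
        B.lp_eval_mult[OF x l(1) l'(1)] S.lp_eval_mult[OF z' l(1) l'(1)] by simp
    have "lp_over K I (l @ l')" using l l' by simp
    then show "\<phi> (u \<oplus>\<^bsub>B\<^esub> v) = \<phi> u \<oplus>\<^bsub>K\<^esub> \<phi> v"
      using \<phi>[of "l @ l'"] \<phi>[OF l(1)] \<phi>[OF l'(1)] l l'
        B.lp_eval_append[OF x l(1) l'(1)] S.lp_eval_append[OF z' l(1) l'(1)] by simp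
  qed
  with \<phi> show thesis using that by blast
qed

text \<open>The polynomial is automatically non-zero: otherwise it would vanish at X = 0, Y =
  1.\<close>

lemma homogeneous_signature_lp:
  assumes "field K" and G: "lp_over K {..n} G" "lp_homog D G"
    and nz: "\<And>a b. a \<in> {..<n} \<rightarrow> carrier K \<Longrightarrow> b \<in> carrier K \<Longrightarrow>
      lp_value K (a(n := b)) G = \<zero>\<^bsub>K\<^esub> \<Longrightarrow> b = \<zero>\<^bsub>K\<^esub>"
  shows "lp_poly K G \<in> homogeneous_signature K n"
proof -
  interpret K: field K by fact
  interpret S: algebra K "scalar_algebra K" by (rule scalar_algebra_algebra[OF K.is_cring])
  have P: "lp_poly K G \<in> K.indexed_pset {..n} (carrier K)" by (rule S.lp_poly(1)[OF G(1)])
  have dom: "a(n := b) \<in> {..n} \<rightarrow> carrier (scalar_algebra K)"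
    if "a \<in> {..<n} \<rightarrow> carrier K" "b \<in> carrier K" for a b
    using that by (auto simp: Pi_iff)
  have ev: "poly_eval K (scalar_algebra K) (lp_poly K G) (a(n := b)) = lp_value K (a(n := b)) G"
    if "a \<in> {..<n} \<rightarrow> carrier K" "b \<in> carrier K" for a b
    by (rule S.lp_poly(2)[OF G(1) dom[OF that]])
  have "lp_poly K G \<noteq> K.indexed_const \<zero>\<^bsub>K\<^esub>"
  proof
    assume eq: "lp_poly K G = K.indexed_const \<zero>\<^bsub>K\<^esub>"
    have a: "(\<lambda>i. \<zero>\<^bsub>K\<^esub>) \<in> {..<n} \<rightarrow> carrier K" by simp
    have "lp_value K ((\<lambda>i. \<zero>\<^bsub>K\<^esub>)(n := \<one>\<^bsub>K\<^esub>)) G = \<zero>\<^bsub>K\<^esub>"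
      using ev[OF a K.one_closed] S.poly_eval_const[OF K.zero_closed dom[OF a K.one_closed]] unfolding eq by simp
    then show False using nz[OF a K.one_closed] by simp
  qed
  then show ?thesis
    using P ev nz lp_poly_homogeneous[OF K.ring_axioms G(2)]
    by (auto simp: homogeneous_signature_def)
qed

text \<open>The witness uses the generators \<open>x\<^sub>i\<close>, then \<open>1\<close> and \<open>c\<^sup>2\<close>. In the system over \<open>k\<close>, the
  equation \<open>Y\<^sup>2 = ZW\<close> excludes points at infinity (\<open>Z = 0\<close>) with \<open>Y \<noteq> 0\<close>.\<close>

lemma homogeneous_relation_not_root_closed:
  fixes K :: "('k, 'm) ring_scheme" (structure) and B :: "('k, 'b, 'n) module_scheme"
  assumes K: "field K" and nrc: "\<not> root_closed K" and fg: "finitely_generated_algebra K B"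
    and c: "c \<in> carrier B" "\<And>\<phi>. \<phi> \<in> points K B \<Longrightarrow> \<phi> c = \<zero>"
  shows "\<exists>n. \<exists>P\<in>homogeneous_signature K n. \<exists>a\<in>{..<n} \<rightarrow> carrier B. poly_eval K B P (a(n := c)) = \<zero>\<^bsub>B\<^esub>"
proof -
  interpret K: field K by fact
  have B: "algebra K B" using fg by (simp add: finitely_generated_algebra_def)
  interpret B: algebra K B by fact
  interpret S: algebra K "scalar_algebra K" by (rule scalar_algebra_algebra[OF K.is_cring])
  obtain xs where xs: "set xs \<subseteq> carrier B"
    "carrier B = foldl (adjoin B) ((\<lambda>c. c \<odot>\<^bsub>B\<^esub> \<one>\<^bsub>B\<^esub>) ` carrier K) xs"
    using finitely_generated_adjoins[OF fg] by blast
  define m x where "m = length xs" and "x = (!) xs"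
  have x: "x \<in> {..<m} \<rightarrow> carrier B" using xs by (auto simp: x_def m_def)
  have gen: "carrier B = {lp_eval B x l | l. lp_over K {..<m} l}"
    using B.lp_values_eq_adjoins[OF xs(1)] xs(2) by (simp add: x_def m_def)
  define T where "T = {l. lp_over K {..<m} l \<and> lp_eval B x l = \<zero>\<^bsub>B\<^esub>}"
  have "\<exists>T0\<subseteq>T. finite T0 \<and> (\<forall>z\<in>{..<m} \<rightarrow> carrier K.
    (\<forall>l\<in>T0. lp_value K z l = \<zero>) \<longrightarrow> (\<forall>l\<in>T. lp_value K z l = \<zero>))"
  proof (rule finite_zero_set[OF K])
    show "l @ l' \<in> T" if "l \<in> T" "l' \<in> T" for l l'
      using that B.lp_eval_append[OF x, of l l'] by (auto simp: T_def)
    show "lp_mult K l l' \<in> T" if "lp_over K {..<m} l" "l' \<in> T" for l l'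
      using that B.lp_eval_mult[OF x, of l l'] lp_over_mult[OF K.is_cring, of "{..<m}" l l']
        B.lp_eval_closed[OF x, of l] by (auto simp: T_def)
  qed (auto simp: T_def)
  then obtain T0 where T0: "T0 \<subseteq> T" "finite T0" "\<And>z. z \<in> {..<m} \<rightarrow> carrier K \<Longrightarrow>
    (\<forall>l\<in>T0. lp_value K z l = \<zero>) \<Longrightarrow> (\<forall>l\<in>T. lp_value K z l = \<zero>)"
    by blast
  have "c \<in> {lp_eval B x l | l. lp_over K {..<m} l}" using c(1) gen by simp
  then obtain lc where lc: "lp_over K {..<m} lc" "lp_eval B x lc = c" by blast
  obtain ts where ts: "set ts = T0" using T0(2) finite_list by blast
  \<comment> \<open>Indices below \<open>m\<close> are the generators, \<open>m\<close> is Z,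
    \<open>Suc m\<close> is W, and \<open>n\<close> is Y, the position that the signature reserves
    for the distinguished variable.\<close>
  define n where "n = Suc (Suc m)"
  let ?I = "{..n}"
  \<comment> \<open>Any bound on the lengths of the words would do as degree of the homogenisation;
    the successor makes it positive even for the empty list.\<close>
  define e where "e l = Suc (sum_list (map (\<lambda>t. length (snd t)) l))" for l :: "('k \<times> nat list) list"
  have e: "1 \<le> e l \<and> (\<forall>t\<in>set l. length (snd t) \<le> e l)" for l
  proof (intro conjI ballI)
    fix t assume "t \<in> set l"
    then have "length (snd t) \<le> sum_list (map (\<lambda>t. length (snd t)) l)"
      by (intro member_le_sum_list) auto
    then show "length (snd t) \<le> e l" by (simp add: e_def)
  qed (simp add: e_def)
  let ?m1 = "\<ominus> \<one>"
  \<comment> \<open>\<open>ly\<close> is g(X) - Y, and \<open>lq\<close> below is Y^2 - ZW. The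
    latter is already homogeneous and is not padded in \<open>gs\<close>.\<close>
  define ly where "ly = lc @ [(?m1, [n])]"
  define lq where "lq = [(\<one>, [n, n]), (?m1, [m, Suc m])]"
  define gs where "gs = map (\<lambda>l. lp_hom m (e l) l) (ly # ts) @ [lq]"
  have oT: "lp_over K ?I l" if "l \<in> T" for l
    using that by (auto simp: T_def n_def intro: lp_over_mono)
  have oc: "lp_over K ?I lc" using lc(1) by (auto simp: n_def intro: lp_over_mono)
  have oy: "lp_over K ?I ly" using oc by (auto simp: ly_def)
  have mI: "m \<in> ?I" by (simp add: n_def)
  have gs: "lp_over K ?I g \<and> (\<exists>d\<ge>1. lp_homog d g)" if "g \<in> set gs" for g
  proof -
    have "g = lq \<or> (\<exists>l. (l = ly \<or> l \<in> T) \<and> g = lp_hom m (e l) l)"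
      using that T0(1) unfolding gs_def ts[symmetric] by auto
    then consider l where "l = ly \<or> l \<in> T" "g = lp_hom m (e l) l" | "g = lq" by blast
    then show ?thesis
    proof cases
      case 1
      then have "lp_over K ?I l" using oy oT by auto
      then show ?thesis
        using 1 e[of l] lp_over_hom[OF _ mI] lp_homog_hom[of l "e l" m] by blast
    next
      case 2
      have "lp_homog 2 lq" by (auto simp: lp_homog_def lq_def)
      moreover have "lp_over K ?I lq" by (auto simp: lq_def n_def)
      ultimately show ?thesis using 2 by (intro conjI exI[of _ 2]) auto
    qed
  qed
  obtain G D where G: "lp_over K ?I G" "lp_homog D G"
    "\<forall>a\<in>?I \<rightarrow> carrier B. (\<forall>g\<in>set gs. lp_eval B a g = \<zero>\<^bsub>B\<^esub>) \<longrightarrow> lp_eval B a G = \<zero>\<^bsub>B\<^esub>"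
    "\<forall>a\<in>?I \<rightarrow> carrier K. lp_value K a G = \<zero> \<longrightarrow>
      (\<forall>g\<in>set gs. lp_value K a g = \<zero>)"
    by (rule ex_lp_system[OF K nrc B gs]) (assumption, rule that)
  have "lp_poly K G \<in> homogeneous_signature K n"
  proof (rule homogeneous_signature_lp[OF K G(1,2)])
    fix a b assume a: "a \<in> {..<n} \<rightarrow> carrier K" "b \<in> carrier K"
      and 0: "lp_value K (a(n := b)) G = \<zero>"
    define a' where "a' = a(n := b)"
    have a': "a' \<in> ?I \<rightarrow> carrier K" using a by (auto simp: a'_def Pi_iff)
    then have a'S: "a' \<in> ?I \<rightarrow> carrier (scalar_algebra K)" by simp
    have v: "\<forall>g\<in>set gs. lp_value K a' g = \<zero>"
      using bspec[OF G(4) a'] 0 by (simp add: a'_def)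
    have aK: "a' m \<in> carrier K" "a' (Suc m) \<in> carrier K" "a' n = b"
      using a' by (auto simp: n_def Pi_iff) (simp add: a'_def n_def)
    have "lp_value K a' lq = \<zero>" using v by (simp add: gs_def)
    then have q: "b \<otimes> b \<oplus> \<ominus> (a' m \<otimes> a' (Suc m)) = \<zero>"
      using aK a(2) by (simp add: lq_def K.l_minus)
    show "b = \<zero>"
    proof (cases "a' m = \<zero>")
      case True
      then show ?thesis using q aK a(2) K.integral by fastforce
    next
      case False
      \<comment> \<open>The affine point with Z = 1. It is a zero of the lists in \<open>T0\<close>,
        hence by their choice of all relations in \<open>T\<close>.\<close>
      let ?z = "\<lambda>i. a' i \<otimes> inv (a' m)"
      have iz: "inv (a' m) \<in> carrier K" "a' m \<otimes> inv (a' m) = \<one>"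
        using aK False K.field_Units by auto
      have z: "?z \<in> ?I \<rightarrow> carrier K" "?z \<in> {..<m} \<rightarrow> carrier K"
        using a' iz by (auto simp: Pi_iff n_def)
      have hz: "lp_value K ?z l = \<zero>" if "l \<in> set (ly # ts)" "lp_over K ?I l" for l
      proof -
        have "lp_value K a' (lp_hom m (e l) l) = \<zero>" using v that by (auto simp: gs_def)
        then have "a' m [^] e l \<otimes> lp_value K ?z l = \<zero>"
          using K.lp_eval_hom_scale[OF a' that(2) mI False, of "e l"] e[of l] by auto
        moreover have "a' m [^] e l \<noteq> \<zero>" using K.pow_eq_zero[OF aK(1)] False by blast
        moreover have "lp_value K ?z l \<in> carrier K"
          using S.lp_eval_closed[of ?z ?I l] z that by simp
        ultimately show ?thesis using K.integral aK by blast
      qed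
      have "\<forall>l\<in>T0. lp_value K ?z l = \<zero>" using hz ts T0(1) oT by auto
      then have "\<forall>l\<in>T. lp_value K ?z l = \<zero>" using T0(3)[OF z(2)] by blast
      then have zT: "lp_value K ?z l = \<zero>"
        if "lp_over K {..<m} l" "lp_eval B x l = \<zero>\<^bsub>B\<^esub>" for l using that by (simp add: T_def)
      obtain \<phi> where \<phi>: "\<phi> \<in> points K B"
        "\<forall>l. lp_over K {..<m} l \<longrightarrow> \<phi> (lp_eval B x l) = lp_value K ?z l"
        by (rule alg_hom_of_point[OF K.is_cring B x gen z(2) zT]) (assumption, assumption, rule that)
      \<comment> \<open>The point gives a homomorphism whose value at \<open>c\<close> is g(z); this
        is 0 by assumption on \<open>c\<close>, while \<open>ly\<close> equates g(z) with
        b/Z.\<close>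
      have lcz: "lp_value K ?z lc = \<zero>" using mp[OF spec[OF \<phi>(2), of lc] lc(1)] c(2)[OF \<phi>(1)] lc(2) by simp
      have "lp_value K ?z ly = \<zero>" using hz oy by simp
      moreover have "lp_value K ?z ly =
        lp_value K ?z lc \<oplus> lp_value K ?z [(?m1, [n])]"
        unfolding ly_def using S.lp_eval_append[of ?z ?I lc "[(?m1, [n])]"] z(1) oc by simp
      ultimately have "\<ominus> (b \<otimes> inv (a' m)) = \<zero>"
        using lcz aK a(2) iz by (simp add: K.l_minus)
      then have bz: "b \<otimes> inv (a' m) = \<zero>"
        using a(2) iz K.minus_minus[of "b \<otimes> inv (a' m)"] by simp
      have "b = b \<otimes> (inv (a' m) \<otimes> a' m)" using a(2) iz aK K.m_comm by simp
      also have "\<dots> = (b \<otimes> inv (a' m)) \<otimes> a' m"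
        by (rule K.m_assoc[symmetric]) (use a(2) iz aK in auto)
      finally show ?thesis using bz aK by simp
    qed
  qed
  moreover define a where "a i = (if i < m then x i else if i = m then \<one>\<^bsub>B\<^esub> else c \<otimes>\<^bsub>B\<^esub> c)" for i
  have a: "a \<in> {..<n} \<rightarrow> carrier B" using x c(1) by (auto simp: a_def n_def Pi_iff)
  moreover have "poly_eval K B (lp_poly K G) (a(n := c)) = \<zero>\<^bsub>B\<^esub>"
  proof -
    define a' where "a' = a(n := c)"
    have a': "a' \<in> ?I \<rightarrow> carrier B" using a c(1) by (auto simp: a'_def Pi_iff)
    have a'v: "a' m = \<one>\<^bsub>B\<^esub>" "a' (Suc m) = c \<otimes>\<^bsub>B\<^esub> c" "a' n = c" "\<And>i. i < m \<Longrightarrow> a' i = x i"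
      by (auto simp: a'_def a_def n_def)
    have ex: "lp_eval B a' l = lp_eval B x l" if "lp_over K {..<m} l" for l
      using that a'v by (intro lp_eval_cong) auto
    have "lp_eval B a' g = \<zero>\<^bsub>B\<^esub>" if "g \<in> set gs" for g
    proof -
      have "g = lq \<or> g = lp_hom m (e ly) ly \<or> (\<exists>l\<in>T. g = lp_hom m (e l) l)"
        using \<open>g \<in> set gs\<close> T0(1) unfolding gs_def ts[symmetric] by auto
      then consider l where "l \<in> T" "g = lp_hom m (e l) l" | "g = lp_hom m (e ly) ly" | "g = lq" by blast
      then show ?thesis
      proof cases
        case 1
        then show ?thesis using B.lp_eval_hom_one[OF a' oT mI a'v(1)] ex by (auto simp: T_def)
      next
        case 2
        have "lp_eval B a' ly = lp_eval B a' lc \<oplus>\<^bsub>B\<^esub> lp_eval B a' [(?m1, [n])]"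
          unfolding ly_def by (rule B.lp_eval_append[OF a' oc]) auto
        then have "lp_eval B a' ly = \<zero>\<^bsub>B\<^esub>"
          using ex[OF lc(1)] lc(2) a'v(3) c(1) by (simp add: B.smult_l_minus B.r_neg)
        then show ?thesis using 2 B.lp_eval_hom_one[OF a' oy mI a'v(1)] by simp
      next
        case 3
        then show ?thesis using a'v c(1) by (simp add: lq_def B.smult_l_minus B.r_neg)
      qed
    qed
    then show ?thesis using bspec[OF G(3) a'] B.lp_poly(2)[OF G(1) a'] by (simp add: a'_def)
  qed
  ultimately show ?thesis by blast
qed

section \<open>Special and essential algebras\<close>

theorem homogeneous_relation:
  fixes K :: "('k, 'm) ring_scheme" (structure) and B :: "('k, 'b, 'n) module_scheme"
  assumes K: "field K" and fg: "finitely_generated_algebra K B"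
    and c: "c \<in> carrier B" "\<And>\<phi>. \<phi> \<in> points K B \<Longrightarrow> \<phi> c = \<zero>"
  shows "\<exists>n. \<exists>P\<in>homogeneous_signature K n. \<exists>a\<in>{..<n} \<rightarrow> carrier B. poly_eval K B P (a(n := c)) = \<zero>\<^bsub>B\<^esub>"
proof (cases "root_closed K")
  case True
  interpret K: field K by fact
  interpret B: algebra K B using fg by (simp add: finitely_generated_algebra_def)
  interpret S: algebra K "scalar_algebra K" by (rule scalar_algebra_algebra[OF K.is_cring])
  obtain d :: nat where d: "c [^]\<^bsub>B\<^esub> d = \<zero>\<^bsub>B\<^esub>"
    using ex_alg_hom_of_not_nilpotent[OF K True fg c(1)] c(2) by blast
  \<comment> \<open>A power of Y alone. There are no ordinary variables, so Y has index 0.\<close>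
  let ?G = "[(\<one>, replicate (Suc d) 0)] :: ('k \<times> nat list) list"
  have o: "lp_over K {..0} ?G" by auto
  have "word_eval (scalar_algebra K) a (replicate n 0) = a 0 [^] n"
    if "a 0 \<in> carrier K" for a :: "nat \<Rightarrow> 'k" and n
    using that by (induction n) (auto simp: K.m_comm)
  then have evK: "lp_value K (a(0 := b)) ?G = b [^] Suc d"
    if "b \<in> carrier K" for a :: "nat \<Rightarrow> 'k" and b
    using that by (simp del: replicate.simps nat_pow_Suc)
  have "word_eval B a (replicate n 0) = a 0 [^]\<^bsub>B\<^esub> n"
    if "a 0 \<in> carrier B" for a :: "nat \<Rightarrow> 'b" and n
    using that by (induction n) (auto simp: B.m_comm)
  then have evB: "lp_eval B ((\<lambda>_. c)(0 := c)) ?G = c [^]\<^bsub>B\<^esub> Suc d"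
    using c(1) by (simp del: replicate.simps nat_pow_Suc)
  have "lp_homog (Suc d) ?G" by (simp add: lp_homog_def)
  moreover have "b = \<zero>"
    if "b \<in> carrier K" "lp_value K (a(0 := b)) ?G = \<zero>" for a b
    using K.pow_eq_zero[OF that(1)] that(2) unfolding evK[OF that(1)] by blast
  ultimately have "lp_poly K ?G \<in> homogeneous_signature K 0"
    by (intro homogeneous_signature_lp[OF K o]) auto
  moreover have "poly_eval K B (lp_poly K ?G) ((\<lambda>_. c)(0 := c)) = \<zero>\<^bsub>B\<^esub>"
    using B.lp_poly(2)[OF o, of "(\<lambda>_. c)(0 := c)"] evB c(1) d by simp
  moreover have "(\<lambda>_. c) \<in> {..<0::nat} \<rightarrow> carrier B" by simp
  ultimately show ?thesis by blast
next
  case False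
  show ?thesis by (rule homogeneous_relation_not_root_closed[OF K False fg c(1)]) (rule c(2))
qed

lemma alg_homD:
  assumes "\<phi> \<in> alg_hom K A B"
  shows "x \<in> carrier A \<Longrightarrow> \<phi> x \<in> carrier B"
    and "x \<in> carrier A \<Longrightarrow> y \<in> carrier A \<Longrightarrow> \<phi> (x \<otimes>\<^bsub>A\<^esub> y) = \<phi> x \<otimes>\<^bsub>B\<^esub> \<phi> y"
    and "x \<in> carrier A \<Longrightarrow> y \<in> carrier A \<Longrightarrow> \<phi> (x \<oplus>\<^bsub>A\<^esub> y) = \<phi> x \<oplus>\<^bsub>B\<^esub> \<phi> y"
    and "\<phi> \<one>\<^bsub>A\<^esub> = \<one>\<^bsub>B\<^esub>"
    and "k \<in> carrier K \<Longrightarrow> x \<in> carrier A \<Longrightarrow> \<phi> (k \<odot>\<^bsub>A\<^esub> x) = k \<odot>\<^bsub>B\<^esub> \<phi> x"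
  using assms by (auto simp: alg_hom_def ring_hom_def)

lemma alg_hom_zero:
  assumes "\<phi> \<in> alg_hom K A B" "algebra K A" "algebra K B"
  shows "\<phi> \<zero>\<^bsub>A\<^esub> = \<zero>\<^bsub>B\<^esub>"
proof -
  interpret A: algebra K A by fact
  interpret B: algebra K B by fact
  show ?thesis
    using assms(1) ring_hom_zero[of \<phi> A B] A.ring_axioms B.ring_axioms by (auto simp: alg_hom_def)
qed

lemma alg_hom_comp:
  "f \<in> alg_hom K A B \<Longrightarrow> g \<in> alg_hom K B C \<Longrightarrow> g \<circ> f \<in> alg_hom K A C"
  by (auto simp: alg_hom_def ring_hom_def Pi_iff)

text \<open>The power of k is indexed by all points; injectivity comes from a point that does not
  kill the difference of two elements.\<close>

lemma essential_of_separating: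
  fixes K :: "('k, 'm) ring_scheme" (structure) and A :: "('k, 'a, 'n) module_scheme"
  assumes K: "field K" and A: "algebra K A"
    and sep: "\<And>x. x \<in> carrier A \<Longrightarrow> x \<noteq> \<zero>\<^bsub>A\<^esub> \<Longrightarrow> \<exists>\<phi>\<in>points K A. \<phi> x \<noteq> \<zero>"
  shows "essential K A"
proof -
  interpret K: field K by fact
  interpret A: algebra K A by fact
  let ?H = "points K A"
  let ?f = "\<lambda>x. \<lambda>\<phi>\<in>?H. \<phi> x"
  have hom: "?f \<in> alg_hom K A (power_algebra K ?H)"
    unfolding alg_hom_def[of K A "power_algebra K ?H"] ring_hom_def power_algebra_simps
    by (safe; (rule restrict_ext | rule restrict_PiE_iff[THEN iffD2, rule_format])?)
      (auto simp: alg_homD alg_homD[where B = "scalar_algebra K", simplified] cong: restrict_cong)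
  have "inj_on ?f (carrier A)"
  proof (rule inj_onI, rule ccontr)
    fix x y assume xy: "x \<in> carrier A" "y \<in> carrier A" "?f x = ?f y" "x \<noteq> y"
    then obtain \<phi> where \<phi>: "\<phi> \<in> ?H" "\<phi> (x \<ominus>\<^bsub>A\<^esub> y) \<noteq> \<zero>"
      using sep[of "x \<ominus>\<^bsub>A\<^esub> y"] by auto
    have eq: "\<phi> x = \<phi> y" using fun_cong[OF xy(3), of \<phi>] \<phi>(1) by simp
    have "\<phi> x = \<phi> (x \<ominus>\<^bsub>A\<^esub> y) \<oplus> \<phi> y"
      using alg_homD(3)[OF \<phi>(1), of "x \<ominus>\<^bsub>A\<^esub> y" y] xy by (simp add: A.minus_eq A.a_assoc A.l_neg)
    then show False
      using \<phi>(2) eq alg_homD(1)[OF \<phi>(1), of "x \<ominus>\<^bsub>A\<^esub> y"] alg_homD(1)[OF \<phi>(1), of y] xy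
        K.add.l_cancel_one' by auto
  qed
  with hom show ?thesis by (rule essentialI[OF A])
qed

lemma special_of_essential:
  fixes K :: "('k, 'm) ring_scheme" (structure) and A :: "('k, 'a, 'n) module_scheme"
  assumes K: "field K" and A: "algebra K A" and ess: "essential K A"
  shows "special K A"
  unfolding special_def
proof (intro allI ballI impI)
  interpret K: field K by fact
  interpret A: algebra K A by fact
  fix n P a b
  assume P: "P \<in> homogeneous_signature K n" and a: "a \<in> {..<n} \<rightarrow> carrier A" and b: "b \<in> carrier A"
    and 0: "poly_eval K A P (a(n := b)) = \<zero>\<^bsub>A\<^esub>"
  obtain S :: "('a \<Rightarrow> 'k) set" and f where f: "f \<in> alg_hom K A (power_algebra K S)" "inj_on f (carrier A)"
    using ess unfolding essential_def by blast
  have Pi: "P \<in> K.indexed_pset {..n} (carrier K)" using P by (simp add: homogeneous_signature_def)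
  have ab: "a(n := b) \<in> {..n} \<rightarrow> carrier A" using a b by (auto simp: Pi_iff)
  note S = scalar_algebra_algebra[OF K.is_cring]
  have "f b s = \<zero>" if s: "s \<in> S" for s
  proof -
    define \<phi> where "\<phi> = (\<lambda>h. h s) \<circ> f"
    have \<phi>: "\<phi> \<in> points K A"
      unfolding \<phi>_def by (rule alg_hom_comp[OF f(1) power_algebra_proj[OF s]])
    have "poly_eval K (scalar_algebra K) P ((\<phi> \<circ> a)(n := \<phi> b)) = \<zero>"
      using poly_eval_alg_hom[OF A S Pi \<phi> ab] alg_hom_zero[OF \<phi> A S] unfolding 0
      by (simp add: fun_upd_comp)
    moreover have "\<phi> \<circ> a \<in> {..<n} \<rightarrow> carrier K" "\<phi> b \<in> carrier K"
      using a b alg_homD(1)[OF \<phi>] by (auto simp: Pi_iff)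
    ultimately have "\<phi> b = \<zero>" using P unfolding homogeneous_signature_def by blast
    then show ?thesis by (simp add: \<phi>_def)
  qed
  moreover have "f b \<in> S \<rightarrow>\<^sub>E carrier K"
    using alg_homD(1)[OF f(1) b] by (simp add: power_algebra_simps)
  ultimately have "f b = (\<lambda>s\<in>S. \<zero>)" by (intro PiE_ext) auto
  also have "\<dots> = f \<zero>\<^bsub>A\<^esub>"
    using alg_hom_zero[OF f(1) A power_algebra_algebra[OF K.is_cring]] by (simp add: power_algebra_simps)
  finally show "b = \<zero>\<^bsub>A\<^esub>" using f(2) b by (auto dest: inj_onD)
qed

text \<open>The hypotheses say that \<open>A\<close> is the localisation of \<open>B\<close> at \<open>M\<close>, where \<open>M\<close> has
  no zero under homomorphisms to \<open>k\<close>; so these extend to \<open>A\<close>.\<close>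

lemma alg_hom_extends:
  fixes K :: "('k, 'm) ring_scheme" (structure) and A :: "('k, 'a, 'n) module_scheme"
    and B :: "('k, 'b, 'p) module_scheme"
  assumes K: "field K" and A: "algebra K A" and B: "algebra K B" and j: "j \<in> alg_hom K B A"
    and M: "M \<subseteq> carrier B"
    and frac: "\<And>x. x \<in> carrier A \<Longrightarrow> \<exists>b\<in>carrier B. \<exists>s\<in>M. x \<otimes>\<^bsub>A\<^esub> j s = j b"
    and ker: "\<And>b. b \<in> carrier B \<Longrightarrow> j b = \<zero>\<^bsub>A\<^esub> \<Longrightarrow> \<exists>u\<in>M. u \<otimes>\<^bsub>B\<^esub> b = \<zero>\<^bsub>B\<^esub>"
    and \<phi>: "\<phi> \<in> points K B" and nz: "\<And>s. s \<in> M \<Longrightarrow> \<phi> s \<noteq> \<zero>"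
  shows "\<exists>\<psi>\<in>points K A. \<forall>b\<in>carrier B. \<psi> (j b) = \<phi> b"
proof -
  interpret K: field K by fact
  interpret A: algebra K A by fact
  interpret B: algebra K B by fact
  note jh = alg_homD[OF j] and ph = alg_homD[OF \<phi>, simplified]
  define Q where "Q y t \<longleftrightarrow> t \<in> carrier K \<and> (\<exists>b\<in>carrier B. \<exists>s\<in>carrier B. \<phi> s \<noteq> \<zero> \<and>
    y \<otimes>\<^bsub>A\<^esub> j s = j b \<and> t \<otimes> \<phi> s = \<phi> b)" for y t
  have QI: "Q y t" if "t \<in> carrier K" "b \<in> carrier B" "s \<in> carrier B" "\<phi> s \<noteq> \<zero>"
    "y \<otimes>\<^bsub>A\<^esub> j s = j b" "t \<otimes> \<phi> s = \<phi> b" for y t b s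
    using that unfolding Q_def by blast
  have total: "\<exists>t. Q y t" if y: "y \<in> carrier A" for y
  proof -
    obtain b s where bs: "b \<in> carrier B" "s \<in> M" "y \<otimes>\<^bsub>A\<^esub> j s = j b" using frac[OF y] by blast
    have s: "s \<in> carrier B" using bs M by blast
    have "\<phi> s \<in> Units K" using ph(1)[OF s] nz[OF bs(2)] K.field_Units by simp
    then have "Q y (\<phi> b \<otimes> inv (\<phi> s))"
      using ph(1)[OF s] ph(1)[OF bs(1)] bs s nz by (intro QI[of _ b s]) (auto simp: K.m_assoc)
    then show ?thesis ..
  qed
  have unique: "t = t'" if y: "y \<in> carrier A" and t: "Q y t" "Q y t'" for y t t'
  proof -
    obtain b s where bs: "b \<in> carrier B" "s \<in> carrier B" "\<phi> s \<noteq> \<zero>"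
      "y \<otimes>\<^bsub>A\<^esub> j s = j b" "t \<otimes> \<phi> s = \<phi> b" "t \<in> carrier K" using t(1) by (auto simp: Q_def)
    obtain b' s' where bs': "b' \<in> carrier B" "s' \<in> carrier B" "\<phi> s' \<noteq> \<zero>"
      "y \<otimes>\<^bsub>A\<^esub> j s' = j b'" "t' \<otimes> \<phi> s' = \<phi> b'" "t' \<in> carrier K" using t(2) by (auto simp: Q_def)
    let ?m = "\<ominus> \<one>"
    \<comment> \<open>The cross difference of two fractions for y is killed by \<open>j\<close>,
      hence annihilated by some u in \<open>M\<close>. As \<phi>(u) is non-zero, \<phi> kills it
      too, and the two quotients agree.\<close>
    let ?d = "b \<otimes>\<^bsub>B\<^esub> s' \<oplus>\<^bsub>B\<^esub> ?m \<odot>\<^bsub>B\<^esub> (b' \<otimes>\<^bsub>B\<^esub> s)"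
    have js: "j s \<in> carrier A" "j s' \<in> carrier A" using jh(1) bs bs' by auto
    have "j ?d = j b \<otimes>\<^bsub>A\<^esub> j s' \<oplus>\<^bsub>A\<^esub> ?m \<odot>\<^bsub>A\<^esub> (j b' \<otimes>\<^bsub>A\<^esub> j s)"
      using jh bs bs' by simp
    also have "j b \<otimes>\<^bsub>A\<^esub> j s' = j b' \<otimes>\<^bsub>A\<^esub> j s"
      unfolding bs(4)[symmetric] bs'(4)[symmetric] using js y by (simp add: A.m_ac)
    finally have "j ?d = \<zero>\<^bsub>A\<^esub>"
      using jh(1)[OF bs'(1)] js by (simp add: A.smult_l_minus A.r_neg)
    then obtain u where u: "u \<in> M" "u \<otimes>\<^bsub>B\<^esub> ?d = \<zero>\<^bsub>B\<^esub>" using ker[of ?d] bs bs' by auto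
    have uB: "u \<in> carrier B" using u M by blast
    have "\<phi> u \<otimes> \<phi> ?d = \<zero>"
      using ph(2)[OF uB, of ?d] u(2) bs bs' alg_hom_zero[OF \<phi> B scalar_algebra_algebra[OF K.is_cring]] by simp
    then have "\<phi> ?d = \<zero>"
      using nz[OF u(1)] ph(1)[OF uB] ph(1)[of ?d] bs bs' by (simp add: K.integral_iff)
    then have d: "\<phi> b \<otimes> \<phi> s' \<oplus> ?m \<otimes> (\<phi> b' \<otimes> \<phi> s) = \<zero>"
      using ph bs bs' by simp
    have c: "\<phi> s \<in> carrier K" "\<phi> s' \<in> carrier K" using ph(1) bs bs' by auto
    have "(t \<ominus> t') \<otimes> (\<phi> s \<otimes> \<phi> s') = (t \<otimes> \<phi> s) \<otimes> \<phi> s' \<oplus> ?m \<otimes> ((t' \<otimes> \<phi> s') \<otimes> \<phi> s)"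
      using c bs(6) bs'(6) by algebra
    then have "(t \<ominus> t') \<otimes> (\<phi> s \<otimes> \<phi> s') = \<zero>" unfolding bs(5) bs'(5) d .
    then have "t \<ominus> t' = \<zero>" using c bs bs' by (simp add: K.integral_iff)
    then show ?thesis using bs bs' by simp
  qed
  define \<psi> where "\<psi> y = (SOME t. Q y t)" for y
  have Q\<psi>: "Q y (\<psi> y)" if "y \<in> carrier A" for y
    unfolding \<psi>_def using total[OF that] by (rule someI_ex)
  have \<psi>: "\<psi> y = t" if "y \<in> carrier A" "Q y t" for y t
    using unique[OF that(1) Q\<psi>[OF that(1)] that(2)] .
  have val: "\<psi> (j b) = \<phi> b" if "b \<in> carrier B" for b
    using that jh ph B.one_closed by (intro \<psi> QI[of _ b "\<one>\<^bsub>B\<^esub>"]) auto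
  have "\<psi> \<in> points K A"
    unfolding alg_hom_def ring_hom_def
  proof (safe; unfold scalar_algebra_simps)
    show "\<psi> \<one>\<^bsub>A\<^esub> = \<one>" using val[OF B.one_closed] jh(4) ph(4) by simp
    fix y assume y: "y \<in> carrier A"
    obtain b s where bs: "b \<in> carrier B" "s \<in> carrier B" "\<phi> s \<noteq> \<zero>"
      "y \<otimes>\<^bsub>A\<^esub> j s = j b" "\<psi> y \<otimes> \<phi> s = \<phi> b" "\<psi> y \<in> carrier K" using Q\<psi>[OF y] by (auto simp: Q_def)
    show "\<psi> y \<in> carrier K" by fact
    have js: "j s \<in> carrier A" "\<phi> s \<in> carrier K" using jh(1) ph(1) bs by auto
    show "\<psi> (k \<odot>\<^bsub>A\<^esub> y) = k \<otimes> \<psi> y" if k: "k \<in> carrier K" for k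
    proof (intro \<psi> QI[of _ "k \<odot>\<^bsub>B\<^esub> b" s])
      show "(k \<odot>\<^bsub>A\<^esub> y) \<otimes>\<^bsub>A\<^esub> j s = j (k \<odot>\<^bsub>B\<^esub> b)" using k y js bs jh by (simp add: A.smult_assoc2)
      show "k \<otimes> \<psi> y \<otimes> \<phi> s = \<phi> (k \<odot>\<^bsub>B\<^esub> b)" using k js bs ph by (simp add: K.m_assoc)
    qed (use k y bs in auto)
    fix y' assume y': "y' \<in> carrier A"
    obtain b' s' where bs': "b' \<in> carrier B" "s' \<in> carrier B" "\<phi> s' \<noteq> \<zero>"
      "y' \<otimes>\<^bsub>A\<^esub> j s' = j b'" "\<psi> y' \<otimes> \<phi> s' = \<phi> b'" "\<psi> y' \<in> carrier K" using Q\<psi>[OF y'] by (auto simp: Q_def)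
    have js': "j s' \<in> carrier A" "\<phi> s' \<in> carrier K" using jh(1) ph(1) bs' by auto
    have nz': "\<phi> (s \<otimes>\<^bsub>B\<^esub> s') \<noteq> \<zero>" using ph(2) bs bs' js js' by (simp add: K.integral_iff)
    show "\<psi> (y \<otimes>\<^bsub>A\<^esub> y') = \<psi> y \<otimes> \<psi> y'"
    proof (intro \<psi> QI[of _ "b \<otimes>\<^bsub>B\<^esub> b'" "s \<otimes>\<^bsub>B\<^esub> s'"])
      have "(y \<otimes>\<^bsub>A\<^esub> y') \<otimes>\<^bsub>A\<^esub> (j s \<otimes>\<^bsub>A\<^esub> j s') = (y \<otimes>\<^bsub>A\<^esub> j s) \<otimes>\<^bsub>A\<^esub> (y' \<otimes>\<^bsub>A\<^esub> j s')"
        using y y' js js' by (simp add: A.m_ac)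
      then show "(y \<otimes>\<^bsub>A\<^esub> y') \<otimes>\<^bsub>A\<^esub> j (s \<otimes>\<^bsub>B\<^esub> s') = j (b \<otimes>\<^bsub>B\<^esub> b')"
        using bs bs' jh(2) by simp
      have "(\<psi> y \<otimes> \<psi> y') \<otimes> (\<phi> s \<otimes> \<phi> s') = (\<psi> y \<otimes> \<phi> s) \<otimes> (\<psi> y' \<otimes> \<phi> s')"
        using bs(6) bs'(6) js js' by (simp add: K.m_ac)
      then show "(\<psi> y \<otimes> \<psi> y') \<otimes> \<phi> (s \<otimes>\<^bsub>B\<^esub> s') = \<phi> (b \<otimes>\<^bsub>B\<^esub> b')"
        using bs bs' ph(2) by simp
    qed (use y y' bs bs' nz' in auto)
    show "\<psi> (y \<oplus>\<^bsub>A\<^esub> y') = \<psi> y \<oplus> \<psi> y'"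
    proof (intro \<psi> QI[of _ "b \<otimes>\<^bsub>B\<^esub> s' \<oplus>\<^bsub>B\<^esub> b' \<otimes>\<^bsub>B\<^esub> s" "s \<otimes>\<^bsub>B\<^esub> s'"])
      have "(y \<oplus>\<^bsub>A\<^esub> y') \<otimes>\<^bsub>A\<^esub> (j s \<otimes>\<^bsub>A\<^esub> j s') = (y \<otimes>\<^bsub>A\<^esub> j s) \<otimes>\<^bsub>A\<^esub> j s' \<oplus>\<^bsub>A\<^esub> (y' \<otimes>\<^bsub>A\<^esub> j s') \<otimes>\<^bsub>A\<^esub> j s"
        using y y' js(1) js'(1) by algebra
      then show "(y \<oplus>\<^bsub>A\<^esub> y') \<otimes>\<^bsub>A\<^esub> j (s \<otimes>\<^bsub>B\<^esub> s') = j (b \<otimes>\<^bsub>B\<^esub> s' \<oplus>\<^bsub>B\<^esub> b' \<otimes>\<^bsub>B\<^esub> s)"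
        using bs bs' jh(2,3) by simp
      have "(\<psi> y \<oplus> \<psi> y') \<otimes> (\<phi> s \<otimes> \<phi> s') = (\<psi> y \<otimes> \<phi> s) \<otimes> \<phi> s' \<oplus> (\<psi> y' \<otimes> \<phi> s') \<otimes> \<phi> s"
        using bs(6) bs'(6) js(2) js'(2) by algebra
      then show "(\<psi> y \<oplus> \<psi> y') \<otimes> \<phi> (s \<otimes>\<^bsub>B\<^esub> s') = \<phi> (b \<otimes>\<^bsub>B\<^esub> s' \<oplus>\<^bsub>B\<^esub> b' \<otimes>\<^bsub>B\<^esub> s)"
        using bs bs' ph(2,3) by simp
    qed (use y y' bs bs' nz' in auto)
  qed
  with val show ?thesis by blast
qed

text \<open>After clearing a denominator, x is a unit times \<open>j b\<close>. If every point of
  \<open>B\<close> killed b, the homogeneous relation for b in \<open>B\<close> would be carried by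
  \<open>j\<close> into the special algebra \<open>A\<close> and force \<open>j b\<close> to be 0.
  The formulation through \<open>j\<close> and \<open>M\<close> covers both a localisation and
  \<open>A\<close> itself with the identity map.\<close>

lemma essential_of_special:
  fixes K :: "('k, 'm) ring_scheme" (structure) and A :: "('k, 'a, 'n) module_scheme"
    and B :: "('k, 'b, 'p) module_scheme"
  assumes K: "field K" and A: "algebra K A" and fg: "finitely_generated_algebra K B"
    and j: "j \<in> alg_hom K B A" and M: "M \<subseteq> carrier B"
    and frac: "\<And>x. x \<in> carrier A \<Longrightarrow> \<exists>b\<in>carrier B. \<exists>s\<in>M. x \<otimes>\<^bsub>A\<^esub> j s = j b"
    and units: "\<And>s. s \<in> M \<Longrightarrow> j s \<in> Units A"
    and ker: "\<And>b. b \<in> carrier B \<Longrightarrow> j b = \<zero>\<^bsub>A\<^esub> \<Longrightarrow> \<exists>u\<in>M. u \<otimes>\<^bsub>B\<^esub> b = \<zero>\<^bsub>B\<^esub>"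
    and nz: "\<And>\<phi> s. \<phi> \<in> points K B \<Longrightarrow> s \<in> M \<Longrightarrow> \<phi> s \<noteq> \<zero>"
    and special: "special K A"
  shows "essential K A"
proof (rule essential_of_separating[OF K A])
  interpret K: field K by fact
  interpret A: algebra K A by fact
  have B: "algebra K B" using fg by (simp add: finitely_generated_algebra_def)
  interpret B: algebra K B by fact
  fix x assume x: "x \<in> carrier A" "x \<noteq> \<zero>\<^bsub>A\<^esub>"
  obtain b s where bs: "b \<in> carrier B" "s \<in> M" "x \<otimes>\<^bsub>A\<^esub> j s = j b" using frac[OF x(1)] by blast
  have u: "j s \<in> Units A" by (rule units[OF bs(2)])
  have "j b \<noteq> \<zero>\<^bsub>A\<^esub>"
  proof
    assume "j b = \<zero>\<^bsub>A\<^esub>"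
    then have "x \<otimes>\<^bsub>A\<^esub> j s \<otimes>\<^bsub>A\<^esub> inv\<^bsub>A\<^esub> (j s) = \<zero>\<^bsub>A\<^esub>" using bs u by simp
    then show False using x u by (simp add: A.m_assoc A.Units_closed)
  qed
  have "\<exists>\<phi>\<in>points K B. \<phi> b \<noteq> \<zero>"
  proof (rule ccontr)
    assume "\<not> ?thesis"
    then obtain n P a where P: "P \<in> homogeneous_signature K n" "a \<in> {..<n} \<rightarrow> carrier B"
      "poly_eval K B P (a(n := b)) = \<zero>\<^bsub>B\<^esub>"
      using homogeneous_relation[OF K fg bs(1)] by blast
    have Pi: "P \<in> K.indexed_pset {..n} (carrier K)" using P(1) by (simp add: homogeneous_signature_def)
    have ab: "a(n := b) \<in> {..n} \<rightarrow> carrier B" using P(2) bs(1) by (auto simp: Pi_iff)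
    have "poly_eval K A P ((j \<circ> a)(n := j b)) = \<zero>\<^bsub>A\<^esub>"
      using poly_eval_alg_hom[OF B A Pi j ab] alg_hom_zero[OF j B A] P(3) by (simp add: fun_upd_comp)
    moreover have "j \<circ> a \<in> {..<n} \<rightarrow> carrier A" "j b \<in> carrier A"
      using P(2) bs(1) alg_homD(1)[OF j] by (auto simp: Pi_iff)
    ultimately have "j b = \<zero>\<^bsub>A\<^esub>" using special P(1) unfolding special_def by blast
    then show False using \<open>j b \<noteq> \<zero>\<^bsub>A\<^esub>\<close> by simp
  qed
  then obtain \<phi> where \<phi>: "\<phi> \<in> points K B" "\<phi> b \<noteq> \<zero>" by blast
  obtain \<psi> where \<psi>: "\<psi> \<in> points K A" "\<forall>b\<in>carrier B. \<psi> (j b) = \<phi> b"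
    using alg_hom_extends[OF K A B j M frac ker \<phi>(1) nz[OF \<phi>(1)]] by blast
  have "\<psi> x \<otimes> \<psi> (j s) = \<phi> b"
    using alg_homD(2)[OF \<psi>(1) x(1) A.Units_closed[OF u]] bs \<psi>(2) by simp
  then have "\<psi> x \<noteq> \<zero>" using \<phi>(2) alg_homD(1)[OF \<psi>(1) A.Units_closed[OF u]] by auto
  then show "\<exists>\<phi>\<in>points K A. \<phi> x \<noteq> \<zero>" using \<psi>(1) by blast
qed

section \<open>Canonical localisation\<close>

text \<open>For products, the variables of the second polynomial are renamed apart by adding
  \<open>n\<close>; the product polynomial has no zero in k because k is a domain. The constant 1
  needs no variables.\<close>

lemma signature_values_submonoid:
  fixes K :: "('k, 'm) ring_scheme" (structure) and B :: "('k, 'b, 'n) module_scheme"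
  assumes K: "field K" and B: "algebra K B"
  shows "submonoid (signature_values K B) B"
proof
  interpret K: field K by fact
  interpret B: algebra K B by fact
  note aS = scalar_algebra_algebra[OF K.is_cring]
  interpret S: algebra K "scalar_algebra K" by (rule aS)
  show "signature_values K B \<subseteq> carrier B"
  proof
    fix s assume "s \<in> signature_values K B"
    then obtain n P a where P: "P \<in> algebraic_signature K n" "a \<in> {..<n} \<rightarrow> carrier B" "s = poly_eval K B P a"
      by (auto simp: signature_values_def)
    then obtain l where "lp_over K {..<n} l" "poly_eval K B P a = lp_eval B a l"
      using ex_lp[OF aS B, of P "{..<n}"] unfolding algebraic_signature_def by blast
    then show "s \<in> carrier B" using P B.lp_eval_closed[OF P(2)] by simp
  qed
  let ?e = "\<lambda>i::nat. undefined"
  have "K.indexed_const \<one> \<in> algebraic_signature K 0"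
    unfolding algebraic_signature_def
    by (auto intro: K.indexed_pset.intros simp: S.poly_eval_const[of _ _ "{}"])
  moreover have "poly_eval K B (K.indexed_const \<one>) (?e :: nat \<Rightarrow> 'b) = \<one>\<^bsub>B\<^esub>"
    using B.poly_eval_const[of "\<one>" ?e "{}"] by simp
  ultimately show "\<one>\<^bsub>B\<^esub> \<in> signature_values K B"
    unfolding signature_values_def mem_Collect_eq
    by (intro exI[of _ "0::nat"] exI[of _ "K.indexed_const \<one>"] exI[of _ ?e]) auto
  fix s s' assume "s \<in> signature_values K B" "s' \<in> signature_values K B"
  then obtain n P a n' P' a' where P: "P \<in> algebraic_signature K n" "a \<in> {..<n} \<rightarrow> carrier B" "s = poly_eval K B P a"
    and P': "P' \<in> algebraic_signature K n'" "a' \<in> {..<n'} \<rightarrow> carrier B" "s' = poly_eval K B P' a'"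
    unfolding signature_values_def by blast
  have nz: "\<And>z. z \<in> {..<n} \<rightarrow> carrier K \<Longrightarrow> poly_eval K (scalar_algebra K) P z \<noteq> \<zero>"
    and nz': "\<And>z. z \<in> {..<n'} \<rightarrow> carrier K \<Longrightarrow> poly_eval K (scalar_algebra K) P' z \<noteq> \<zero>"
    using P(1) P'(1) by (auto simp: algebraic_signature_def)
  have Pp: "P \<in> K.indexed_pset {..<n} (carrier K)" "P' \<in> K.indexed_pset {..<n'} (carrier K)"
    using P(1) P'(1) by (auto simp: algebraic_signature_def)
  obtain l where l: "lp_over K {..<n} l"
    "\<forall>z\<in>{..<n} \<rightarrow> carrier (scalar_algebra K). poly_eval K (scalar_algebra K) P z = lp_value K z l"
    "\<forall>z\<in>{..<n} \<rightarrow> carrier B. poly_eval K B P z = lp_eval B z l"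
    using ex_lp[OF aS B Pp(1)] by blast
  obtain l' where l': "lp_over K {..<n'} l'"
    "\<forall>z\<in>{..<n'} \<rightarrow> carrier (scalar_algebra K). poly_eval K (scalar_algebra K) P' z = lp_value K z l'"
    "\<forall>z\<in>{..<n'} \<rightarrow> carrier B. poly_eval K B P' z = lp_eval B z l'"
    using ex_lp[OF aS B Pp(2)] by blast
  let ?I = "{..<n + n'}" and ?l = "lp_rename ((+) n) l'"
  let ?G = "lp_mult K l ?l"
  have "(+) n ` {..<n'} \<subseteq> ?I" by auto
  from lp_over_rename[OF l'(1) this] lp_over_mono[OF l(1), of ?I]
  have o: "lp_over K ?I l" "lp_over K ?I ?l" by auto
  have G: "lp_over K ?I ?G" by (rule lp_over_mult[OF K.is_cring o])
  have "lp_poly K ?G \<in> algebraic_signature K (n + n')"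
    unfolding algebraic_signature_def
  proof (intro CollectI conjI ballI S.lp_poly(1)[OF G])
    fix z assume z: "z \<in> ?I \<rightarrow> carrier K"
    have z': "z \<in> {..<n} \<rightarrow> carrier K" "z \<circ> (+) n \<in> {..<n'} \<rightarrow> carrier K" using z by (auto simp: Pi_iff)
    have "lp_value K z l \<noteq> \<zero>" "lp_value K (z \<circ> (+) n) l' \<noteq> \<zero>"
      using nz[OF z'(1)] nz'[OF z'(2)] l(2) l'(2) z' by auto
    moreover have "lp_value K z l \<in> carrier K" "lp_value K (z \<circ> (+) n) l' \<in> carrier K"
      using S.lp_eval_closed[OF _ l(1), of z] S.lp_eval_closed[OF _ l'(1), of "z \<circ> (+) n"] z' by auto
    ultimately show "poly_eval K (scalar_algebra K) (lp_poly K ?G) z \<noteq> \<zero>"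
      using S.lp_poly(2)[OF G, of z] S.lp_eval_mult[OF _ o, of z] z
      by (simp add: lp_eval_rename K.integral_iff)
  qed
  moreover define b where "b i = (if i < n then a i else a' (i - n))" for i
  have b: "b \<in> ?I \<rightarrow> carrier B" using P(2) P'(2) by (auto simp: b_def Pi_iff)
  have "lp_eval B b l = lp_eval B a l" by (rule lp_eval_cong[OF l(1)]) (simp add: b_def)
  moreover have "lp_eval B (b \<circ> (+) n) l' = lp_eval B a' l'" by (rule lp_eval_cong[OF l'(1)]) (simp add: b_def)
  ultimately have "poly_eval K B (lp_poly K ?G) b = s \<otimes>\<^bsub>B\<^esub> s'"
    using B.lp_poly(2)[OF G b] B.lp_eval_mult[OF b o] l(3) l'(3) P(2,3) P'(2,3) by (simp add: lp_eval_rename)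
  with \<open>lp_poly K ?G \<in> algebraic_signature K (n + n')\<close> b
  show "s \<otimes>\<^bsub>B\<^esub> s' \<in> signature_values K B"
    unfolding signature_values_def by (metis (mono_tags, lifting) mem_Collect_eq)
qed

text \<open>Operations on classes are unions over representatives; such a union collapses once its
  terms are independent of the representative.\<close>

lemma Union_pairs_const:
  assumes "\<And>a s. (a, s) \<in> p \<Longrightarrow> F a s = T" "(a0, s0) \<in> p"
  shows "(\<Union>(a, s)\<in>p. F a s) = T"
proof (intro equalityI subsetI)
  show "x \<in> T" if "x \<in> (\<Union>(a, s)\<in>p. F a s)" for x using that assms(1) by blast
  show "x \<in> (\<Union>(a, s)\<in>p. F a s)" if "x \<in> T" for x
    using that assms(1)[OF assms(2)] assms(2) by blast
qed

section \<open>Arithmetic of fractions\<close>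

locale localise = algebra K B + M: submonoid M B
  for K :: "('k, 'm) ring_scheme" and B :: "('k, 'b, 'n) module_scheme" (structure) and M
begin

lemma M_closed [simp]: "s \<in> M \<Longrightarrow> s \<in> carrier B"
  using M.subset by blast

lemma fraction_rel_equiv: "equiv (carrier B \<times> M) (fraction_rel B M)"
proof (rule equivI)
  show "fraction_rel B M \<subseteq> (carrier B \<times> M) \<times> (carrier B \<times> M)" by (auto simp: fraction_rel_def)
  show "refl_on (carrier B \<times> M) (fraction_rel B M)"
    using M.one_closed by (auto simp: refl_on_def fraction_rel_def)
  show "sym (fraction_rel B M)"
    unfolding sym_def fraction_rel_def by (auto; metis)
  show "trans (fraction_rel B M)"
  proof (rule transI)
    fix p q r assume "(p, q) \<in> fraction_rel B M" "(q, r) \<in> fraction_rel B M"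
    then obtain a s b t c w u v where pqr: "p = (a, s)" "q = (b, t)" "r = (c, w)"
      "a \<in> carrier B" "s \<in> M" "b \<in> carrier B" "t \<in> M" "c \<in> carrier B" "w \<in> M" "u \<in> M" "v \<in> M"
      "u \<otimes> (a \<otimes> t) = u \<otimes> (b \<otimes> s)" "v \<otimes> (b \<otimes> w) = v \<otimes> (c \<otimes> t)"
      by (cases p; cases q; cases r) (auto simp: fraction_rel_def)
    note cl = pqr(4,6,8) M_closed[OF pqr(5)] M_closed[OF pqr(7)] M_closed[OF pqr(9)]
      M_closed[OF pqr(10)] M_closed[OF pqr(11)]
    \<comment> \<open>The middle denominator t enters the multiplier because it may be a zero
      divisor and cannot be cancelled.\<close>
    have "(u \<otimes> v \<otimes> t) \<otimes> (a \<otimes> w) = v \<otimes> w \<otimes> (u \<otimes> (a \<otimes> t))" using cl by algebra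
    also have "\<dots> = u \<otimes> s \<otimes> (v \<otimes> (b \<otimes> w))" unfolding pqr(12) using cl by algebra
    also have "\<dots> = (u \<otimes> v \<otimes> t) \<otimes> (c \<otimes> s)" unfolding pqr(13) using cl by algebra
    finally have "(u \<otimes> v \<otimes> t) \<otimes> (a \<otimes> w) = (u \<otimes> v \<otimes> t) \<otimes> (c \<otimes> s)" .
    moreover have "u \<otimes> v \<otimes> t \<in> M" using pqr M.m_closed by simp
    ultimately show "(p, r) \<in> fraction_rel B M"
      using pqr unfolding fraction_rel_def by auto
  qed
qed

lemma fraction_eq:
  assumes "a \<in> carrier B" "s \<in> M" "b \<in> carrier B" "t \<in> M"
  shows "fraction B M a s = fraction B M b t \<longleftrightarrow> (\<exists>u\<in>M. u \<otimes> (a \<otimes> t) = u \<otimes> (b \<otimes> s))"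
  unfolding fraction_def using assms
  by (subst eq_equiv_class_iff[OF fraction_rel_equiv]) (auto simp: fraction_rel_def)

lemma fraction_mem:
  assumes "a \<in> carrier B" "s \<in> M"
  shows "(b, t) \<in> fraction B M a s \<longleftrightarrow> b \<in> carrier B \<and> t \<in> M \<and> (\<exists>u\<in>M. u \<otimes> (a \<otimes> t) = u \<otimes> (b \<otimes> s))"
  using assms by (auto simp: fraction_def fraction_rel_def)

lemma fraction_self: "a \<in> carrier B \<Longrightarrow> s \<in> M \<Longrightarrow> (a, s) \<in> fraction B M a s"
  using fraction_mem M.one_closed by auto

lemma fraction_carrier: "a \<in> carrier B \<Longrightarrow> s \<in> M \<Longrightarrow> fraction B M a s \<in> carrier (localisation B M)"
  by (auto simp: localisation_def fraction_def intro!: quotientI)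

lemma localisation_cases:
  assumes "p \<in> carrier (localisation B M)"
  obtains a s where "a \<in> carrier B" "s \<in> M" "p = fraction B M a s"
  using assms by (auto simp: localisation_def fraction_def elim!: quotientE)

lemma localisation_mult:
  assumes "a \<in> carrier B" "s \<in> M" "b \<in> carrier B" "t \<in> M"
  shows "fraction B M a s \<otimes>\<^bsub>localisation B M\<^esub> fraction B M b t = fraction B M (a \<otimes> b) (s \<otimes> t)"
proof -
  have *: "fraction B M (a' \<otimes> b') (s' \<otimes> t') = fraction B M (a \<otimes> b) (s \<otimes> t)"
    if as: "(a', s') \<in> fraction B M a s" and bt: "(b', t') \<in> fraction B M b t" for a' s' b' t'
  proof -
    obtain u v where uv: "u \<in> M" "v \<in> M" "a' \<in> carrier B" "s' \<in> M" "b' \<in> carrier B" "t' \<in> M"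
      "u \<otimes> (a \<otimes> s') = u \<otimes> (a' \<otimes> s)" "v \<otimes> (b \<otimes> t') = v \<otimes> (b' \<otimes> t)"
      using as bt assms by (auto simp: fraction_mem)
    note cl = assms(1,3) uv(3,5) M_closed[OF assms(2)] M_closed[OF assms(4)] M_closed[OF uv(4)]
      M_closed[OF uv(6)] M_closed[OF uv(1)] M_closed[OF uv(2)]
    have "(u \<otimes> v) \<otimes> ((a' \<otimes> b') \<otimes> (s \<otimes> t)) = (u \<otimes> (a' \<otimes> s)) \<otimes> (v \<otimes> (b' \<otimes> t))" using cl by algebra
    also have "\<dots> = (u \<otimes> v) \<otimes> ((a \<otimes> b) \<otimes> (s' \<otimes> t'))" unfolding uv(7,8)[symmetric] using cl by algebra
    finally show ?thesis using assms uv M.m_closed by (subst fraction_eq) auto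
  qed
  show ?thesis
    unfolding localisation_def ring_record_simps
    by (rule Union_pairs_const[OF Union_pairs_const[OF *]])
      (assumption | rule fraction_self[OF assms(1,2)] fraction_self[OF assms(3,4)])+
qed

lemma localisation_add:
  assumes "a \<in> carrier B" "s \<in> M" "b \<in> carrier B" "t \<in> M"
  shows "fraction B M a s \<oplus>\<^bsub>localisation B M\<^esub> fraction B M b t =
    fraction B M (a \<otimes> t \<oplus> b \<otimes> s) (s \<otimes> t)"
proof -
  have *: "fraction B M (a' \<otimes> t' \<oplus> b' \<otimes> s') (s' \<otimes> t') = fraction B M (a \<otimes> t \<oplus> b \<otimes> s) (s \<otimes> t)"
    if as: "(a', s') \<in> fraction B M a s" and bt: "(b', t') \<in> fraction B M b t" for a' s' b' t'
  proof -
    obtain u v where uv: "u \<in> M" "v \<in> M" "a' \<in> carrier B" "s' \<in> M" "b' \<in> carrier B" "t' \<in> M"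
      "u \<otimes> (a \<otimes> s') = u \<otimes> (a' \<otimes> s)" "v \<otimes> (b \<otimes> t') = v \<otimes> (b' \<otimes> t)"
      using as bt assms by (auto simp: fraction_mem)
    note cl = assms(1,3) uv(3,5) M_closed[OF assms(2)] M_closed[OF assms(4)] M_closed[OF uv(4)]
      M_closed[OF uv(6)] M_closed[OF uv(1)] M_closed[OF uv(2)]
    have "(u \<otimes> v) \<otimes> ((a' \<otimes> t' \<oplus> b' \<otimes> s') \<otimes> (s \<otimes> t)) =
      (v \<otimes> t' \<otimes> t) \<otimes> (u \<otimes> (a' \<otimes> s)) \<oplus> (u \<otimes> s' \<otimes> s) \<otimes> (v \<otimes> (b' \<otimes> t))" using cl by algebra
    also have "\<dots> = (u \<otimes> v) \<otimes> ((a \<otimes> t \<oplus> b \<otimes> s) \<otimes> (s' \<otimes> t'))"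
      unfolding uv(7,8)[symmetric] using cl by algebra
    finally show ?thesis using assms uv M.m_closed by (subst fraction_eq) auto
  qed
  show ?thesis
    unfolding localisation_def ring_record_simps
    by (rule Union_pairs_const[OF Union_pairs_const[OF *]])
      (assumption | rule fraction_self[OF assms(1,2)] fraction_self[OF assms(3,4)])+
qed

lemma localisation_smult:
  assumes "k \<in> carrier K" "a \<in> carrier B" "s \<in> M"
  shows "k \<odot>\<^bsub>localisation B M\<^esub> fraction B M a s = fraction B M (k \<odot> a) s"
proof -
  have *: "fraction B M (k \<odot> a') s' = fraction B M (k \<odot> a) s" if as: "(a', s') \<in> fraction B M a s" for a' s'
  proof -
    obtain u where u: "u \<in> M" "a' \<in> carrier B" "s' \<in> M" "u \<otimes> (a \<otimes> s') = u \<otimes> (a' \<otimes> s)"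
      using as assms by (auto simp: fraction_mem)
    have "u \<otimes> ((k \<odot> b) \<otimes> t) = k \<odot> (u \<otimes> (b \<otimes> t))" if "b \<in> carrier B" "t \<in> M" for b t
      using that u assms by (simp add: smult_assoc2 m_comm[of u])
    then show ?thesis using assms u by (subst fraction_eq) (auto intro!: bexI[of _ u])
  qed
  show ?thesis
    unfolding localisation_def module.simps
    by (rule Union_pairs_const[OF *]) (assumption | rule fraction_self[OF assms(2,3)])+
qed

end

text \<open>\<open>j\<close> is the canonical map b/1 followed by the inverse of the isomorphism.
  Identities in \<open>A\<close> are checked after applying the injective \<open>f\<close>; the
  algebra laws come from \<open>A\<close>, so they are not verified for the set of
  fractions.\<close>

lemma essential_of_special_localisation:
  fixes K :: "('k, 'm) ring_scheme" (structure) and A :: "('k, 'a, 'n) module_scheme"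
    and B :: "('k, 'b, 'p) module_scheme"
  assumes K: "field K" and A: "algebra K A" and fg: "finitely_generated_algebra K B"
    and iso: "alg_isomorphic K A (canonical_localisation K B)" and special: "special K A"
  shows "essential K A"
proof -
  have B: "algebra K B" using fg by (simp add: finitely_generated_algebra_def)
  let ?M = "signature_values K B"
  let ?L = "localisation B ?M"
  interpret K: field K by fact
  interpret A: algebra K A by fact
  interpret L: localise K B ?M
    using B signature_values_submonoid[OF K B] by (simp add: localise_def)
  obtain f where f: "f \<in> alg_hom K A ?L" "bij_betw f (carrier A) (carrier ?L)"
    using iso unfolding alg_isomorphic_def canonical_localisation_def by blast
  note fh = alg_homD[OF f(1)] and inj = bij_betw_imp_inj_on[OF f(2)]
  define g where "g = inv_into (carrier A) f"
  have g: "g p \<in> carrier A" "f (g p) = p" if "p \<in> carrier ?L" for p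
    using that inv_into_into[of p f "carrier A"] f_inv_into_f[of p f "carrier A"]
    unfolding g_def bij_betw_imp_surj_on[OF f(2)] by blast+
  have eqI: "x = y" if "x \<in> carrier A" "y \<in> carrier A" "f x = f y" for x y
    using inj_onD[OF inj] that by blast
  let ?fr = "fraction B ?M"
  have 1: "\<one>\<^bsub>B\<^esub> \<in> ?M" by (rule L.M.one_closed)
  define j where "j b = g (?fr b \<one>\<^bsub>B\<^esub>)" for b
  have j: "j b \<in> carrier A" "f (j b) = ?fr b \<one>\<^bsub>B\<^esub>" if "b \<in> carrier B" for b
    using g L.fraction_carrier[OF that 1] by (auto simp: j_def)
  have f1: "f \<one>\<^bsub>A\<^esub> = ?fr \<one>\<^bsub>B\<^esub> \<one>\<^bsub>B\<^esub>" using fh(4) by (simp add: localisation_def)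
  have jh: "j \<in> alg_hom K B A"
    unfolding alg_hom_def ring_hom_def
  proof safe
    show "j \<one>\<^bsub>B\<^esub> = \<one>\<^bsub>A\<^esub>" using f1 j by (intro eqI) auto
    fix b assume b: "b \<in> carrier B"
    show "j b \<in> carrier A" by (rule j(1)[OF b])
    show "j (k \<odot>\<^bsub>B\<^esub> b) = k \<odot>\<^bsub>A\<^esub> j b" if "k \<in> carrier K" for k
      using that b j fh(5) L.localisation_smult[OF that b 1] by (intro eqI) auto
    fix b' assume b': "b' \<in> carrier B"
    show "j (b \<otimes>\<^bsub>B\<^esub> b') = j b \<otimes>\<^bsub>A\<^esub> j b'"
      using b b' j fh(2) L.localisation_mult[OF b 1 b' 1] by (intro eqI) auto
    show "j (b \<oplus>\<^bsub>B\<^esub> b') = j b \<oplus>\<^bsub>A\<^esub> j b'"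
      using b b' j fh(3) L.localisation_add[OF b 1 b' 1] by (intro eqI) auto
  qed
  have cancel: "?fr (a \<otimes>\<^bsub>B\<^esub> s) s = ?fr a \<one>\<^bsub>B\<^esub>" if "a \<in> carrier B" "s \<in> ?M" for a s
    using that 1 by (subst L.fraction_eq) (auto intro!: bexI[of _ "\<one>\<^bsub>B\<^esub>"])
  show ?thesis
  proof (rule essential_of_special[OF K A fg jh _ _ _ _ _ special])
    show "?M \<subseteq> carrier B" by auto
    fix x assume x: "x \<in> carrier A"
    then obtain a s where as: "a \<in> carrier B" "s \<in> ?M" "f x = ?fr a s"
      using L.localisation_cases[OF fh(1)] by blast
    have "f (x \<otimes>\<^bsub>A\<^esub> j s) = ?fr (a \<otimes>\<^bsub>B\<^esub> s) s"
      using as x j fh(2) L.localisation_mult[OF as(1,2) L.M_closed[OF as(2)] 1] by simp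
    then have "x \<otimes>\<^bsub>A\<^esub> j s = j a" using cancel[OF as(1,2)] as x j by (intro eqI) auto
    then show "\<exists>b\<in>carrier B. \<exists>s\<in>?M. x \<otimes>\<^bsub>A\<^esub> j s = j b" using as by blast
  next
    fix s assume s: "s \<in> ?M"
    let ?y = "g (?fr \<one>\<^bsub>B\<^esub> s)"
    have y: "?y \<in> carrier A" "f ?y = ?fr \<one>\<^bsub>B\<^esub> s" using g L.fraction_carrier[OF _ s] by auto
    have "f (?y \<otimes>\<^bsub>A\<^esub> j s) = ?fr (\<one>\<^bsub>B\<^esub> \<otimes>\<^bsub>B\<^esub> s) s"
      using y j s fh(2) L.localisation_mult[OF L.one_closed s L.M_closed[OF s] 1] by simp
    then have "?y \<otimes>\<^bsub>A\<^esub> j s = \<one>\<^bsub>A\<^esub>" using cancel[OF L.one_closed s] f1 y j s by (intro eqI) auto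
    moreover from this have "j s \<otimes>\<^bsub>A\<^esub> ?y = \<one>\<^bsub>A\<^esub>" using y j s by (simp add: A.m_comm)
    ultimately show "j s \<in> Units A" using y(1) j(1)[OF L.M_closed[OF s]] unfolding Units_def by blast
  next
    fix b assume b: "b \<in> carrier B" "j b = \<zero>\<^bsub>A\<^esub>"
    then have "j b = j \<zero>\<^bsub>B\<^esub>" using alg_hom_zero[OF jh B A] by simp
    then have "?fr b \<one>\<^bsub>B\<^esub> = ?fr \<zero>\<^bsub>B\<^esub> \<one>\<^bsub>B\<^esub>" using j(2)[OF b(1)] j(2)[OF L.zero_closed] by simp
    then show "\<exists>u\<in>?M. u \<otimes>\<^bsub>B\<^esub> b = \<zero>\<^bsub>B\<^esub>" using b 1 by (subst (asm) L.fraction_eq) auto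
  next
    fix \<phi> s assume \<phi>: "\<phi> \<in> points K B" and "s \<in> ?M"
    then obtain n P a where P: "P \<in> algebraic_signature K n" "a \<in> {..<n} \<rightarrow> carrier B" "s = poly_eval K B P a"
      unfolding signature_values_def by blast
    have "\<phi> s = poly_eval K (scalar_algebra K) P (\<phi> \<circ> a)"
      unfolding P(3) using P(1)
      by (intro poly_eval_alg_hom[OF B scalar_algebra_algebra[OF K.is_cring] _ \<phi> P(2)])
        (simp add: algebraic_signature_def)
    moreover have "\<phi> \<circ> a \<in> {..<n} \<rightarrow> carrier K" using P(2) alg_homD(1)[OF \<phi>] by (auto simp: Pi_iff)
    ultimately show "\<phi> s \<noteq> \<zero>" using P(1) by (auto simp: algebraic_signature_def)
  qed
qed

theorem corollary5p6:
  fixes K :: "('k, 'm) ring_scheme" and A :: "('k, 'a, 'n) module_scheme"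
  assumes "field K" and "algebra K A"
    and "finitely_generated_algebra K A \<or> finite_star_type TYPE('b) K A"
  shows "special K A \<longleftrightarrow> essential K A"
proof
  interpret K: field K by fact
  interpret A: algebra K A by fact
  assume special: "special K A"
  from assms(3) show "essential K A"
  proof
    assume fg: "finitely_generated_algebra K A"
    have "(\<lambda>x. x) \<in> alg_hom K A A" by (auto simp: alg_hom_def ring_hom_def)
    then show ?thesis
    \<comment> \<open>\<open>A\<close> is regarded as its own localisation at {1}; this choice of
      \<open>M\<close> is fixed by the first subgoal that names it.\<close>
    proof (rule essential_of_special[OF assms(1,2) fg _ _ _ _ _ _ special])
      fix \<phi> s assume "\<phi> \<in> points K A" "s \<in> {\<one>\<^bsub>A\<^esub>}"
      then show "\<phi> s \<noteq> \<zero>\<^bsub>K\<^esub>" using alg_homD(4) by fastforce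
    qed auto
  next
    assume "finite_star_type TYPE('b) K A"
    then show ?thesis
      using essential_of_special_localisation[OF assms(1,2) _ _ special]
      unfolding finite_star_type_def by blast
  qed
qed (rule special_of_essential[OF assms(1,2)])

end
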